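(* In the setting described in the context, let $m\ge 1$ be an integer and suppose $f\in\mathcal S'$. If property $(S)$ and condition (BP) hold, then there exist $\nu=\nu(f)\in\mathbb N$, $\rho_f\in\mathcal P$, and a sequence $(\rho_k)\subset\mathcal P_\nu$ such that $$f-\rho_f=\frac1{(m-1)!}\lim_{k\to\infty}\bigg(\int_0^k(t\mathcal L)^mT_tf\,\frac{dt}t+\rho_k\bigg)\qquad\text{in }\mathcal S'.$$
   Context: Setting. $(M,d,\mu)$ is a second countable, locally compact, connected metric measure space with $\mu(M)=\infty$; $\mu$ is a positive Radon measure and there are constants $c_0,\mathbf d>0$ with $\inf_{x\in M}\mu(B(x,1))\ge c_0^{-1}$ and $\mu(B(x,Rr))\le c_0R^{\mathbf d}\mu(B(x,r))$ for all $x\in M$, $r>0$, $R\ge 1$, where $B(x,r)$ is the $d$-ball. All functions are real valued and $L^p=L^p(\mu)$ with norm $\|\cdot\|_p$. $\mathcal L$ is a non-negative self-adjoint operator on $L^2$, mapping real-valued to real-valued functions, generating a positivity preserving, contractive, symmetric semigroup $T_t=e^{-t\mathcal L}$ on $L^2$ with $T_t1=1$ for all $t>0$. Write $V_t(x,y)=(\mu(B(x,\sqrt t))\mu(B(y,\sqrt t)))^{1/2}$. The integral kernel $H_t(x,y)$ of $T_t$ satisfies: (a) there are $C,b_0,b_1>0$ with $C^{-1}V_t(x,y)^{-1}e^{-b_0d(x,y)^2/t}\le H_t(x,y)\le C\,V_t(x,y)^{-1}e^{-b_1d(x,y)^2/t}$ for all $x,y\in M$, $t>0$; (b) there are $C,a,b_2>0$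 with $|H_t(x,y)-H_t(x,y')|\le C(d(y,y')/\sqrt t)^aV_t(x,y)^{-1}e^{-b_2d(x,y)^2/t}$ whenever $d(y,y')\le\sqrt t$; (c) for every integer $k\ge 0$ there are $C,\delta>0$ with $|\partial_t^kH_t(x,y)|\le Ct^{-k}V_t(x,y)^{-1}e^{-\delta d(x,y)^2/t}$ for all $x,y\in M$, $t>0$. In addition, $M$ is a smooth manifold endowed with a family $\mathfrak X=\{X_1,\dots,X_\kappa\}$ of smooth vector fields, $\mathcal L=-\sum_{j=1}^\kappa X_j^2$, the heat kernel $H_t(x,y)$ is smooth jointly in $t>0$ and $x,y\in M$, and, with $\mathcal I=\{1,\dots,\kappa\}$ and $X_I=X_{I_1}\cdots X_{I_h}$ for $I\in\mathcal I^h$ (identity if $h=0$), for all $h,k\in\mathbb N=\{0,1,\dots\}$ there are $C,c>0$ such that $|(X_J)_y(X_I)_xH_t(x,y)|\le Ct^{-(h+k)/2}V_t(x,y)^{-1}e^{-c\,d(x,y)^2/t}$ for all $x,y\in M$, $t>0$, $I\in\mathcal I^h$, $J\in\mathcal I^k$. Distributions and polynomials. Fix $x_0\in M$, put $d(x)=d(x,x_0)$. $\mathcal S$ is the Fréchet space of $\phi\in L^2$ such that $\mathcal L^n\phi\in L^2$ and $p_n(\phi)=\|(1+d(\cdot))^n\max_{0\le k\le n}|\mathcal L^k\phi|\|_\infty<\infty$ for all $n\in\mathbb N$, with seminorms $p_n$; $\mathcal S'$ is its topological dual with the weak topology. $\mathcal L^k$ and $T_t$ preserve $\mathcal S$ and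 act on $\mathcal S'$ by duality. The operators $X_J$ are continuous on $\mathcal S$ and act on $\mathcal S'$ by duality, in the usual distributional sense (consistently with their pointwise action on smooth functions). Put $\mathcal P_k=\{\rho\in\mathcal S':\mathcal L^k\rho=0\}$, $\mathcal P=\bigcup_k\mathcal P_k$ (polynomials). Integrals of $\mathcal S'$-valued functions of $t$ are understood weakly, i.e. after pairing with each $\phi\in\mathcal S$. Property $(S)$: for all $n\in\mathbb N$ there exists $\nu\in\mathbb N$ such that, for all sequences $(f_k)_{k\in\mathbb N}$ in $\mathcal S'$ such that $(X_Jf_k)_{k\in\mathbb N}$ converges in $\mathcal S'$ for all $J\in\mathcal I^n$, there exists a sequence $(\rho_k)_{k\in\mathbb N}$ in $\mathcal P_\nu$ such that $(f_k+\rho_k)_{k\in\mathbb N}$ converges in $\mathcal S'$. Condition (BP): for every $h\in\mathbb N$ there are constants $C,c>0$ such that $|T_tX_J\phi|\le Ct^{-h/2}T_{ct}|\phi|$ pointwise for all $t>0$, $J\in\mathcal I^h$ and $\phi\in\mathcal S$. *)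

theory Defs
  imports "HOL-Analysis.Analysis" "HOL-Probability.Essential_Supremum"
begin

section \<open>Radon measures and the volume growth hypotheses\<close>

definition radon_measure :: "'a::topological_space measure \<Rightarrow> bool" where
  "radon_measure \<mu> \<longleftrightarrow>
     sets \<mu> = sets borel \<and>
     (\<forall>K. compact K \<longrightarrow> emeasure \<mu> K < \<infinity>) \<and>
     (\<forall>B \<in> sets borel. emeasure \<mu> B = (INF U \<in> {U. open U \<and> B \<subseteq> U}. emeasure \<mu> U)) \<and>
     (\<forall>U. open U \<longrightarrow> emeasure \<mu> U = (SUP K \<in> {K. compact K \<and> K \<subseteq> U}. emeasure \<mu> K))"

definition vol :: "'a::metric_space measure \<Rightarrow> real \<Rightarrow> 'a \<Rightarrow> 'a \<Rightarrow> real" where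
  "vol \<mu> t x y = sqrt (measure \<mu> (ball x (sqrt t)) * measure \<mu> (ball y (sqrt t)))"

locale doubling_space =
  fixes \<mu> :: "'a::{metric_space, second_countable_topology} measure"
  assumes locally_compact: "locally compact (UNIV :: 'a set)"
    and connected: "connected (UNIV :: 'a set)"
    and radon: "radon_measure \<mu>"
    and infinite_mass: "emeasure \<mu> UNIV = \<infinity>"
    and volume: "\<exists>c\<^sub>0>0. \<exists>dd>0.
        (INF x. emeasure \<mu> (ball x 1)) \<ge> ennreal (1 / c\<^sub>0) \<and>
        (\<forall>x. \<forall>r>0. \<forall>R\<ge>1.
           emeasure \<mu> (ball x (R * r)) \<le> ennreal (c\<^sub>0 * R powr dd) * emeasure \<mu> (ball x r))"


section \<open>Operators and semigroups on real \<open>L\<^sup>2\<close>\<close>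

text \<open>
  Elements of \<open>L\<^sup>2\<close> are represented by functions, and equality in \<open>L\<^sup>2\<close> is equality almost
  everywhere. An operator is a domain \<open>D\<close> (closed under a.e. equality) together with a map \<open>A\<close>
  on representatives whose values outside \<open>D\<close> carry no meaning.
\<close>

definition L2 :: "'a measure \<Rightarrow> ('a \<Rightarrow> real) set" where
  "L2 \<mu> = {u \<in> borel_measurable \<mu>. integrable \<mu> (\<lambda>x. (u x)\<^sup>2)}"

definition l2_inner :: "'a measure \<Rightarrow> ('a \<Rightarrow> real) \<Rightarrow> ('a \<Rightarrow> real) \<Rightarrow> real" where
  "l2_inner \<mu> u v = (\<integral>x. u x * v x \<partial>\<mu>)"

definition l2_norm :: "'a measure \<Rightarrow> ('a \<Rightarrow> real) \<Rightarrow> real" where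
  "l2_norm \<mu> u = sqrt (l2_inner \<mu> u u)"

definition linear_ae_on ::
    "'a measure \<Rightarrow> ('a \<Rightarrow> real) set \<Rightarrow> (('a \<Rightarrow> real) \<Rightarrow> 'a \<Rightarrow> real) \<Rightarrow> bool" where
  "linear_ae_on \<mu> D A \<longleftrightarrow>
     (\<forall>u\<in>D. \<forall>v\<in>D. (\<lambda>x. u x + v x) \<in> D \<and>
        (AE x in \<mu>. A (\<lambda>x. u x + v x) x = A u x + A v x)) \<and>
     (\<forall>u\<in>D. \<forall>c. (\<lambda>x. c * u x) \<in> D \<and> (AE x in \<mu>. A (\<lambda>x. c * u x) x = c * A u x))"

definition l2_operator ::
    "'a measure \<Rightarrow> ('a \<Rightarrow> real) set \<Rightarrow> (('a \<Rightarrow> real) \<Rightarrow> 'a \<Rightarrow> real) \<Rightarrow> bool" where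
  "l2_operator \<mu> D A \<longleftrightarrow>
     D \<subseteq> L2 \<mu> \<and> A ` D \<subseteq> L2 \<mu> \<and>
     (\<forall>u\<in>D. \<forall>v\<in>L2 \<mu>. (AE x in \<mu>. u x = v x) \<longrightarrow> v \<in> D \<and> (AE x in \<mu>. A u x = A v x)) \<and>
     linear_ae_on \<mu> D A"

text \<open>The second conjunct says that the graph of \<open>A\<close> equals the graph of its adjoint.\<close>

definition l2_self_adjoint ::
    "'a measure \<Rightarrow> ('a \<Rightarrow> real) set \<Rightarrow> (('a \<Rightarrow> real) \<Rightarrow> 'a \<Rightarrow> real) \<Rightarrow> bool" where
  "l2_self_adjoint \<mu> D A \<longleftrightarrow>
     (\<forall>u\<in>L2 \<mu>. \<forall>\<epsilon>>0. \<exists>v\<in>D. l2_norm \<mu> (\<lambda>x. u x - v x) < \<epsilon>) \<and>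
     (\<forall>u\<in>L2 \<mu>. \<forall>w\<in>L2 \<mu>.
        (u \<in> D \<and> (AE x in \<mu>. A u x = w x)) \<longleftrightarrow> (\<forall>v\<in>D. l2_inner \<mu> u (A v) = l2_inner \<mu> w v))"

text \<open>
  \<open>T t = exp (-t A)\<close>: \<open>T\<close> is the strongly continuous contraction semigroup whose
  infinitesimal generator is \<open>-A\<close>.
\<close>

definition l2_contraction_semigroup ::
    "'a measure \<Rightarrow> ('a \<Rightarrow> real) set \<Rightarrow> (('a \<Rightarrow> real) \<Rightarrow> 'a \<Rightarrow> real)
      \<Rightarrow> (real \<Rightarrow> ('a \<Rightarrow> real) \<Rightarrow> 'a \<Rightarrow> real) \<Rightarrow> bool" where
  "l2_contraction_semigroup \<mu> D A T \<longleftrightarrow>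
     (\<forall>t\<ge>0. l2_operator \<mu> (L2 \<mu>) (T t)) \<and>
     (\<forall>t\<ge>0. \<forall>u\<in>L2 \<mu>. l2_norm \<mu> (T t u) \<le> l2_norm \<mu> u) \<and>
     (\<forall>u\<in>L2 \<mu>. AE x in \<mu>. T 0 u x = u x) \<and>
     (\<forall>s\<ge>0. \<forall>t\<ge>0. \<forall>u\<in>L2 \<mu>. AE x in \<mu>. T (s + t) u x = T s (T t u) x) \<and>
     (\<forall>u\<in>L2 \<mu>. ((\<lambda>t. l2_norm \<mu> (\<lambda>x. T t u x - u x)) \<longlongrightarrow> 0) (at_right 0)) \<and>
     (\<forall>u\<in>L2 \<mu>. \<forall>w\<in>L2 \<mu>.
        (u \<in> D \<and> (AE x in \<mu>. - A u x = w x)) \<longleftrightarrow>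
        ((\<lambda>h. l2_norm \<mu> (\<lambda>x. (T h u x - u x) / h - w x)) \<longlongrightarrow> 0) (at_right 0))"


section \<open>The heat semigroup and its kernel\<close>

text \<open>
  In \<open>conservative\<close>, the constant function is not in \<open>L\<^sup>2\<close>, and \<open>T t 1\<close> is given by the integral
  kernel.
\<close>

locale heat_semigroup = doubling_space \<mu>
  for \<mu> :: "'a::{metric_space, second_countable_topology} measure" +
  fixes D :: "('a \<Rightarrow> real) set"
    and L :: "('a \<Rightarrow> real) \<Rightarrow> 'a \<Rightarrow> real"
    and T :: "real \<Rightarrow> ('a \<Rightarrow> real) \<Rightarrow> 'a \<Rightarrow> real"
    and H :: "real \<Rightarrow> 'a \<Rightarrow> 'a \<Rightarrow> real"
  assumes L_operator: "l2_operator \<mu> D L"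
    and L_self_adjoint: "l2_self_adjoint \<mu> D L"
    and L_nonneg: "\<And>u. u \<in> D \<Longrightarrow> l2_inner \<mu> (L u) u \<ge> 0"
    and T_semigroup: "l2_contraction_semigroup \<mu> D L T"
    and T_symmetric: "\<And>t u v. t > 0 \<Longrightarrow> u \<in> L2 \<mu> \<Longrightarrow> v \<in> L2 \<mu> \<Longrightarrow>
        l2_inner \<mu> (T t u) v = l2_inner \<mu> u (T t v)"
    and T_positive: "\<And>t u. t > 0 \<Longrightarrow> u \<in> L2 \<mu> \<Longrightarrow> AE x in \<mu>. u x \<ge> 0 \<Longrightarrow>
        AE x in \<mu>. T t u x \<ge> 0"
    and kernel: "\<And>t u. t > 0 \<Longrightarrow> u \<in> L2 \<mu> \<Longrightarrow>
        AE x in \<mu>. T t u x = (\<integral>y. H t x y * u y \<partial>\<mu>)"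
    and conservative: "\<And>t. t > 0 \<Longrightarrow> AE x in \<mu>. (\<integral>y. H t x y \<partial>\<mu>) = 1"
    and gaussian_bounds: "\<exists>C>0. \<exists>b\<^sub>0>0. \<exists>b\<^sub>1>0. \<forall>x y. \<forall>t>0.
        1 / C * (1 / vol \<mu> t x y) * exp (- b\<^sub>0 * (dist x y)\<^sup>2 / t) \<le> H t x y \<and>
        H t x y \<le> C * (1 / vol \<mu> t x y) * exp (- b\<^sub>1 * (dist x y)\<^sup>2 / t)"
    and hoelder_bound: "\<exists>C>0. \<exists>a>0. \<exists>b\<^sub>2>0. \<forall>x y y'. \<forall>t>0. dist y y' \<le> sqrt t \<longrightarrow>
        \<bar>H t x y - H t x y'\<bar> \<le>
          C * (dist y y' / sqrt t) powr a * (1 / vol \<mu> t x y) * exp (- b\<^sub>2 * (dist x y)\<^sup>2 / t)"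
    and time_derivative_bounds: "\<And>k. \<exists>C>0. \<exists>\<delta>>0. \<forall>x y. \<forall>t>0.
        \<bar>(deriv ^^ k) (\<lambda>s. H s x y) t\<bar> \<le>
          C * t powr (- real k) * (1 / vol \<mu> t x y) * exp (- \<delta> * (dist x y)\<^sup>2 / t)"


section \<open>Smooth manifolds and vector fields\<close>

text \<open>The following is used for open \<open>S\<close> only.\<close>

primrec Ck_on :: "nat \<Rightarrow> 'e::real_normed_vector set \<Rightarrow> ('e \<Rightarrow> 'f::real_normed_vector) \<Rightarrow> bool" where
  "Ck_on 0 S f \<longleftrightarrow> continuous_on S f"
| "Ck_on (Suc k) S f \<longleftrightarrow>
     (\<forall>x\<in>S. f differentiable (at x)) \<and> (\<forall>v. Ck_on k S (\<lambda>x. frechet_derivative f (at x) v))"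

definition smooth_on :: "'e::real_normed_vector set \<Rightarrow> ('e \<Rightarrow> 'f::real_normed_vector) \<Rightarrow> bool" where
  "smooth_on S f \<longleftrightarrow> (\<forall>k. Ck_on k S f)"

text \<open>
  The smooth structure is given by an atlas of pairs \<open>(U, \<phi>)\<close> of a domain and a coordinate map.
\<close>

definition smooth_atlas :: "('a::topological_space set \<times> ('a \<Rightarrow> 'e::euclidean_space)) set \<Rightarrow> bool" where
  "smooth_atlas \<A> \<longleftrightarrow>
     (\<forall>(U, \<phi>) \<in> \<A>. open U \<and> open (\<phi> ` U) \<and> homeomorphism U (\<phi> ` U) \<phi> (inv_into U \<phi>)) \<and>
     (\<Union>(U, \<phi>) \<in> \<A>. U) = UNIV \<and>
     (\<forall>(U, \<phi>) \<in> \<A>. \<forall>(V, \<psi>) \<in> \<A>. smooth_on (\<phi> ` (U \<inter> V)) (\<lambda>u. \<psi> (inv_into U \<phi> u)))"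

definition smooth_fun ::
    "('a::topological_space set \<times> ('a \<Rightarrow> 'e::euclidean_space)) set \<Rightarrow> ('a \<Rightarrow> real) \<Rightarrow> bool" where
  "smooth_fun \<A> f \<longleftrightarrow> (\<forall>(U, \<phi>) \<in> \<A>. smooth_on (\<phi> ` U) (\<lambda>u. f (inv_into U \<phi> u)))"

definition smooth_kernel ::
    "('a::topological_space set \<times> ('a \<Rightarrow> 'e::euclidean_space)) set
      \<Rightarrow> (real \<Rightarrow> 'a \<Rightarrow> 'a \<Rightarrow> real) \<Rightarrow> bool" where
  "smooth_kernel \<A> H \<longleftrightarrow>
     (\<forall>(U, \<phi>) \<in> \<A>. \<forall>(V, \<psi>) \<in> \<A>.
        smooth_on ({0<..} \<times> \<phi> ` U \<times> \<psi> ` V)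
          (\<lambda>(t, u, v). H t (inv_into U \<phi> u) (inv_into V \<psi> v)))"

text \<open>
  Tangent vectors at \<open>p\<close> are derivations at \<open>p\<close> of the algebra of smooth functions; their values
  on functions that are not smooth carry no meaning.
\<close>

definition tangent_vector ::
    "('a::topological_space set \<times> ('a \<Rightarrow> 'e::euclidean_space)) set \<Rightarrow> 'a
      \<Rightarrow> (('a \<Rightarrow> real) \<Rightarrow> real) \<Rightarrow> bool" where
  "tangent_vector \<A> p v \<longleftrightarrow>
     (\<forall>f g. smooth_fun \<A> f \<longrightarrow> smooth_fun \<A> g \<longrightarrow>
        v (\<lambda>x. f x + g x) = v f + v g \<and>
        v (\<lambda>x. f x * g x) = f p * v g + g p * v f) \<and>
     (\<forall>f c. smooth_fun \<A> f \<longrightarrow> v (\<lambda>x. c * f x) = c * v f)"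

definition smooth_vector_field ::
    "('a::topological_space set \<times> ('a \<Rightarrow> 'e::euclidean_space)) set
      \<Rightarrow> ('a \<Rightarrow> ('a \<Rightarrow> real) \<Rightarrow> real) \<Rightarrow> bool" where
  "smooth_vector_field \<A> X \<longleftrightarrow>
     (\<forall>p. tangent_vector \<A> p (X p)) \<and> (\<forall>f. smooth_fun \<A> f \<longrightarrow> smooth_fun \<A> (\<lambda>p. X p f))"

definition multi_indices :: "nat \<Rightarrow> nat \<Rightarrow> nat list set" where
  "multi_indices \<kappa> h = {I. set I \<subseteq> {1..\<kappa>} \<and> length I = h}"

text \<open>\<open>iterated X [i\<^sub>1, \<dots>, i\<^sub>h] f = X\<^sub>i\<^sub>1 (\<dots> (X\<^sub>i\<^sub>h f))\<close>\<close>

definition iterated :: "(nat \<Rightarrow> 'f \<Rightarrow> 'f) \<Rightarrow> nat list \<Rightarrow> 'f \<Rightarrow> 'f" where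
  "iterated X I f = foldr X I f"

definition vf_action :: "(nat \<Rightarrow> 'a \<Rightarrow> ('a \<Rightarrow> real) \<Rightarrow> real) \<Rightarrow> nat \<Rightarrow> ('a \<Rightarrow> real) \<Rightarrow> 'a \<Rightarrow> real" where
  "vf_action X j f = (\<lambda>p. X j p f)"

text \<open>
  The self-adjoint operator \<open>L\<close> is (an extension of) the differential operator
  \<open>- (X\<^sub>1\<^sup>2 + \<dots> + X\<^sub>\<kappa>\<^sup>2)\<close> on smooth functions with compact support.
\<close>

locale heat_manifold = heat_semigroup \<mu> D L T H
  for \<mu> :: "'a::{metric_space, second_countable_topology} measure"
    and D :: "('a \<Rightarrow> real) set"
    and L :: "('a \<Rightarrow> real) \<Rightarrow> 'a \<Rightarrow> real"
    and T :: "real \<Rightarrow> ('a \<Rightarrow> real) \<Rightarrow> 'a \<Rightarrow> real"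
    and H :: "real \<Rightarrow> 'a \<Rightarrow> 'a \<Rightarrow> real" +
  fixes \<A> :: "('a set \<times> ('a \<Rightarrow> 'e::euclidean_space)) set"
    and \<kappa> :: nat
    and X :: "nat \<Rightarrow> 'a \<Rightarrow> ('a \<Rightarrow> real) \<Rightarrow> real"
  assumes atlas: "smooth_atlas \<A>"
    and vector_fields: "\<And>j. j \<in> {1..\<kappa>} \<Longrightarrow> smooth_vector_field \<A> (X j)"
    and L_sum_of_squares: "\<And>\<phi>. smooth_fun \<A> \<phi> \<Longrightarrow> compact (closure {x. \<phi> x \<noteq> 0}) \<Longrightarrow>
        \<phi> \<in> D \<and>
        (AE x in \<mu>. L \<phi> x = - (\<Sum>j\<in>{1..\<kappa>}. vf_action X j (vf_action X j \<phi>) x))"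
    and kernel_smooth: "smooth_kernel \<A> H"
    and kernel_derivative_bounds: "\<And>h k. \<exists>C>0. \<exists>c>0. \<forall>x y. \<forall>t>0.
        \<forall>I \<in> multi_indices \<kappa> h. \<forall>J \<in> multi_indices \<kappa> k.
          \<bar>iterated (vf_action X) J (\<lambda>y. iterated (vf_action X) I (\<lambda>x. H t x y) x) y\<bar> \<le>
            C * t powr (- real (h + k) / 2) * (1 / vol \<mu> t x y) * exp (- c * (dist x y)\<^sup>2 / t)"


section \<open>Test functions, distributions and polynomials\<close>

definition schwartz_seminorm ::
    "'a::metric_space measure \<Rightarrow> (('a \<Rightarrow> real) \<Rightarrow> 'a \<Rightarrow> real) \<Rightarrow> 'a \<Rightarrow> nat
      \<Rightarrow> ('a \<Rightarrow> real) \<Rightarrow> ereal" where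
  "schwartz_seminorm \<mu> L x\<^sub>0 n \<phi> =
     esssup \<mu> (\<lambda>x. ereal ((1 + dist x x\<^sub>0) ^ n * Max ((\<lambda>k. \<bar>(L ^^ k) \<phi> x\<bar>) ` {..n})))"

definition schwartz ::
    "'a::metric_space measure \<Rightarrow> ('a \<Rightarrow> real) set \<Rightarrow> (('a \<Rightarrow> real) \<Rightarrow> 'a \<Rightarrow> real) \<Rightarrow> 'a
      \<Rightarrow> ('a \<Rightarrow> real) set" where
  "schwartz \<mu> D L x\<^sub>0 =
     {\<phi> \<in> L2 \<mu>. (\<forall>n. (L ^^ n) \<phi> \<in> D) \<and> (\<forall>n. schwartz_seminorm \<mu> L x\<^sub>0 n \<phi> < \<infinity>)}"

definition schwartz_topology ::
    "'a::metric_space measure \<Rightarrow> ('a \<Rightarrow> real) set \<Rightarrow> (('a \<Rightarrow> real) \<Rightarrow> 'a \<Rightarrow> real) \<Rightarrow> 'a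
      \<Rightarrow> ('a \<Rightarrow> real) topology" where
  "schwartz_topology \<mu> D L x\<^sub>0 = topology_generated_by
     {{\<psi> \<in> schwartz \<mu> D L x\<^sub>0. schwartz_seminorm \<mu> L x\<^sub>0 n (\<lambda>x. \<psi> x - \<phi> x) < ereal \<epsilon>} | \<phi> n \<epsilon>.
        \<phi> \<in> schwartz \<mu> D L x\<^sub>0 \<and> \<epsilon> > 0}"

text \<open>
  A distribution is a functional on \<open>schwartz\<close>; its values elsewhere carry no meaning, and two
  distributions are equal if they agree on \<open>schwartz\<close>. Continuity makes a distribution
  insensitive to the choice of representatives.
\<close>

definition distributions ::
    "'a::metric_space measure \<Rightarrow> ('a \<Rightarrow> real) set \<Rightarrow> (('a \<Rightarrow> real) \<Rightarrow> 'a \<Rightarrow> real) \<Rightarrow> 'a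
      \<Rightarrow> (('a \<Rightarrow> real) \<Rightarrow> real) set" where
  "distributions \<mu> D L x\<^sub>0 =
     {f. (\<forall>\<phi>\<in>schwartz \<mu> D L x\<^sub>0. \<forall>\<psi>\<in>schwartz \<mu> D L x\<^sub>0. f (\<lambda>x. \<phi> x + \<psi> x) = f \<phi> + f \<psi>) \<and>
         (\<forall>\<phi>\<in>schwartz \<mu> D L x\<^sub>0. \<forall>c. f (\<lambda>x. c * \<phi> x) = c * f \<phi>) \<and>
         continuous_map (schwartz_topology \<mu> D L x\<^sub>0) euclideanreal f}"

text \<open>The weak topology, i.e. the topology of pointwise convergence on \<open>schwartz\<close>.\<close>

definition distribution_topology ::
    "'a::metric_space measure \<Rightarrow> ('a \<Rightarrow> real) set \<Rightarrow> (('a \<Rightarrow> real) \<Rightarrow> 'a \<Rightarrow> real) \<Rightarrow> 'a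
      \<Rightarrow> (('a \<Rightarrow> real) \<Rightarrow> real) topology" where
  "distribution_topology \<mu> D L x\<^sub>0 =
     pullback_topology (distributions \<mu> D L x\<^sub>0) (\<lambda>f. restrict f (schwartz \<mu> D L x\<^sub>0))
       (powertop_real (schwartz \<mu> D L x\<^sub>0))"

definition converges_in_distributions ::
    "'a::metric_space measure \<Rightarrow> ('a \<Rightarrow> real) set \<Rightarrow> (('a \<Rightarrow> real) \<Rightarrow> 'a \<Rightarrow> real) \<Rightarrow> 'a
      \<Rightarrow> (nat \<Rightarrow> ('a \<Rightarrow> real) \<Rightarrow> real) \<Rightarrow> bool" where
  "converges_in_distributions \<mu> D L x\<^sub>0 F \<longleftrightarrow>
     (\<exists>g. limitin (distribution_topology \<mu> D L x\<^sub>0) F g sequentially)"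

definition by_duality :: "('f \<Rightarrow> 'f) \<Rightarrow> ('f \<Rightarrow> real) \<Rightarrow> 'f \<Rightarrow> real" where
  "by_duality B f = (\<lambda>\<phi>. f (B \<phi>))"

definition polynomials_order ::
    "'a::metric_space measure \<Rightarrow> ('a \<Rightarrow> real) set \<Rightarrow> (('a \<Rightarrow> real) \<Rightarrow> 'a \<Rightarrow> real) \<Rightarrow> 'a \<Rightarrow> nat
      \<Rightarrow> (('a \<Rightarrow> real) \<Rightarrow> real) set" where
  "polynomials_order \<mu> D L x\<^sub>0 k =
     {\<rho> \<in> distributions \<mu> D L x\<^sub>0. \<forall>\<phi>\<in>schwartz \<mu> D L x\<^sub>0. by_duality (L ^^ k) \<rho> \<phi> = 0}"

definition polynomials ::
    "'a::metric_space measure \<Rightarrow> ('a \<Rightarrow> real) set \<Rightarrow> (('a \<Rightarrow> real) \<Rightarrow> 'a \<Rightarrow> real) \<Rightarrow> 'a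
      \<Rightarrow> (('a \<Rightarrow> real) \<Rightarrow> real) set" where
  "polynomials \<mu> D L x\<^sub>0 = (\<Union>k. polynomials_order \<mu> D L x\<^sub>0 k)"


section \<open>The vector fields acting on test functions and on distributions\<close>

text \<open>
  \<open>XS j\<close> is the continuous action of \<open>X\<^sub>j\<close> on \<open>schwartz\<close>: it is the pointwise action on those test
  functions that are smooth (no claim is made that all of them are). \<open>XA j\<close> is the formal
  adjoint of \<open>XS j\<close> with respect to \<open>\<mu>\<close>; the vector fields need not be divergence free, so it
  need not be \<open>- XS j\<close>. Both are determined up to a.e. equality, as smooth test functions are
  dense in \<open>schwartz\<close> and \<open>schwartz\<close> is dense in \<open>L\<^sup>2\<close>. The action of \<open>X\<^sub>j\<close> on a distribution
  is \<open>by_duality (XA j)\<close>, which extends \<open>XS j\<close>.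
\<close>

locale heat_manifold_distributions = heat_manifold \<mu> D L T H \<A> \<kappa> X
  for \<mu> :: "'a::{metric_space, second_countable_topology} measure"
    and D :: "('a \<Rightarrow> real) set"
    and L :: "('a \<Rightarrow> real) \<Rightarrow> 'a \<Rightarrow> real"
    and T :: "real \<Rightarrow> ('a \<Rightarrow> real) \<Rightarrow> 'a \<Rightarrow> real"
    and H :: "real \<Rightarrow> 'a \<Rightarrow> 'a \<Rightarrow> real"
    and \<A> :: "('a set \<times> ('a \<Rightarrow> 'e::euclidean_space)) set"
    and \<kappa> :: nat
    and X :: "nat \<Rightarrow> 'a \<Rightarrow> ('a \<Rightarrow> real) \<Rightarrow> real" +
  fixes x\<^sub>0 :: 'a
    and XS XA :: "nat \<Rightarrow> ('a \<Rightarrow> real) \<Rightarrow> 'a \<Rightarrow> real"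
  assumes XS_linear: "\<And>j. j \<in> {1..\<kappa>} \<Longrightarrow> linear_ae_on \<mu> (schwartz \<mu> D L x\<^sub>0) (XS j)"
    and XS_continuous: "\<And>j. j \<in> {1..\<kappa>} \<Longrightarrow>
        continuous_map (schwartz_topology \<mu> D L x\<^sub>0) (schwartz_topology \<mu> D L x\<^sub>0) (XS j)"
    and XS_pointwise: "\<And>j \<phi>. j \<in> {1..\<kappa>} \<Longrightarrow> \<phi> \<in> schwartz \<mu> D L x\<^sub>0 \<Longrightarrow> smooth_fun \<A> \<phi> \<Longrightarrow>
        AE x in \<mu>. XS j \<phi> x = vf_action X j \<phi> x"
    and XA_linear: "\<And>j. j \<in> {1..\<kappa>} \<Longrightarrow> linear_ae_on \<mu> (schwartz \<mu> D L x\<^sub>0) (XA j)"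
    and XA_continuous: "\<And>j. j \<in> {1..\<kappa>} \<Longrightarrow>
        continuous_map (schwartz_topology \<mu> D L x\<^sub>0) (schwartz_topology \<mu> D L x\<^sub>0) (XA j)"
    and XA_adjoint: "\<And>j \<phi> \<psi>. j \<in> {1..\<kappa>} \<Longrightarrow>
        \<phi> \<in> schwartz \<mu> D L x\<^sub>0 \<Longrightarrow> \<psi> \<in> schwartz \<mu> D L x\<^sub>0 \<Longrightarrow>
        l2_inner \<mu> (XS j \<phi>) \<psi> = l2_inner \<mu> \<phi> (XA j \<psi>)"

definition property_S ::
    "'a::metric_space measure \<Rightarrow> ('a \<Rightarrow> real) set \<Rightarrow> (('a \<Rightarrow> real) \<Rightarrow> 'a \<Rightarrow> real) \<Rightarrow> 'a
      \<Rightarrow> nat \<Rightarrow> (nat \<Rightarrow> ('a \<Rightarrow> real) \<Rightarrow> 'a \<Rightarrow> real) \<Rightarrow> bool" where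
  "property_S \<mu> D L x\<^sub>0 \<kappa> XA \<longleftrightarrow>
     (\<forall>n. \<exists>\<nu>. \<forall>F :: nat \<Rightarrow> ('a \<Rightarrow> real) \<Rightarrow> real.
        (\<forall>k. F k \<in> distributions \<mu> D L x\<^sub>0) \<longrightarrow>
        (\<forall>J \<in> multi_indices \<kappa> n. converges_in_distributions \<mu> D L x\<^sub>0
            (\<lambda>k. iterated (\<lambda>j. by_duality (XA j)) J (F k))) \<longrightarrow>
        (\<exists>\<rho> :: nat \<Rightarrow> ('a \<Rightarrow> real) \<Rightarrow> real.
           (\<forall>k. \<rho> k \<in> polynomials_order \<mu> D L x\<^sub>0 \<nu>) \<and>
           converges_in_distributions \<mu> D L x\<^sub>0 (\<lambda>k \<phi>. F k \<phi> + \<rho> k \<phi>)))"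

definition condition_BP ::
    "'a::metric_space measure \<Rightarrow> ('a \<Rightarrow> real) set \<Rightarrow> (('a \<Rightarrow> real) \<Rightarrow> 'a \<Rightarrow> real) \<Rightarrow> 'a
      \<Rightarrow> (real \<Rightarrow> ('a \<Rightarrow> real) \<Rightarrow> 'a \<Rightarrow> real)
      \<Rightarrow> nat \<Rightarrow> (nat \<Rightarrow> ('a \<Rightarrow> real) \<Rightarrow> 'a \<Rightarrow> real) \<Rightarrow> bool" where
  "condition_BP \<mu> D L x\<^sub>0 T \<kappa> XS \<longleftrightarrow>
     (\<forall>h. \<exists>C>0. \<exists>c>0. \<forall>t>0. \<forall>J \<in> multi_indices \<kappa> h. \<forall>\<phi> \<in> schwartz \<mu> D L x\<^sub>0.
        AE x in \<mu>. \<bar>T t (iterated XS J \<phi>) x\<bar> \<le>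
          C * t powr (- real h / 2) * T (c * t) (\<lambda>x. \<bar>\<phi> x\<bar>) x)"

text \<open>
  The integrand of the weakly defined \<open>\<integral>\<^sub>0\<^sup>k (tL)\<^sup>m T\<^sub>t f dt/t\<close>, paired with \<open>\<phi>\<close>.
\<close>

definition calderon_integrand ::
    "(('a \<Rightarrow> real) \<Rightarrow> 'a \<Rightarrow> real) \<Rightarrow> (real \<Rightarrow> ('a \<Rightarrow> real) \<Rightarrow> 'a \<Rightarrow> real) \<Rightarrow> nat
      \<Rightarrow> (('a \<Rightarrow> real) \<Rightarrow> real) \<Rightarrow> ('a \<Rightarrow> real) \<Rightarrow> real \<Rightarrow> real" where
  "calderon_integrand L T m f \<phi> t = t ^ m * by_duality (L ^^ m) (by_duality (T t) f) \<phi> / t"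

end

theory Submission
  imports Defs
begin

text \<open>
  Write \<open>m = p + 1\<close> and \<open>G\<^sub>t = (\<Sum>j\<le>p. (t L)\<^sup>j / j! T\<^sub>t f)\<close>. Because \<open>d/dt T\<^sub>t = - L T\<^sub>t\<close>, the
  derivative of the sum telescopes to \<open>- t\<^sup>p L\<^sup>m T\<^sub>t f / p!\<close>, and \<open>G\<^sub>0 = f\<close>. The truncated
  integral is therefore \<open>p! (f - G\<^sub>k)\<close> (\<open>calderon_integral\<close>), and the claim says that \<open>G\<^sub>k\<close>
  converges modulo polynomials of bounded degree, and that its limit is a polynomial.

  A distribution has a finite order \<open>N\<close>: it is controlled by the supremum of
  \<open>(1 + d)\<^sup>N \<bar>L\<^sup>k \<phi>\<bar>\<close> for \<open>k \<le> N\<close> (\<open>distribution_bound\<close>). In such weighted norms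
  \<open>(t L)\<^sup>j T\<^sub>t\<close> grows at most like \<open>t\<^sup>N\<close> (\<open>heat_flow_decay\<close>), while every further factor \<open>L\<close>
  gains \<open>1 / t\<close> and every further adjoint vector field gains \<open>1 / sqrt t\<close>
  (\<open>T_pow_wbound\<close>, \<open>T_XA_wbound\<close>). Hence \<open>X\<^sub>J G\<^sub>k\<close> tends to zero as soon as \<open>J\<close> is long compared
  with \<open>N\<close> (\<open>truncated_exp_XA_tendsto\<close>). Property \<open>(S)\<close> then yields \<open>\<rho>\<^sub>k\<close> of order \<open>\<nu>\<close> such that
  \<open>G\<^sub>k + \<rho>\<^sub>k\<close> converges to some \<open>g\<close>. Applying \<open>L\<close> to the power \<open>\<nu> + N + 1\<close> kills \<open>\<rho>\<^sub>k\<close> and sends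
  \<open>G\<^sub>k\<close> to zero (\<open>truncated_exp_L_pow_tendsto\<close>); so \<open>g\<close> is a polynomial, and it is the \<open>\<rho>\<^sub>f\<close> of the
  statement.

  The two gains are obtained by letting the operators act on the heat kernel instead of the test
  function. For this the section \<open>H\<^sub>t(x, \<cdot>)\<close> has to be a test function itself for every \<open>x\<close>
  (\<open>heat_schwartz\<close>), with \<open>L\<^sup>n H\<^sub>t(x, \<cdot>) = (- \<partial>\<^sub>t)\<^sup>n H\<^sub>t(x, \<cdot>)\<close>. This follows from the
  Chapman-Kolmogorov identity \<open>T\<^sub>s H\<^sub>t(x, \<cdot>) = H\<^sub>t\<^sub>+\<^sub>s(x, \<cdot>)\<close> (\<open>heat_semigroup_kernel\<close>), which
  holds for every \<open>x\<close> by continuity, and from differentiating it in \<open>t\<close>. Then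
  \<open>T\<^sub>t L\<^sup>n \<phi>(x)\<close> is the pairing of \<open>\<phi>\<close> with \<open>(- \<partial>\<^sub>t)\<^sup>n H\<^sub>t(x, \<cdot>)\<close>, and \<open>T\<^sub>t X\<^sub>J\<^sup>* \<phi>(x)\<close> is its pairing
  with \<open>X\<^sub>J H\<^sub>t(x, \<cdot>)\<close>; both functions have Gaussian bounds.

  No Gaussian integral has to be computed: by the lower Gaussian bound each Gaussian is dominated
  by the heat kernel at a later time (\<open>gauss_le_heat\<close>), whose integral is one.
\<close>

section \<open>Square integrable functions\<close>

lemma AE_eq_sym: "AE x in M. f x = g x \<Longrightarrow> AE x in M. g x = f x"
  by (auto elim: eventually_mono)

lemma L2_measurable: "u \<in> L2 M \<Longrightarrow> u \<in> borel_measurable M"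
  by (simp add: L2_def)

lemma L2_dominated:
  assumes "g \<in> L2 M" "u \<in> borel_measurable M" "AE x in M. \<bar>u x\<bar> \<le> \<bar>g x\<bar>"
  shows "u \<in> L2 M"
proof -
  have "integrable M (\<lambda>x. (u x)\<^sup>2)"
  proof (rule Bochner_Integration.integrable_bound)
    show "integrable M (\<lambda>x. (g x)\<^sup>2)" using assms by (simp add: L2_def)
    show "AE x in M. norm ((u x)\<^sup>2) \<le> norm ((g x)\<^sup>2)"
      using assms(3) by eventually_elim (simp add: abs_le_square_iff)
  qed (use assms in measurable)
  then show ?thesis using assms by (simp add: L2_def)
qed

lemma L2_mult_integrable:
  assumes "u \<in> L2 M" "v \<in> L2 M"
  shows "integrable M (\<lambda>x. u x * v x)"
proof (rule Bochner_Integration.integrable_bound)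
  show "integrable M (\<lambda>x. (u x)\<^sup>2 + (v x)\<^sup>2)" using assms by (simp add: L2_def)
  have [measurable]: "u \<in> borel_measurable M" "v \<in> borel_measurable M"
    using assms by (auto simp: L2_def)
  show "(\<lambda>x. u x * v x) \<in> borel_measurable M" by measurable
  have "\<bar>a * b\<bar> \<le> a\<^sup>2 + b\<^sup>2" for a b :: real
  proof -
    have "0 \<le> (\<bar>a\<bar> - \<bar>b\<bar>)\<^sup>2" by simp
    then have "2 * (\<bar>a\<bar> * \<bar>b\<bar>) \<le> a\<^sup>2 + b\<^sup>2" by (simp add: power2_diff)
    moreover have "0 \<le> \<bar>a\<bar> * \<bar>b\<bar>" by simp
    ultimately show ?thesis unfolding abs_mult by linarith
  qed
  then show "AE x in M. norm (u x * v x) \<le> norm ((u x)\<^sup>2 + (v x)\<^sup>2)" by simp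
qed

lemma L2_scale: "u \<in> L2 M \<Longrightarrow> (\<lambda>x. c * u x) \<in> L2 M"
  by (auto simp: L2_def power_mult_distrib)

lemma L2_add:
  assumes "u \<in> L2 M" "v \<in> L2 M"
  shows "(\<lambda>x. u x + v x) \<in> L2 M"
proof -
  have [measurable]: "u \<in> borel_measurable M" "v \<in> borel_measurable M"
    using assms by (auto simp: L2_def)
  show ?thesis
    using assms L2_mult_integrable[OF assms] by (simp add: L2_def power2_sum mult.assoc)
qed

lemma L2_diff:
  assumes "u \<in> L2 M" "v \<in> L2 M"
  shows "(\<lambda>x. u x - v x) \<in> L2 M"
  using L2_add[OF assms(1) L2_scale[OF assms(2), of "-1"]] by simp

lemma L2_zero: "(\<lambda>x. 0) \<in> L2 M"
  by (simp add: L2_def)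

lemma L2_cong_AE:
  assumes "u \<in> L2 M" "v \<in> borel_measurable M" "AE x in M. u x = v x"
  shows "v \<in> L2 M"
  by (rule L2_dominated[OF assms(1,2)]) (use assms(3) in eventually_elim, simp)

lemma l2_inner_cong_AE:
  assumes "u \<in> borel_measurable M" "u' \<in> borel_measurable M"
    "v \<in> borel_measurable M" "v' \<in> borel_measurable M"
    "AE x in M. u x = u' x" "AE x in M. v x = v' x"
  shows "l2_inner M u v = l2_inner M u' v'"
  unfolding l2_inner_def using assms(1-4)
  by (intro integral_cong_AE) (use assms(5,6) in \<open>auto\<close>)

lemma l2_norm_cong_AE:
  assumes "u \<in> borel_measurable M" "u' \<in> borel_measurable M" "AE x in M. u x = u' x"
  shows "l2_norm M u = l2_norm M u'"
  unfolding l2_norm_def using l2_inner_cong_AE[OF assms(1,2,1,2,3,3)] by simp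

lemma l2_inner_commute: "l2_inner M u v = l2_inner M v u"
  by (simp add: l2_inner_def mult.commute)

lemma l2_inner_add_left:
  assumes "u \<in> L2 M" "v \<in> L2 M" "w \<in> L2 M"
  shows "l2_inner M (\<lambda>x. u x + v x) w = l2_inner M u w + l2_inner M v w"
  using L2_mult_integrable[OF assms(1,3)] L2_mult_integrable[OF assms(2,3)]
  by (simp add: l2_inner_def distrib_right)

lemma l2_inner_diff_left:
  assumes "u \<in> L2 M" "v \<in> L2 M" "w \<in> L2 M"
  shows "l2_inner M (\<lambda>x. u x - v x) w = l2_inner M u w - l2_inner M v w"
  using L2_mult_integrable[OF assms(1,3)] L2_mult_integrable[OF assms(2,3)]
  by (simp add: l2_inner_def left_diff_distrib)

lemma l2_inner_scale_left: "l2_inner M (\<lambda>x. c * u x) w = c * l2_inner M u w"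
  by (simp add: l2_inner_def mult.assoc)

lemma l2_inner_self_nonneg: "0 \<le> l2_inner M u u"
  by (simp add: l2_inner_def)

lemma l2_norm_nonneg: "0 \<le> l2_norm M u"
  by (simp add: l2_norm_def l2_inner_self_nonneg)

lemma l2_norm_square: "(l2_norm M u)\<^sup>2 = l2_inner M u u"
  by (simp add: l2_norm_def l2_inner_self_nonneg)

lemma l2_norm_eq_0_AE:
  assumes "u \<in> L2 M" "l2_norm M u = 0"
  shows "AE x in M. u x = 0"
proof -
  have "integrable M (\<lambda>x. u x * u x)" using L2_mult_integrable assms by blast
  moreover have "(\<integral>x. u x * u x \<partial>M) = 0"
    using assms(2) l2_norm_square[of M u] by (simp add: l2_inner_def)
  ultimately have "AE x in M. u x * u x = 0"
    by (subst (asm) integral_nonneg_eq_0_iff_AE) auto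
  then show ?thesis by simp
qed

lemma l2_norm_scale: "l2_norm M (\<lambda>x. c * u x) = \<bar>c\<bar> * l2_norm M u"
proof -
  have "l2_inner M (\<lambda>x. c * u x) (\<lambda>x. c * u x) = c\<^sup>2 * l2_inner M u u"
    using l2_inner_scale_left[of M c u "\<lambda>x. c * u x"] l2_inner_scale_left[of M c u u]
      l2_inner_commute[of M u "\<lambda>x. c * u x"]
    by (simp add: power2_eq_square)
  then show ?thesis by (simp add: l2_norm_def real_sqrt_mult)
qed

lemma l2_Cauchy_Schwarz:
  assumes "u \<in> L2 M" "v \<in> L2 M"
  shows "\<bar>l2_inner M u v\<bar> \<le> l2_norm M u * l2_norm M v"
proof -
  define A B C where "A = l2_inner M u u" and "B = l2_inner M u v" and "C = l2_inner M v v"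
  have "B\<^sup>2 \<le> A * C"
  proof (cases "C = 0")
    case True
    then have "AE x in M. v x = 0"
      using l2_norm_eq_0_AE[OF assms(2)] by (simp add: C_def l2_norm_def)
    then have "B = l2_inner M u (\<lambda>x. 0)"
      unfolding B_def using assms by (intro l2_inner_cong_AE) (auto simp: L2_def)
    then show ?thesis using True by (simp add: l2_inner_def)
  next
    case False
    then have C: "C > 0" using l2_inner_self_nonneg[of M v] by (simp add: C_def)
    define w where "w = (\<lambda>x. C * u x - B * v x)"
    have sc: "(\<lambda>x. C * u x) \<in> L2 M" "(\<lambda>x. B * v x) \<in> L2 M" and w: "w \<in> L2 M"
      unfolding w_def using assms by (auto intro!: L2_scale L2_diff)
    have wl: "l2_inner M w z = C * l2_inner M u z - B * l2_inner M v z" if "z \<in> L2 M" for z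
      unfolding w_def using l2_inner_diff_left[OF sc that] by (simp add: l2_inner_scale_left)
    have "0 \<le> l2_inner M w w" by (rule l2_inner_self_nonneg)
    also have "\<dots> = C * l2_inner M w u - B * l2_inner M w v"
      using wl[OF w] by (simp add: l2_inner_commute)
    also have "\<dots> = C * (C * A - B * B) - B * (C * B - B * C)"
      using wl assms by (simp add: A_def B_def C_def l2_inner_commute)
    finally have "0 \<le> C * (C * A - B * B)" by simp
    then show ?thesis using C by (simp add: zero_le_mult_iff power2_eq_square mult.commute)
  qed
  then have "\<bar>B\<bar> \<le> sqrt (A * C)" using real_le_rsqrt by fastforce
  then show ?thesis by (simp add: A_def B_def C_def l2_norm_def real_sqrt_mult)
qed

lemma l2_norm_triangle:
  assumes "u \<in> L2 M" "v \<in> L2 M"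
  shows "l2_norm M (\<lambda>x. u x + v x) \<le> l2_norm M u + l2_norm M v"
proof (rule power2_le_imp_le)
  have uv: "(\<lambda>x. u x + v x) \<in> L2 M" using L2_add assms by blast
  have "(l2_norm M (\<lambda>x. u x + v x))\<^sup>2 =
      l2_inner M u (\<lambda>x. u x + v x) + l2_inner M v (\<lambda>x. u x + v x)"
    unfolding l2_norm_square using assms uv by (intro l2_inner_add_left)
  also have "\<dots> = (l2_norm M u)\<^sup>2 + 2 * l2_inner M u v + (l2_norm M v)\<^sup>2"
    using l2_inner_add_left[OF assms assms(1)] l2_inner_add_left[OF assms assms(2)]
      l2_inner_commute[of M u "\<lambda>x. u x + v x"] l2_inner_commute[of M v "\<lambda>x. u x + v x"]
      l2_inner_commute[of M v u]
    unfolding l2_norm_square by linarith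
  also have "\<dots> \<le> (l2_norm M u + l2_norm M v)\<^sup>2"
    using l2_Cauchy_Schwarz[OF assms] by (simp add: power2_sum)
  finally show "(l2_norm M (\<lambda>x. u x + v x))\<^sup>2 \<le> (l2_norm M u + l2_norm M v)\<^sup>2" .
qed (simp add: l2_norm_nonneg)

lemma l2_norm_minus_commute: "l2_norm M (\<lambda>x. u x - v x) = l2_norm M (\<lambda>x. v x - u x)"
  using l2_norm_scale[of M "-1" "\<lambda>x. u x - v x"] by simp

lemma l2_norm_diff_triangle:
  assumes "u \<in> L2 M" "v \<in> L2 M" "w \<in> L2 M"
  shows "l2_norm M (\<lambda>x. u x - w x) \<le> l2_norm M (\<lambda>x. u x - v x) + l2_norm M (\<lambda>x. v x - w x)"
  using l2_norm_triangle[OF L2_diff[OF assms(1,2)] L2_diff[OF assms(2,3)]] by simp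

lemma l2_norm_dominated:
  assumes "g \<in> L2 M" "u \<in> borel_measurable M" "AE x in M. \<bar>u x\<bar> \<le> \<bar>g x\<bar>"
  shows "l2_norm M u \<le> l2_norm M g"
  unfolding l2_norm_def l2_inner_def real_sqrt_le_iff
proof (rule integral_mono_AE)
  have u: "u \<in> L2 M" using L2_dominated assms .
  show "integrable M (\<lambda>x. u x * u x)" "integrable M (\<lambda>x. g x * g x)"
    using L2_mult_integrable u assms(1) by blast+
  show "AE x in M. u x * u x \<le> g x * g x"
    using assms(3) by eventually_elim (metis abs_le_square_iff power2_eq_square)
qed

lemma l2_inner_tendsto:
  assumes "\<forall>\<^sub>F i in F. u i \<in> L2 M" "a \<in> L2 M" "w \<in> L2 M"
    and "((\<lambda>i. l2_norm M (\<lambda>x. u i x - a x)) \<longlongrightarrow> 0) F"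
  shows "((\<lambda>i. l2_inner M (u i) w) \<longlongrightarrow> l2_inner M a w) F"
proof (rule LIM_zero_cancel)
  show "((\<lambda>i. l2_inner M (u i) w - l2_inner M a w) \<longlongrightarrow> 0) F"
  proof (rule tendsto_0_le[OF tendsto_mult_left_zero[OF assms(4), of "l2_norm M w"], where K=1])
    show "\<forall>\<^sub>F i in F. norm (l2_inner M (u i) w - l2_inner M a w)
        \<le> norm (l2_norm M (\<lambda>x. u i x - a x) * l2_norm M w) * 1"
      using assms(1)
    proof eventually_elim
      case (elim i)
      have "\<bar>l2_inner M (\<lambda>x. u i x - a x) w\<bar> \<le> l2_norm M (\<lambda>x. u i x - a x) * l2_norm M w"
        using l2_Cauchy_Schwarz L2_diff elim assms by blast
      then show ?case
        using l2_inner_diff_left[OF elim assms(2,3)] by (simp add: l2_norm_nonneg abs_mult)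
    qed
  qed
qed

lemma l2_limit_unique:
  assumes "\<forall>\<^sub>F i in F. u i \<in> L2 M" "a \<in> L2 M" "b \<in> L2 M" "F \<noteq> bot"
    and "((\<lambda>i. l2_norm M (\<lambda>x. u i x - a x)) \<longlongrightarrow> 0) F"
    and "((\<lambda>i. l2_norm M (\<lambda>x. u i x - b x)) \<longlongrightarrow> 0) F"
  shows "AE x in M. a x = b x"
proof -
  have "l2_norm M (\<lambda>x. a x - b x) \<le> 0 + 0"
  proof (rule tendsto_lowerbound[OF tendsto_add[OF assms(5,6)] _ assms(4)])
    show "\<forall>\<^sub>F i in F. l2_norm M (\<lambda>x. a x - b x)
        \<le> l2_norm M (\<lambda>x. u i x - a x) + l2_norm M (\<lambda>x. u i x - b x)"
      using assms(1)
    proof eventually_elim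
      case (elim i)
      show ?case
        using l2_norm_diff_triangle[OF assms(2) elim assms(3)] l2_norm_minus_commute[of M a "u i"]
        by simp
    qed
  qed
  then have "l2_norm M (\<lambda>x. a x - b x) = 0" using l2_norm_nonneg[of M] by (simp add: antisym)
  then show ?thesis using l2_norm_eq_0_AE[OF L2_diff[OF assms(2,3)]] by simp
qed

lemma l2_eq_AE_if_inner_eq:
  assumes "u \<in> L2 M" "v \<in> L2 M"
    and "\<And>w. w \<in> L2 M \<Longrightarrow> l2_inner M u w = l2_inner M v w"
  shows "AE x in M. u x = v x"
proof -
  have d: "(\<lambda>x. u x - v x) \<in> L2 M" using L2_diff assms by blast
  have "l2_inner M (\<lambda>x. u x - v x) (\<lambda>x. u x - v x) = 0"
    using l2_inner_diff_left[OF assms(1,2) d] assms(3)[OF d] by simp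
  then show ?thesis using l2_norm_eq_0_AE[OF d] by (simp add: l2_norm_def)
qed

text \<open>The squares of the differences tend to zero in \<open>L\<^sup>1\<close>.\<close>
lemma l2_limit_AE_subseq:
  fixes u :: "nat \<Rightarrow> 'a \<Rightarrow> real"
  assumes "\<And>i. u i \<in> L2 M" "a \<in> L2 M"
    and "(\<lambda>i. l2_norm M (\<lambda>x. u i x - a x)) \<longlonglongrightarrow> 0"
  obtains r where "strict_mono r" "AE x in M. (\<lambda>i. u (r i) x) \<longlonglongrightarrow> a x"
proof -
  define q where "q i x = (u i x - a x) * (u i x - a x)" for i x
  have "(\<lambda>i. \<integral>x. norm (q i x) \<partial>M) \<longlonglongrightarrow> 0"
  proof -
    have "(\<integral>x. norm (q i x) \<partial>M) = (l2_norm M (\<lambda>x. u i x - a x))\<^sup>2" for i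
      unfolding l2_norm_square by (simp add: l2_inner_def q_def)
    then show ?thesis using tendsto_power[OF assms(3), of 2] by simp
  qed
  moreover have "integrable M (q i)" for i
    unfolding q_def using L2_mult_integrable L2_diff assms(1,2) by blast
  ultimately obtain r where r: "strict_mono r" "AE x in M. (\<lambda>i. q (r i) x) \<longlonglongrightarrow> 0"
    using tendsto_L1_AE_subseq[of M q] by blast
  have "AE x in M. (\<lambda>i. u (r i) x) \<longlonglongrightarrow> a x"
    using r(2)
  proof eventually_elim
    case (elim x)
    then have "(\<lambda>i. sqrt (q (r i) x)) \<longlonglongrightarrow> sqrt 0" by (intro tendsto_real_sqrt)
    then have "(\<lambda>i. \<bar>u (r i) x - a x\<bar>) \<longlonglongrightarrow> 0" by (simp add: q_def)
    then have "(\<lambda>i. u (r i) x - a x) \<longlonglongrightarrow> 0" by (rule tendsto_rabs_zero_cancel)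
    then show ?case by (rule LIM_zero_cancel)
  qed
  then show ?thesis using r that by blast
qed

section \<open>Gaussian majorants of the heat kernel\<close>

text \<open>The common majorant of the kernel estimates.\<close>
definition gauss :: "'a::metric_space measure \<Rightarrow> real \<Rightarrow> real \<Rightarrow> 'a \<Rightarrow> 'a \<Rightarrow> real" where
  "gauss \<mu> c t x y = 1 / vol \<mu> t x y * exp (- c * (dist x y)\<^sup>2 / t)"

lemma polynomial_le_gaussian:
  fixes c :: real
  assumes "c > 0"
  shows "\<exists>C>0. \<forall>u\<ge>0. (1 + u) ^ n \<le> C * exp (c * u\<^sup>2)"
proof -
  \<comment> \<open>Each of the \<open>n\<close> factors \<open>1 + u\<close> may use the exponent \<open>b\<close>.\<close>
  define b where "b = c / (real n + 1)"
  have b: "b > 0" using assms by (simp add: b_def)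
  have 1: "1 + u \<le> (1 + 1 / (4 * b)) * exp (b * u\<^sup>2)" if "u \<ge> 0" for u
  proof -
    have "b * u\<^sup>2 + 1 / (4 * b) - u = b * (u - 1 / (2 * b))\<^sup>2"
      using b by (simp add: power2_eq_square field_simps)
    moreover have "b * (u - 1 / (2 * b))\<^sup>2 \<ge> 0" using b by simp
    ultimately have u4: "u \<le> b * u\<^sup>2 + 1 / (4 * b)" by linarith
    have "0 \<le> u\<^sup>2 / 4" by simp
    moreover have "(1 + 1 / (4 * b)) * (1 + b * u\<^sup>2) = 1 + (b * u\<^sup>2 + 1 / (4 * b)) + u\<^sup>2 / 4"
      using b by (simp add: field_simps)
    ultimately have "1 + u \<le> (1 + 1 / (4 * b)) * (1 + b * u\<^sup>2)" using u4 by linarith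
    also have "\<dots> \<le> (1 + 1 / (4 * b)) * exp (b * u\<^sup>2)"
      using b by (intro mult_left_mono) (auto simp: exp_ge_add_one_self)
    finally show ?thesis .
  qed
  have "(1 + u) ^ n \<le> (1 + 1 / (4 * b)) ^ n * exp (c * u\<^sup>2)" if u: "u \<ge> 0" for u
  proof -
    have "(1 + u) ^ n \<le> ((1 + 1 / (4 * b)) * exp (b * u\<^sup>2)) ^ n"
      using 1[OF u] u by (intro power_mono) auto
    also have "\<dots> = (1 + 1 / (4 * b)) ^ n * exp (real n * (b * u\<^sup>2))"
      by (simp add: power_mult_distrib exp_of_nat_mult)
    also have "real n * (b * u\<^sup>2) \<le> c * u\<^sup>2"
      using assms by (simp add: b_def field_simps)
    finally show ?thesis using b by (simp add: mult_left_mono)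
  qed
  moreover have "(1 + 1 / (4 * b)) ^ n > 0" using b by (intro zero_less_power) (simp add: add_pos_pos)
  ultimately show ?thesis by blast
qed

context doubling_space
begin

lemma sets_mu [measurable_cong, simp]: "sets \<mu> = sets borel"
  using radon by (simp add: radon_measure_def)

lemma space_mu [simp]: "space \<mu> = UNIV"
  using sets_eq_imp_space_eq[OF sets_mu] by simp

lemma measurable_mu: "borel_measurable \<mu> = borel_measurable borel"
  using measurable_cong_sets[OF sets_mu refl] by blast

lemma emeasure_ball_finite: "emeasure \<mu> (ball x r) < \<infinity>"
proof (cases "r > 0")
  case True
  obtain c dd where cdd: "\<And>x r R. r > 0 \<Longrightarrow> R \<ge> 1 \<Longrightarrow>
      emeasure \<mu> (ball x (R * r)) \<le> ennreal (c * R powr dd) * emeasure \<mu> (ball x r)"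
    using volume by metis
  obtain U K where UK: "open U" "compact K" "x \<in> U" "U \<subseteq> K"
    using locally_compact by (auto simp: locally_def) (metis UNIV_I open_UNIV)
  then obtain e where e: "e > 0" "ball x e \<subseteq> K" by (meson order_trans openE)
  have "emeasure \<mu> (ball x e) \<le> emeasure \<mu> K"
    using e UK by (intro emeasure_mono) (auto simp: compact_imp_closed)
  also have "\<dots> < \<infinity>" using radon UK by (simp add: radon_measure_def)
  finally have fin: "emeasure \<mu> (ball x e) < \<infinity>" .
  define R where "R = max 1 (r / e)"
  have "r \<le> R * e" using e by (simp add: R_def max_def field_simps)
  then have "emeasure \<mu> (ball x r) \<le> emeasure \<mu> (ball x (R * e))"
    by (intro emeasure_mono) (auto simp: subset_ball)
  also have "\<dots> \<le> ennreal (c * R powr dd) * emeasure \<mu> (ball x e)"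
    using e by (intro cdd) (auto simp: R_def)
  also have "\<dots> < \<infinity>" using fin by (simp add: ennreal_mult_less_top)
  finally show ?thesis .
next
  case False
  then show ?thesis by (simp add: not_less ball_empty)
qed

lemma emeasure_ball: "emeasure \<mu> (ball x r) = ennreal (measure \<mu> (ball x r))"
  using emeasure_ball_finite[of x r] by (intro emeasure_eq_ennreal_measure) auto

lemma measure_ball_mono: "ball x r \<subseteq> ball y s \<Longrightarrow> measure \<mu> (ball x r) \<le> measure \<mu> (ball y s)"
  using emeasure_ball_finite by (intro measure_mono_fmeasurable) (auto simp: fmeasurable_def)

lemma volume_growth:
  obtains c dd where "c > 0" "dd > 0"
    "\<And>x. measure \<mu> (ball x 1) \<ge> 1 / c"
    "\<And>x r R. r > 0 \<Longrightarrow> R \<ge> 1 \<Longrightarrow>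
       measure \<mu> (ball x (R * r)) \<le> c * R powr dd * measure \<mu> (ball x r)"
proof -
  obtain c dd where c: "c > 0" "dd > 0" "(INF x. emeasure \<mu> (ball x 1)) \<ge> ennreal (1 / c)"
    and d: "\<And>x r R. r > 0 \<Longrightarrow> R \<ge> 1 \<Longrightarrow>
      emeasure \<mu> (ball x (R * r)) \<le> ennreal (c * R powr dd) * emeasure \<mu> (ball x r)"
    using volume by blast
  have "ennreal (1 / c) \<le> emeasure \<mu> (ball x 1)" for x
    using c(3) INF_lower[of x UNIV "\<lambda>x. emeasure \<mu> (ball x 1)"] by (auto intro: order_trans)
  then have "1 / c \<le> measure \<mu> (ball x 1)" for x by (simp add: emeasure_ball)
  moreover have "measure \<mu> (ball x (R * r)) \<le> c * R powr dd * measure \<mu> (ball x r)"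
    if "r > 0" "R \<ge> 1" for x r R
    using d[OF that, of x] c(1) unfolding emeasure_ball by (simp flip: ennreal_mult)
  ultimately show ?thesis using that c by blast
qed

text \<open>Doubling compares a small ball with the ball of radius one with the same centre.\<close>
lemma measure_ball_lower:
  assumes "r > 0"
  shows "\<exists>v>0. \<forall>x. v \<le> measure \<mu> (ball x r)"
proof -
  obtain c dd where g: "c > 0" "dd > 0" "\<And>x. measure \<mu> (ball x 1) \<ge> 1 / c"
    "\<And>x r R. r > 0 \<Longrightarrow> R \<ge> 1 \<Longrightarrow>
       measure \<mu> (ball x (R * r)) \<le> c * R powr dd * measure \<mu> (ball x r)"
    using volume_growth by metis
  define R where "R = max 1 (1 / r)"
  have R: "R \<ge> 1" "1 \<le> R * r" using assms by (auto simp: R_def max_def field_simps)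
  have "1 / c / (c * R powr dd) \<le> measure \<mu> (ball x r)" for x
  proof -
    have "1 / c \<le> measure \<mu> (ball x (R * r))"
      using g(3)[of x] measure_ball_mono[of x 1 x "R * r"] R by (simp add: subset_ball)
    also have "\<dots> \<le> c * R powr dd * measure \<mu> (ball x r)" using g(4) assms R by simp
    finally show ?thesis using g(1) R by (simp add: field_simps)
  qed
  moreover have "1 / c / (c * R powr dd) > 0" using g(1) R by simp
  ultimately show ?thesis by blast
qed

lemma measure_ball_pos: "r > 0 \<Longrightarrow> 0 < measure \<mu> (ball x r)"
  using measure_ball_lower[of r] by (meson less_le_trans)

text \<open>
  Balls are not null sets. This is how facts that hold for almost every point are transferred to
  every point.
\<close>
lemma AE_exists_in_ball:
  assumes "AE x in \<mu>. P x" "r > 0"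
  shows "\<exists>x'. dist x x' < r \<and> P x'"
proof (rule ccontr)
  assume "\<not> ?thesis"
  then have "AE y in \<mu>. y \<notin> ball x r"
    using assms(1) by (auto elim!: eventually_mono)
  then have "ball x r \<in> null_sets \<mu>" by (subst (asm) AE_iff_null) (auto simp: ball_def)
  then show False using measure_ball_pos[OF assms(2), of x] by (simp add: null_sets_def measure_def)
qed

lemma vol_pos: "t > 0 \<Longrightarrow> 0 < vol \<mu> t x y"
  by (simp add: vol_def measure_ball_pos)

lemma vol_lower:
  assumes "t > 0"
  shows "\<exists>v>0. \<forall>x y. v \<le> vol \<mu> t x y"
proof -
  obtain v where v: "v > 0" "\<And>x. v \<le> measure \<mu> (ball x (sqrt t))"
    using measure_ball_lower[of "sqrt t"] assms by auto
  have "v \<le> vol \<mu> t x y" for x y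
  proof -
    have "v = sqrt (v * v)" using v by simp
    also have "\<dots> \<le> vol \<mu> t x y"
      unfolding vol_def using v by (intro real_sqrt_le_mono mult_mono) (auto intro: less_imp_le)
    finally show ?thesis .
  qed
  then show ?thesis using v by blast
qed

lemma vol_mono: "s \<le> t \<Longrightarrow> vol \<mu> s x y \<le> vol \<mu> t x y"
  unfolding vol_def
  by (intro real_sqrt_le_mono mult_mono measure_ball_mono) (auto simp: subset_ball)

lemma vol_compare:
  assumes "l \<ge> 1"
  shows "\<exists>C>0. \<forall>t>0. \<forall>x x' y. dist x x' \<le> sqrt t \<longrightarrow> vol \<mu> (l * t) x' y \<le> C * vol \<mu> t x y"
proof -
  obtain c dd where g: "c > 0"
    "\<And>x r R. r > 0 \<Longrightarrow> R \<ge> 1 \<Longrightarrow>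
       measure \<mu> (ball x (R * r)) \<le> c * R powr dd * measure \<mu> (ball x r)"
    using volume_growth by metis
  define R where "R = sqrt l + 1"
  define C where "C = c * R powr dd"
  have R: "R \<ge> 1" using assms by (simp add: R_def)
  have C: "C > 0" using g(1) R by (simp add: C_def)
  have main: "vol \<mu> (l * t) x' y \<le> C * vol \<mu> t x y" if t: "t > 0" and d: "dist x x' \<le> sqrt t" for t x x' y
  proof -
    have *: "measure \<mu> (ball z' (sqrt (l * t))) \<le> C * measure \<mu> (ball z (sqrt t))"
      if "dist z z' \<le> sqrt t" for z z'
    proof -
      have "ball z' (sqrt (l * t)) \<subseteq> ball z (R * sqrt t)"
      proof
        fix w assume "w \<in> ball z' (sqrt (l * t))"
        then show "w \<in> ball z (R * sqrt t)"
          using that dist_triangle[of z w z'] by (simp add: R_def algebra_simps real_sqrt_mult)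
      qed
      then have "measure \<mu> (ball z' (sqrt (l * t))) \<le> measure \<mu> (ball z (R * sqrt t))"
        by (rule measure_ball_mono)
      also have "\<dots> \<le> C * measure \<mu> (ball z (sqrt t))"
        unfolding C_def using t R by (intro g(2)) auto
      finally show ?thesis .
    qed
    have "vol \<mu> (l * t) x' y \<le>
        sqrt ((C * measure \<mu> (ball x (sqrt t))) * (C * measure \<mu> (ball y (sqrt t))))"
      unfolding vol_def using *[OF d] *[of y y] t C
      by (intro real_sqrt_le_mono mult_mono) auto
    also have "\<dots> = C * vol \<mu> t x y"
      using C by (simp add: vol_def real_sqrt_mult)
    finally show ?thesis .
  qed
  show ?thesis by (intro exI[of _ C] conjI allI impI main C)
qed

lemma gauss_pos: "t > 0 \<Longrightarrow> 0 < gauss \<mu> c t x y"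
  by (simp add: gauss_def vol_pos)

lemma gauss_bounded:
  assumes "t > 0" "c > 0"
  shows "\<exists>B>0. \<forall>x y. gauss \<mu> c t x y \<le> B"
proof -
  obtain v where v: "v > 0" "\<And>x y. v \<le> vol \<mu> t x y" using vol_lower[OF assms(1)] by blast
  have "gauss \<mu> c t x y \<le> 1 / v * 1" for x y
    unfolding gauss_def using v assms vol_pos[OF assms(1), of x y]
    by (intro mult_mono divide_left_mono) auto
  then show ?thesis using v(1) by (intro exI[of _ "1 / v"]) auto
qed

lemma gauss_time:
  assumes "0 < s" "s \<le> r" "r \<le> 4 * s" "c > 0"
  shows "gauss \<mu> c r x y \<le> gauss \<mu> (c / 4) s x y"
proof -
  have "c / 4 * (dist x y)\<^sup>2 / s = c * (dist x y)\<^sup>2 / (4 * s)" by simp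
  also have "\<dots> \<le> c * (dist x y)\<^sup>2 / r" using assms by (intro divide_left_mono) auto
  finally have "exp (- c * (dist x y)\<^sup>2 / r) \<le> exp (- (c / 4) * (dist x y)\<^sup>2 / s)" by simp
  moreover have "1 / vol \<mu> r x y \<le> 1 / vol \<mu> s x y"
    using vol_mono[OF assms(2)] vol_pos assms by (intro divide_left_mono) (auto simp: vol_pos)
  ultimately show ?thesis
    unfolding gauss_def using vol_pos[OF assms(1), of x y] by (intro mult_mono) auto
qed

text \<open>
  Passing to a later time \<open>l * t\<close> widens the Gaussian. A large \<open>l\<close> pays for any smaller decay
  constant \<open>b\<close> and for a shift of the centre by \<open>sqrt t\<close>, and by doubling the volumes grow by a
  constant factor only.
\<close>
lemma gauss_compare:
  assumes "c > 0" "b > 0"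
  shows "\<exists>C>0. \<exists>l\<ge>1. \<forall>t>0. \<forall>x x' y. dist x x' \<le> sqrt t \<longrightarrow>
    gauss \<mu> c t x y \<le> C * gauss \<mu> b (l * t) x' y"
proof -
  \<comment> \<open>The factor \<open>2\<close> comes from \<open>d(x', y)\<^sup>2 \<le> 2 t + 2 d(x, y)\<^sup>2\<close>.\<close>
  define l where "l = max 1 (2 * b / c)"
  have l: "l \<ge> 1" "2 * b \<le> c * l" using assms by (auto simp: l_def max_def field_simps)
  obtain C where C: "C > 0"
    "\<And>t x x' y. t > 0 \<Longrightarrow> dist x x' \<le> sqrt t \<Longrightarrow> vol \<mu> (l * t) x' y \<le> C * vol \<mu> t x y"
    using vol_compare[OF l(1)] by metis
  have main: "gauss \<mu> c t x y \<le> C * exp c * gauss \<mu> b (l * t) x' y"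
    if t: "t > 0" and d: "dist x x' \<le> sqrt t" for t x x' y
  proof -
    have "(dist x' y)\<^sup>2 \<le> (sqrt t + dist x y)\<^sup>2"
      using d dist_triangle[of x' y x] by (intro power_mono) (auto simp: dist_commute)
    also have "\<dots> \<le> 2 * t + 2 * (dist x y)\<^sup>2"
      using t sum_squares_bound[of "sqrt t" "dist x y"] by (simp add: power2_sum)
    finally have "c * l * (dist x' y)\<^sup>2 \<le> c * l * (2 * t + 2 * (dist x y)\<^sup>2)"
      using l(1) assms by (intro mult_left_mono) auto
    moreover have "2 * b * (dist x' y)\<^sup>2 \<le> c * l * (dist x' y)\<^sup>2"
      using l(2) by (intro mult_right_mono) auto
    ultimately have "2 * b * (dist x' y)\<^sup>2 \<le> c * l * (2 * t + 2 * (dist x y)\<^sup>2)" by linarith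
    then have "b * (dist x' y)\<^sup>2 / (l * t) \<le> c + c * (dist x y)\<^sup>2 / t"
      using t l by (simp add: field_simps)
    then have "exp (- c * (dist x y)\<^sup>2 / t) \<le> exp (c + (- b * (dist x' y)\<^sup>2 / (l * t)))"
      by simp
    then have e: "exp (- c * (dist x y)\<^sup>2 / t) \<le> exp c * exp (- b * (dist x' y)\<^sup>2 / (l * t))"
      by (simp only: exp_add)
    have lt: "l * t > 0" using l t by (intro mult_pos_pos) auto
    have v: "1 / vol \<mu> t x y \<le> C / vol \<mu> (l * t) x' y"
      using C(2)[OF t d, of y] vol_pos[OF t, of x y] vol_pos[OF lt, of x' y]
      by (simp add: field_simps)
    have "gauss \<mu> c t x y \<le> C / vol \<mu> (l * t) x' y * (exp c * exp (- b * (dist x' y)\<^sup>2 / (l * t)))"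
      unfolding gauss_def using e v vol_pos[OF t, of x y] vol_pos[OF lt, of x' y] C(1)
      by (intro mult_mono) auto
    then show ?thesis by (simp add: gauss_def mult_ac)
  qed
  show ?thesis
    by (intro exI[of _ "C * exp c"] exI[of _ l] conjI allI impI main l(1)) (use C(1) in simp_all)
qed

text \<open>Half of the Gaussian decay pays for the polynomial weight.\<close>
lemma gauss_weight:
  assumes "c > 0"
  shows "\<exists>C>0. \<forall>t>0. \<forall>x y.
    (1 + dist x y) ^ n * gauss \<mu> c t x y \<le> C * (1 + sqrt t) ^ n * gauss \<mu> (c / 2) t x y"
proof -
  obtain C where C: "C > 0" "\<And>u::real. u \<ge> 0 \<Longrightarrow> (1 + u) ^ n \<le> C * exp (c / 2 * u\<^sup>2)"
    using polynomial_le_gaussian[of "c / 2" n] assms by auto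
  have main: "(1 + dist x y) ^ n * gauss \<mu> c t x y \<le> C * (1 + sqrt t) ^ n * gauss \<mu> (c / 2) t x y"
    if t: "t > 0" for t x y
  proof -
    define u where "u = dist x y / sqrt t"
    have u: "u \<ge> 0" "u\<^sup>2 = (dist x y)\<^sup>2 / t" "dist x y = u * sqrt t"
      using t by (auto simp: u_def power_divide)
    have "(1 + dist x y) ^ n \<le> ((1 + sqrt t) * (1 + u)) ^ n"
      using u t by (intro power_mono) (auto simp: algebra_simps)
    also have "\<dots> \<le> (1 + sqrt t) ^ n * (C * exp (c / 2 * u\<^sup>2))"
      unfolding power_mult_distrib using C(2)[OF u(1)] t by (intro mult_left_mono) auto
    finally have "(1 + dist x y) ^ n * gauss \<mu> c t x y
        \<le> (1 + sqrt t) ^ n * (C * exp (c / 2 * u\<^sup>2)) * gauss \<mu> c t x y"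
      using gauss_pos[OF t, of c x y] by (intro mult_right_mono) auto
    also have "\<dots> = C * (1 + sqrt t) ^ n *
        (1 / vol \<mu> t x y * (exp (c / 2 * u\<^sup>2) * exp (- c * (dist x y)\<^sup>2 / t)))"
      by (simp add: gauss_def)
    also have "exp (c / 2 * u\<^sup>2) * exp (- c * (dist x y)\<^sup>2 / t) = exp (- (c / 2) * (dist x y)\<^sup>2 / t)"
      unfolding u(2) exp_add[symmetric] by (simp add: field_simps)
    finally show ?thesis by (simp add: gauss_def)
  qed
  show ?thesis by (intro exI[of _ C] conjI allI impI main C(1))
qed

end

context heat_semigroup
begin

lemma heat_gauss_bounds:
  obtains C b c where "C > 0" "b > 0" "c > 0"
    "\<And>t x y. t > 0 \<Longrightarrow> gauss \<mu> b t x y \<le> C * H t x y"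
    "\<And>t x y. t > 0 \<Longrightarrow> H t x y \<le> C * gauss \<mu> c t x y"
proof -
  obtain C b c where *: "C > 0" "b > 0" "c > 0" "\<And>x y t. t > 0 \<Longrightarrow>
        1 / C * (1 / vol \<mu> t x y) * exp (- b * (dist x y)\<^sup>2 / t) \<le> H t x y \<and>
        H t x y \<le> C * (1 / vol \<mu> t x y) * exp (- c * (dist x y)\<^sup>2 / t)"
    using gaussian_bounds by blast
  show ?thesis
  proof (rule that[OF *(1-3)])
    fix t x y assume t: "(t::real) > 0"
    have "1 / C * gauss \<mu> b t x y \<le> H t x y" using *(4)[OF t, of x y] by (simp add: gauss_def)
    then show "gauss \<mu> b t x y \<le> C * H t x y" using *(1) by (simp add: field_simps)
    show "H t x y \<le> C * gauss \<mu> c t x y" using *(4)[OF t, of x y] by (simp add: gauss_def)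
  qed
qed

lemma heat_pos:
  assumes "t > 0"
  shows "0 < H t x y"
proof -
  obtain C b where *: "C > 0" "\<And>t x y. t > 0 \<Longrightarrow> gauss \<mu> b t x y \<le> C * H t x y"
    using heat_gauss_bounds by metis
  have "0 < C * H t x y" using gauss_pos[OF assms, of b x y] *(2)[OF assms, of x y] by simp
  then show ?thesis using *(1) by (simp add: zero_less_mult_iff)
qed

text \<open>
  The lower Gaussian bound turns an arbitrary Gaussian into a heat kernel at a later time; the
  latter has a known integral.
\<close>
lemma gauss_le_heat:
  assumes "c > 0"
  shows "\<exists>C>0. \<exists>l\<ge>1. \<forall>t>0. \<forall>x x' y. dist x x' \<le> sqrt t \<longrightarrow>
    gauss \<mu> c t x y \<le> C * H (l * t) x' y"
proof -
  obtain C b where *: "C > 0" "b > 0"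
    "\<And>t x y. t > 0 \<Longrightarrow> gauss \<mu> b t x y \<le> C * H t x y"
    using heat_gauss_bounds by metis
  obtain C' l where **: "C' > 0" "l \<ge> 1" "\<And>t x x' y. t > 0 \<Longrightarrow> dist x x' \<le> sqrt t \<Longrightarrow>
    gauss \<mu> c t x y \<le> C' * gauss \<mu> b (l * t) x' y"
    using gauss_compare[OF assms *(2)] by metis
  have main: "gauss \<mu> c t x y \<le> (C' * C) * H (l * t) x' y" if "t > 0" "dist x x' \<le> sqrt t" for t x x' y
  proof -
    have "C' * gauss \<mu> b (l * t) x' y \<le> C' * (C * H (l * t) x' y)"
      using * **(1,2) that by (intro mult_left_mono) auto
    then show ?thesis using **(3)[OF that, of y] by (simp add: mult.assoc)
  qed
  show ?thesis
    by (intro exI[of _ "C' * C"] exI[of _ l] conjI allI impI main mult_pos_pos *(1) **(1,2))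
qed

lemma heat_continuous:
  assumes "t > 0"
  shows "continuous_on UNIV (H t x)"
proof -
  obtain C a b where *: "C > 0" "a > 0" "b > 0" "\<And>x y y' t. t > 0 \<Longrightarrow> dist y y' \<le> sqrt t \<Longrightarrow>
        \<bar>H t x y - H t x y'\<bar> \<le>
          C * (dist y y' / sqrt t) powr a * (1 / vol \<mu> t x y) * exp (- b * (dist x y)\<^sup>2 / t)"
    using hoelder_bound by blast
  have "(H t x \<longlongrightarrow> H t x y) (at y)" for y
  proof (rule LIM_zero_cancel, rule tendsto_0_le)
    have "((\<lambda>y'. dist y y' / sqrt t) \<longlongrightarrow> dist y y / sqrt t) (at y)"
      using assms by (intro tendsto_intros) auto
    then show "((\<lambda>y'. (dist y y' / sqrt t) powr a) \<longlongrightarrow> 0) (at y)"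
      using *(2) assms by (intro tendsto_zero_powrI[OF _ tendsto_const]) auto
    have "\<forall>\<^sub>F y' in at y. dist y y' < sqrt t"
      using assms by (auto simp: eventually_at dist_commute intro!: exI[of _ "sqrt t"])
    then show "\<forall>\<^sub>F y' in at y. norm (H t x y' - H t x y) \<le>
        norm ((dist y y' / sqrt t) powr a) * (C * gauss \<mu> b t x y)"
    proof eventually_elim
      case (elim y')
      then show ?case using *(4)[OF assms, of y y' x] by (simp add: gauss_def abs_minus_commute mult_ac)
    qed
  qed
  then show ?thesis by (simp add: continuous_on_def)
qed

lemma heat_measurable: "t > 0 \<Longrightarrow> H t x \<in> borel_measurable \<mu>"
  unfolding measurable_mu using heat_continuous by (rule borel_measurable_continuous_onI)

text \<open>
  The heat kernel has integral one for almost every centre only, and the exceptional set depends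
  on the time. Hence the majorant is centred at a nearby point \<open>x'\<close>.
\<close>
lemma gauss_dominated:
  assumes "c > 0"
  shows "\<exists>C>0. \<forall>t>0. \<forall>x A. \<forall>g\<in>borel_measurable \<mu>. A \<ge> 0 \<longrightarrow>
    (AE y in \<mu>. \<bar>g y\<bar> \<le> A * gauss \<mu> c t x y) \<longrightarrow>
    integrable \<mu> g \<and> (\<integral>y. \<bar>g y\<bar> \<partial>\<mu>) \<le> C * A"
proof -
  obtain C l where *: "C > 0" "l \<ge> 1" "\<And>t x x' y. t > 0 \<Longrightarrow> dist x x' \<le> sqrt t \<Longrightarrow>
    gauss \<mu> c t x y \<le> C * H (l * t) x' y"
    using gauss_le_heat[OF assms] by metis
  have main: "integrable \<mu> g" "(\<integral>y. \<bar>g y\<bar> \<partial>\<mu>) \<le> C * A"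
    if t: "t > 0" and A: "A \<ge> 0" and g: "g \<in> borel_measurable \<mu>"
      and le: "AE y in \<mu>. \<bar>g y\<bar> \<le> A * gauss \<mu> c t x y" for t x A g
  proof -
    have lt: "l * t > 0" using * t by (intro mult_pos_pos) auto
    obtain x' where x': "dist x x' < sqrt t" "(\<integral>y. H (l * t) x' y \<partial>\<mu>) = 1"
      using AE_exists_in_ball[OF conservative[OF lt], of "sqrt t" x] t by auto
    \<comment> \<open>The integral of a function that is not integrable is \<open>0\<close>, not \<open>1\<close>.\<close>
    have int: "integrable \<mu> (H (l * t) x')"
      using x'(2) not_integrable_integral_eq by fastforce
    have le': "AE y in \<mu>. \<bar>g y\<bar> \<le> (C * A) * H (l * t) x' y"
      using le
    proof eventually_elim
      case (elim y)
      have "A * gauss \<mu> c t x y \<le> A * (C * H (l * t) x' y)"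
        using *(3)[OF t, of x x' y] x'(1) A by (intro mult_left_mono) auto
      then show ?case using elim by (simp add: mult_ac)
    qed
    have ig: "integrable \<mu> g"
      by (rule Bochner_Integration.integrable_bound[of _ "\<lambda>y. (C * A) * H (l * t) x' y"])
        (use int g le' in \<open>auto elim: eventually_mono\<close>)
    have "(\<integral>y. \<bar>g y\<bar> \<partial>\<mu>) \<le> (\<integral>y. (C * A) * H (l * t) x' y \<partial>\<mu>)"
      using ig int le' by (intro integral_mono_AE) auto
    then show "integrable \<mu> g" "(\<integral>y. \<bar>g y\<bar> \<partial>\<mu>) \<le> C * A" using ig x'(2) by simp_all
  qed
  show ?thesis
    by (intro exI[of _ C] conjI allI ballI impI *(1)) (rule main; assumption)+
qed

lemma gauss_dominated_L2:
  assumes "c > 0" "t > 0" "A \<ge> 0" "g \<in> borel_measurable \<mu>" "\<And>y. \<bar>g y\<bar> \<le> A * gauss \<mu> c t x y"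
  shows "g \<in> L2 \<mu>"
proof -
  obtain B where B: "B > 0" "\<And>x y. gauss \<mu> c t x y \<le> B" using gauss_bounded assms by metis
  have "AE y in \<mu>. \<bar>g y\<bar> \<le> A * gauss \<mu> c t x y" using assms(5) by simp
  then have i: "integrable \<mu> g" using gauss_dominated[OF assms(1)] assms(2-4) by blast
  have "integrable \<mu> (\<lambda>y. (g y)\<^sup>2)"
  proof (rule Bochner_Integration.integrable_bound)
    show "integrable \<mu> (\<lambda>y. A * B * g y)" using i by simp
    have "(g y)\<^sup>2 \<le> A * B * \<bar>g y\<bar>" for y
    proof -
      have "\<bar>g y\<bar> \<le> A * B"
        using assms(5)[of y] B(2)[of x y] assms(3) by (meson mult_left_mono order_trans)
      then have "\<bar>g y\<bar> * \<bar>g y\<bar> \<le> A * B * \<bar>g y\<bar>" by (intro mult_right_mono) auto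
      then show ?thesis by (simp add: power2_eq_square)
    qed
    then show "AE y in \<mu>. norm ((g y)\<^sup>2) \<le> norm (A * B * g y)"
      using assms(3) B(1) by (auto simp: abs_mult)
  qed (use assms(4) in measurable)
  then show ?thesis using assms(4) by (simp add: L2_def)
qed

lemma heat_L2: "t > 0 \<Longrightarrow> H t x \<in> L2 \<mu>"
proof -
  assume t: "t > 0"
  obtain C c where *: "C > 0" "c > 0" "\<And>t x y. t > 0 \<Longrightarrow> H t x y \<le> C * gauss \<mu> c t x y"
    using heat_gauss_bounds by metis
  show ?thesis
    by (rule gauss_dominated_L2[OF *(2) t, of C])
      (use * t heat_pos[OF t] heat_measurable[OF t] in \<open>auto simp: abs_of_pos\<close>)
qed

text \<open>
  The uniformity in the centre serves the continuity of the heat kernel in its first variable, and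
  the uniformity in the time serves Taylor expansion in \<open>t\<close>.
\<close>
lemma gauss_L2_dominator:
  assumes "c > 0" "t > 0"
  obtains G where "G \<in> L2 \<mu>" "\<And>y. 0 \<le> G y"
    "\<And>x' r y. dist x x' \<le> sqrt t \<Longrightarrow> t \<le> r \<Longrightarrow> r \<le> 4 * t \<Longrightarrow> gauss \<mu> c r x' y \<le> G y"
proof -
  have "c / 4 > 0" using assms by simp
  then obtain C l where *: "C > 0" "l \<ge> 1" "\<And>t x x' y. t > 0 \<Longrightarrow> dist x x' \<le> sqrt t \<Longrightarrow>
    gauss \<mu> (c / 4) t x y \<le> C * H (l * t) x' y"
    using gauss_le_heat[of "c / 4"] by metis
  have lt: "l * t > 0" using * assms by (intro mult_pos_pos) auto
  show ?thesis
  proof (rule that[of "\<lambda>y. C * H (l * t) x y"])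
    show "(\<lambda>y. C * H (l * t) x y) \<in> L2 \<mu>" using heat_L2[OF lt] by (rule L2_scale)
    show "0 \<le> C * H (l * t) x y" for y using heat_pos[OF lt, of x y] *(1) by simp
    show "gauss \<mu> c r x' y \<le> C * H (l * t) x y"
      if "dist x x' \<le> sqrt t" "t \<le> r" "r \<le> 4 * t" for x' r y
      using gauss_time[OF assms(2) that(2,3) assms(1), of x' y] *(3)[OF assms(2), of x' x y] that(1)
      by (simp add: dist_commute)
  qed
qed

definition weighted_constant :: "real \<Rightarrow> nat \<Rightarrow> real \<Rightarrow> bool" where
  "weighted_constant c n C \<longleftrightarrow> C > 0 \<and>
    (\<forall>t>0. \<forall>x x\<^sub>0 A K. \<forall>k\<in>borel_measurable \<mu>. \<forall>u\<in>borel_measurable \<mu>. A \<ge> 0 \<longrightarrow> K \<ge> 0 \<longrightarrow>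
      (\<forall>y. \<bar>k y\<bar> \<le> A * gauss \<mu> c t x y) \<longrightarrow> (AE y in \<mu>. (1 + dist y x\<^sub>0) ^ n * \<bar>u y\<bar> \<le> K) \<longrightarrow>
      (1 + dist x x\<^sub>0) ^ n * \<bar>\<integral>y. k y * u y \<partial>\<mu>\<bar> \<le> C * A * (1 + sqrt t) ^ n * K)"

text \<open>
  The weight splits as \<open>1 + d(x, x\<^sub>0) \<le> (1 + d(x, y)) (1 + d(y, x\<^sub>0))\<close>; the first factor is
  absorbed by the Gaussian, at the cost of \<open>(1 + sqrt t)\<^sup>n\<close>, and the second one by \<open>u\<close>.
\<close>
lemma weighted_kernel_bound:
  assumes "c > 0"
  shows "\<exists>C. weighted_constant c n C"
proof -
  obtain C1 where C1: "C1 > 0" "\<And>t x y. t > 0 \<Longrightarrow>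
    (1 + dist x y) ^ n * gauss \<mu> c t x y \<le> C1 * (1 + sqrt t) ^ n * gauss \<mu> (c / 2) t x y"
    using gauss_weight[OF assms] by metis
  have "c / 2 > 0" using assms by simp
  from gauss_dominated[OF this] obtain C2 where C2: "C2 > 0" "\<forall>t>0. \<forall>x A. \<forall>g\<in>borel_measurable \<mu>.
    A \<ge> 0 \<longrightarrow> (AE y in \<mu>. \<bar>g y\<bar> \<le> A * gauss \<mu> (c / 2) t x y) \<longrightarrow>
    integrable \<mu> g \<and> (\<integral>y. \<bar>g y\<bar> \<partial>\<mu>) \<le> C2 * A"
    by (elim exE conjE)
  have main: "(1 + dist x x\<^sub>0) ^ n * \<bar>\<integral>y. k y * u y \<partial>\<mu>\<bar> \<le> (C2 * C1) * A * (1 + sqrt t) ^ n * K"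
    if t: "t > 0" and A: "A \<ge> 0" and K: "K \<ge> 0" and [measurable]: "k \<in> borel_measurable \<mu>"
      "u \<in> borel_measurable \<mu>" and k: "\<And>y. \<bar>k y\<bar> \<le> A * gauss \<mu> c t x y"
      and u: "AE y in \<mu>. (1 + dist y x\<^sub>0) ^ n * \<bar>u y\<bar> \<le> K" for t x x\<^sub>0 A K k u
  proof -
    define g where "g y = (1 + dist x x\<^sub>0) ^ n * (k y * u y)" for y
    have [measurable]: "g \<in> borel_measurable \<mu>" unfolding g_def by measurable
    have "AE y in \<mu>. \<bar>g y\<bar> \<le> (C1 * A * (1 + sqrt t) ^ n * K) * gauss \<mu> (c / 2) t x y"
      using u
    proof eventually_elim
      case (elim y)
      have "1 + dist x x\<^sub>0 \<le> (1 + dist x y) * (1 + dist y x\<^sub>0)"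
        using dist_triangle[of x x\<^sub>0 y] mult_nonneg_nonneg[OF zero_le_dist[of x y] zero_le_dist[of y x\<^sub>0]]
        unfolding distrib_left distrib_right mult_1 mult_1_right by linarith
      then have "(1 + dist x x\<^sub>0) ^ n \<le> (1 + dist x y) ^ n * (1 + dist y x\<^sub>0) ^ n"
        unfolding power_mult_distrib[symmetric] by (intro power_mono) auto
      then have "\<bar>g y\<bar> \<le> ((1 + dist x y) ^ n * (1 + dist y x\<^sub>0) ^ n) * (A * gauss \<mu> c t x y * \<bar>u y\<bar>)"
        unfolding g_def abs_mult using k[of y] by (intro mult_mono) auto
      also have "\<dots> = A * ((1 + dist x y) ^ n * gauss \<mu> c t x y) * ((1 + dist y x\<^sub>0) ^ n * \<bar>u y\<bar>)"
        by (simp add: mult_ac)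
      also have "\<dots> \<le> A * (C1 * (1 + sqrt t) ^ n * gauss \<mu> (c / 2) t x y) * K"
        using C1(1) A K t less_imp_le[OF gauss_pos[OF t, of "c / 2" x y]]
        by (intro mult_mono[OF mult_left_mono[OF C1(2)[OF t] A] elim]) auto
      finally show ?case by (simp add: mult_ac)
    qed
    then have "(\<integral>y. \<bar>g y\<bar> \<partial>\<mu>) \<le> C2 * (C1 * A * (1 + sqrt t) ^ n * K)"
      using C1(1) A K t by (intro C2(2)[rule_format, THEN conjunct2]) auto
    moreover have "\<bar>\<integral>y. g y \<partial>\<mu>\<bar> \<le> (\<integral>y. \<bar>g y\<bar> \<partial>\<mu>)" by (rule integral_abs_bound)
    moreover have "(\<integral>y. g y \<partial>\<mu>) = (1 + dist x x\<^sub>0) ^ n * (\<integral>y. k y * u y \<partial>\<mu>)"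
      unfolding g_def by (rule integral_mult_right_zero)
    ultimately show ?thesis by (simp add: abs_mult mult_ac)
  qed
  show ?thesis
    unfolding weighted_constant_def
    by (intro exI[of _ "C2 * C1"] conjI allI ballI impI mult_pos_pos C1(1) C2(1))
      (rule main; (assumption | erule spec))
qed

end

section \<open>Smoothness of the heat kernel\<close>

lemma Ck_on_cong:
  assumes "open S" "Ck_on k S f" "\<And>x. x \<in> S \<Longrightarrow> f x = g x"
  shows "Ck_on k S g"
  using assms(2,3)
proof (induction k arbitrary: f g)
  case 0
  then show ?case using continuous_on_cong[of S S f g] by simp
next
  case (Suc k)
  have d: "g differentiable (at x)" if x: "x \<in> S" for x
  proof -
    have "f differentiable (at x)" using Suc.prems x by simp
    then obtain f' where "(f has_derivative f') (at x)" by (auto simp: differentiable_def)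
    then have "(g has_derivative f') (at x)"
      by (rule has_derivative_transform_within_open[OF _ assms(1) x Suc.prems(2)])
    then show ?thesis by (auto simp: differentiable_def)
  qed
  have e: "frechet_derivative f (at x) = frechet_derivative g (at x)" if x: "x \<in> S" for x
    using Suc.prems x by (intro frechet_derivative_transform_within_open[OF _ assms(1) x]) auto
  have "Ck_on k S (\<lambda>x. frechet_derivative g (at x) v)" for v
    by (rule Suc.IH[of "\<lambda>x. frechet_derivative f (at x) v"]) (use Suc.prems e in auto)
  then show ?case using d by simp
qed

text \<open>
  Freezing some of the variables of a jointly smooth function is composition with an affine map.
  In this way one lemma gives the smoothness of the heat kernel in the time and in each point.
\<close>
lemma Ck_on_affine:
  assumes "open S" "open C" "bounded_linear l" "\<And>x. x \<in> C \<Longrightarrow> p + l x \<in> S" "Ck_on k S F"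
  shows "Ck_on k C (\<lambda>x. F (p + l x))"
  using assms(5)
proof (induction k arbitrary: F)
  case 0
  have "continuous_on C (\<lambda>x. p + l x)"
    by (intro continuous_intros linear_continuous_on assms)
  then show ?case using 0 assms(4)
    by (auto intro!: continuous_on_compose2[of S F C])
next
  case (Suc k)
  have D: "((\<lambda>x. F (p + l x)) has_derivative (\<lambda>v. frechet_derivative F (at (p + l x)) (l v))) (at x)"
    if "x \<in> C" for x
  proof -
    have "((\<lambda>x. p + l x) has_derivative l) (at x)"
      using has_derivative_add[OF has_derivative_const bounded_linear_imp_has_derivative[OF assms(3)]]
      by simp
    moreover have "(F has_derivative frechet_derivative F (at (p + l x))) (at (p + l x))"
      using Suc.prems assms(4)[OF that] by (simp add: frechet_derivative_works)
    ultimately show ?thesis by (rule has_derivative_compose)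
  qed
  have "Ck_on k C (\<lambda>x. frechet_derivative (\<lambda>x. F (p + l x)) (at x) v)" for v
  proof (rule Ck_on_cong[OF assms(2)])
    show "Ck_on k C (\<lambda>x. frechet_derivative F (at (p + l x)) (l v))"
      using Suc.prems by (intro Suc.IH) simp
    show "frechet_derivative F (at (p + l x)) (l v) = frechet_derivative (\<lambda>x. F (p + l x)) (at x) v"
      if "x \<in> C" for x
      using frechet_derivative_at[OF D[OF that]] by metis
  qed
  then show ?case using D by (auto simp: differentiable_def)
qed

lemma smooth_on_affine:
  assumes "open S" "open C" "bounded_linear l" "\<And>x. x \<in> C \<Longrightarrow> p + l x \<in> S" "smooth_on S F"
  shows "smooth_on C (\<lambda>x. F (p + l x))"
  unfolding smooth_on_def
proof
  fix k
  have "Ck_on k S F" using assms(5) unfolding smooth_on_def by blast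
  with assms(1-4) show "Ck_on k C (\<lambda>x. F (p + l x))" using Ck_on_affine[of S C l p k F] by blast
qed

lemma smooth_on_deriv:
  fixes g :: "real \<Rightarrow> real"
  assumes "open S" "smooth_on S g"
  shows "smooth_on S (deriv g)"
  unfolding smooth_on_def
proof
  fix k
  have g: "Ck_on (Suc k) S g" using assms(2) unfolding smooth_on_def by blast
  have "frechet_derivative g (at x) 1 = deriv g x" if "x \<in> S" for x
  proof -
    have "g differentiable (at x)" using g that by simp
    then have D: "(g has_field_derivative deriv g x) (at x)"
      by (metis DERIV_deriv_iff_real_differentiable)
    show ?thesis
      using frechet_derivative_at[OF D[unfolded has_field_derivative_def]] by (metis mult_1_right)
  qed
  moreover have "Ck_on k S (\<lambda>x. frechet_derivative g (at x) 1)" using g by simp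
  ultimately show "Ck_on k S (deriv g)" using Ck_on_cong[OF assms(1)] by blast
qed

lemma smooth_on_iterated_deriv:
  fixes g :: "real \<Rightarrow> real"
  assumes "open S" "smooth_on S g" "t \<in> S"
  shows "((deriv ^^ k) g has_real_derivative (deriv ^^ Suc k) g t) (at t)"
proof -
  have "smooth_on S ((deriv ^^ k) g)"
    by (induction k) (use assms smooth_on_deriv in auto)
  then have "Ck_on 1 S ((deriv ^^ k) g)" unfolding smooth_on_def by blast
  then have "(deriv ^^ k) g differentiable (at t)" using assms(3) by simp
  then show ?thesis by (simp add: DERIV_deriv_iff_real_differentiable)
qed

context heat_manifold
begin

lemma chart_at:
  obtains U \<phi> where "(U, \<phi>) \<in> \<A>" "x \<in> U"
proof -
  have "x \<in> (\<Union>(U, \<phi>) \<in> \<A>. U)" using atlas by (simp add: smooth_atlas_def)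
  then show ?thesis using that by auto
qed

lemma chart_open: "(U, \<phi>) \<in> \<A> \<Longrightarrow> open U"
  and chart_image_open: "(U, \<phi>) \<in> \<A> \<Longrightarrow> open (\<phi> ` U)"
  and chart_continuous: "(U, \<phi>) \<in> \<A> \<Longrightarrow> continuous_on U \<phi>"
  and chart_inverse: "(U, \<phi>) \<in> \<A> \<Longrightarrow> x \<in> U \<Longrightarrow> inv_into U \<phi> (\<phi> x) = x"
  using atlas by (auto simp: smooth_atlas_def homeomorphism_def)

lemma smooth_on_chart_continuous:
  assumes "(U, \<phi>) \<in> \<A>" "smooth_on (\<phi> ` U) (\<lambda>u. f (inv_into U \<phi> u))" "x \<in> U"
  shows "isCont f x"
proof -
  have "Ck_on 0 (\<phi> ` U) (\<lambda>u. f (inv_into U \<phi> u))" using assms(2) unfolding smooth_on_def by blast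
  then have "continuous_on (\<phi> ` U) (\<lambda>u. f (inv_into U \<phi> u))" by simp
  from continuous_on_compose2[OF this chart_continuous[OF assms(1)] order_refl]
  have "continuous_on U (\<lambda>x. f (inv_into U \<phi> (\<phi> x)))" .
  then have "continuous_on U f"
    using chart_inverse[OF assms(1)] continuous_on_cong[of U U "\<lambda>x. f (inv_into U \<phi> (\<phi> x))" f]
    by simp
  then show ?thesis using chart_open[OF assms(1)] assms(3) by (simp add: continuous_on_eq_continuous_at)
qed

lemma smooth_fun_continuous:
  assumes "smooth_fun \<A> f"
  shows "continuous_on UNIV f"
proof (rule continuous_at_imp_continuous_on, safe)
  fix x
  obtain U \<phi> where c: "(U, \<phi>) \<in> \<A>" "x \<in> U" using chart_at by metis
  then have "smooth_on (\<phi> ` U) (\<lambda>u. f (inv_into U \<phi> u))"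
    using assms by (auto simp: smooth_fun_def)
  then show "isCont f x" using smooth_on_chart_continuous c by blast
qed

lemma smooth_fun_measurable: "smooth_fun \<A> f \<Longrightarrow> f \<in> borel_measurable \<mu>"
  unfolding measurable_mu using smooth_fun_continuous by (rule borel_measurable_continuous_onI)

lemma heat_smooth_charts:
  assumes "(U, \<phi>) \<in> \<A>" "(V, \<psi>) \<in> \<A>"
  shows "smooth_on ({0<..} \<times> \<phi> ` U \<times> \<psi> ` V)
    (\<lambda>(t, u, v). H t (inv_into U \<phi> u) (inv_into V \<psi> v))"
    and "open ({0<..} \<times> \<phi> ` U \<times> \<psi> ` V :: (real \<times> 'e \<times> 'e) set)"
  using kernel_smooth assms chart_image_open
  by (auto simp: smooth_kernel_def intro!: open_Times)

lemma heat_time_derivative: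
  assumes "t > 0"
  shows "((deriv ^^ k) (\<lambda>s. H s x y) has_real_derivative (deriv ^^ Suc k) (\<lambda>s. H s x y) t) (at t)"
proof -
  obtain U \<phi> V \<psi> where c: "(U, \<phi>) \<in> \<A>" "x \<in> U" "(V, \<psi>) \<in> \<A>" "y \<in> V" using chart_at by metis
  have "smooth_on {0<..} (\<lambda>s. (\<lambda>(t, u, v). H t (inv_into U \<phi> u) (inv_into V \<psi> v))
      ((0, \<phi> x, \<psi> y) + (s, 0, 0)))"
    by (rule smooth_on_affine[OF heat_smooth_charts(2)[OF c(1,3)] _ _ _ heat_smooth_charts(1)[OF c(1,3)]])
      (use c in \<open>auto intro!: bounded_linear_intros\<close>)
  then have "smooth_on {0<..} (\<lambda>s. H s x y)" using c by (simp add: chart_inverse)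
  then show ?thesis using assms by (intro smooth_on_iterated_deriv[of "{0<..}"]) auto
qed

lemma heat_continuous_left:
  assumes "t > 0"
  shows "isCont (\<lambda>x. H t x y) x"
proof -
  obtain U \<phi> V \<psi> where c: "(U, \<phi>) \<in> \<A>" "x \<in> U" "(V, \<psi>) \<in> \<A>" "y \<in> V" using chart_at by metis
  have "smooth_on (\<phi> ` U) (\<lambda>s. (\<lambda>(t, u, v). H t (inv_into U \<phi> u) (inv_into V \<psi> v))
      ((t, 0, \<psi> y) + (0, s, 0)))"
    by (rule smooth_on_affine[OF heat_smooth_charts(2)[OF c(1,3)] _ _ _ heat_smooth_charts(1)[OF c(1,3)]])
      (use c assms chart_image_open in \<open>auto intro!: bounded_linear_intros\<close>)
  then show ?thesis
    using c by (intro smooth_on_chart_continuous[OF c(1) _ c(2)]) (simp add: chart_inverse)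
qed

lemma heat_smooth_right:
  assumes "t > 0"
  shows "smooth_fun \<A> (H t x)"
  unfolding smooth_fun_def
proof safe
  fix V \<psi> assume V: "(V, \<psi>) \<in> \<A>"
  obtain U \<phi> where c: "(U, \<phi>) \<in> \<A>" "x \<in> U" using chart_at by metis
  have "smooth_on (\<psi> ` V) (\<lambda>s. (\<lambda>(t, u, v). H t (inv_into U \<phi> u) (inv_into V \<psi> v))
      ((t, \<phi> x, 0) + (0, 0, s)))"
    by (rule smooth_on_affine[OF heat_smooth_charts(2)[OF c(1) V] _ _ _ heat_smooth_charts(1)[OF c(1) V]])
      (use c assms chart_image_open V in \<open>auto intro!: bounded_linear_intros\<close>)
  then show "smooth_on (\<psi> ` V) (\<lambda>u. H t x (inv_into V \<psi> u))"
    using c by (simp add: chart_inverse)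
qed

lemma iterated_smooth:
  assumes "J \<in> multi_indices \<kappa> n" "smooth_fun \<A> f"
  shows "smooth_fun \<A> (iterated (vf_action X) J f)"
proof -
  have "set J \<subseteq> {1..\<kappa>} \<Longrightarrow> smooth_fun \<A> (foldr (vf_action X) J f)"
    using assms(2) vector_fields
    by (induction J) (auto simp: vf_action_def[abs_def] smooth_vector_field_def)
  then show ?thesis using assms(1) by (simp add: multi_indices_def iterated_def)
qed

end

section \<open>The heat kernel lies in the domain of all powers of the generator\<close>

text \<open>A weak form of the Lagrange remainder that is symmetric in the positions of \<open>c\<close> and \<open>x\<close>.\<close>
lemma Taylor_order_2_bound:
  fixes g g' g'' :: "real \<Rightarrow> real"
  assumes "\<And>r. a \<le> r \<Longrightarrow> r \<le> b \<Longrightarrow> (g has_real_derivative g' r) (at r)"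
    and "\<And>r. a \<le> r \<Longrightarrow> r \<le> b \<Longrightarrow> (g' has_real_derivative g'' r) (at r)"
    and "\<And>r. a \<le> r \<Longrightarrow> r \<le> b \<Longrightarrow> \<bar>g'' r\<bar> \<le> B"
    and "a \<le> c" "c \<le> b" "a \<le> x" "x \<le> b"
  shows "\<bar>g x - g c - (x - c) * g' c\<bar> \<le> (x - c)\<^sup>2 * B"
proof (cases "x = c")
  case False
  define d where "d m = (if m = 0 then g else if m = 1 then g' else g'')" for m :: nat
  have "\<exists>t. (if x < c then x < t \<and> t < c else c < t \<and> t < x) \<and>
    g x = (\<Sum>m<2. d m c / fact m * (x - c) ^ m) + d 2 t / fact 2 * (x - c) ^ 2"
    using False assms by (intro Taylor[of 2 d g a b]) (auto simp: d_def less_2_cases_iff)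
  then obtain t where ts: "if x < c then x < t \<and> t < c else c < t \<and> t < x"
    and "g x = (\<Sum>m<2. d m c / fact m * (x - c) ^ m) + d 2 t / fact 2 * (x - c) ^ 2"
    by blast
  moreover have t: "a \<le> t" "t \<le> b" using ts assms(4-7) by (auto split: if_splits)
  ultimately have e: "g x - g c - (x - c) * g' c = (x - c)\<^sup>2 * (g'' t / 2)"
    by (simp add: d_def numeral_2_eq_2)
  have "\<bar>g'' t / 2\<bar> \<le> B" using assms(3)[OF t] by simp
  then show ?thesis unfolding e abs_mult by (intro mult_mono) auto
next
  case True
  have "0 \<le> B" using assms(3)[of c] assms(4,5) by auto
  then show ?thesis using True by simp
qed

context heat_semigroup
begin

lemma T_operator: "t \<ge> 0 \<Longrightarrow> l2_operator \<mu> (L2 \<mu>) (T t)"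
  and T_contraction: "t \<ge> 0 \<Longrightarrow> u \<in> L2 \<mu> \<Longrightarrow> l2_norm \<mu> (T t u) \<le> l2_norm \<mu> u"
  and T_0: "u \<in> L2 \<mu> \<Longrightarrow> AE x in \<mu>. T 0 u x = u x"
  and T_plus: "s \<ge> 0 \<Longrightarrow> t \<ge> 0 \<Longrightarrow> u \<in> L2 \<mu> \<Longrightarrow> AE x in \<mu>. T (s + t) u x = T s (T t u) x"
  and T_strongly_continuous:
    "u \<in> L2 \<mu> \<Longrightarrow> ((\<lambda>t. l2_norm \<mu> (\<lambda>x. T t u x - u x)) \<longlongrightarrow> 0) (at_right 0)"
  and T_generator: "u \<in> L2 \<mu> \<Longrightarrow> w \<in> L2 \<mu> \<Longrightarrow>
    (u \<in> D \<and> (AE x in \<mu>. - L u x = w x)) \<longleftrightarrow>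
    ((\<lambda>h. l2_norm \<mu> (\<lambda>x. (T h u x - u x) / h - w x)) \<longlongrightarrow> 0) (at_right 0)"
  using T_semigroup by (simp_all add: l2_contraction_semigroup_def)

lemma T_L2: "t \<ge> 0 \<Longrightarrow> u \<in> L2 \<mu> \<Longrightarrow> T t u \<in> L2 \<mu>"
  using T_operator unfolding l2_operator_def by blast

lemma T_cong_AE: "t \<ge> 0 \<Longrightarrow> u \<in> L2 \<mu> \<Longrightarrow> v \<in> L2 \<mu> \<Longrightarrow> AE x in \<mu>. u x = v x \<Longrightarrow>
    AE x in \<mu>. T t u x = T t v x"
  using T_operator unfolding l2_operator_def by blast

lemma T_add: "t \<ge> 0 \<Longrightarrow> u \<in> L2 \<mu> \<Longrightarrow> v \<in> L2 \<mu> \<Longrightarrow>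
    AE x in \<mu>. T t (\<lambda>x. u x + v x) x = T t u x + T t v x"
  using T_operator unfolding l2_operator_def linear_ae_on_def by blast

lemma T_scale: "t \<ge> 0 \<Longrightarrow> u \<in> L2 \<mu> \<Longrightarrow> AE x in \<mu>. T t (\<lambda>x. c * u x) x = c * T t u x"
  using T_operator unfolding l2_operator_def linear_ae_on_def by blast

lemma T_diff:
  assumes "t \<ge> 0" "u \<in> L2 \<mu>" "v \<in> L2 \<mu>"
  shows "AE x in \<mu>. T t (\<lambda>x. u x - v x) x = T t u x - T t v x"
  using T_add[OF assms(1,2) L2_scale[OF assms(3), of "-1"]] T_scale[OF assms(1,3), of "-1"]
  by eventually_elim simp

lemma T_norm_diff:
  assumes "t \<ge> 0" "u \<in> L2 \<mu>" "v \<in> L2 \<mu>"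
  shows "l2_norm \<mu> (\<lambda>x. T t u x - T t v x) \<le> l2_norm \<mu> (\<lambda>x. u x - v x)"
proof -
  have d: "(\<lambda>x. u x - v x) \<in> L2 \<mu>" using assms L2_diff by blast
  have "l2_norm \<mu> (\<lambda>x. T t u x - T t v x) = l2_norm \<mu> (T t (\<lambda>x. u x - v x))"
    using T_diff[OF assms] L2_measurable[OF T_L2[OF assms(1) d]]
      L2_measurable[OF L2_diff[OF T_L2[OF assms(1,2)] T_L2[OF assms(1,3)]]]
    by (intro l2_norm_cong_AE) (auto elim: eventually_mono)
  then show ?thesis using T_contraction[OF assms(1) d] by simp
qed

lemma D_L2: "u \<in> D \<Longrightarrow> u \<in> L2 \<mu>"
  and L_L2: "u \<in> D \<Longrightarrow> L u \<in> L2 \<mu>"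
  and D_cong_AE: "u \<in> D \<Longrightarrow> v \<in> L2 \<mu> \<Longrightarrow> AE x in \<mu>. u x = v x \<Longrightarrow> v \<in> D"
  and L_cong_AE: "u \<in> D \<Longrightarrow> v \<in> L2 \<mu> \<Longrightarrow> AE x in \<mu>. u x = v x \<Longrightarrow> AE x in \<mu>. L u x = L v x"
  and D_add: "u \<in> D \<Longrightarrow> v \<in> D \<Longrightarrow> (\<lambda>x. u x + v x) \<in> D"
  and L_add: "u \<in> D \<Longrightarrow> v \<in> D \<Longrightarrow> AE x in \<mu>. L (\<lambda>x. u x + v x) x = L u x + L v x"
  and D_scale: "u \<in> D \<Longrightarrow> (\<lambda>x. c * u x) \<in> D"
  and L_scale: "u \<in> D \<Longrightarrow> AE x in \<mu>. L (\<lambda>x. c * u x) x = c * L u x"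
  using L_operator unfolding l2_operator_def linear_ae_on_def by blast+

lemma L_symmetric: "u \<in> D \<Longrightarrow> v \<in> D \<Longrightarrow> l2_inner \<mu> (L u) v = l2_inner \<mu> u (L v)"
  using L_self_adjoint D_L2 L_L2 unfolding l2_self_adjoint_def by (metis (mono_tags, lifting) AE_I2)

text \<open>
  The difference quotients of \<open>T t u\<close> are the images under \<open>T t\<close> of those of \<open>u\<close>, and \<open>T t\<close> is
  a contraction.
\<close>
lemma T_commutes_L:
  assumes "t \<ge> 0" "u \<in> D"
  shows "T t u \<in> D" "AE x in \<mu>. L (T t u) x = T t (L u) x"
proof -
  note u = D_L2[OF assms(2)] and Lu = L_L2[OF assms(2)]
  define w where "w = (\<lambda>x. - L u x)"
  have w: "w \<in> L2 \<mu>" using L2_scale[OF Lu, of "-1"] by (simp add: w_def)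
  have TL: "AE x in \<mu>. T t w x = - T t (L u) x"
    using T_scale[OF assms(1) Lu, of "-1"] by (simp add: w_def)
  have lim: "((\<lambda>h. l2_norm \<mu> (\<lambda>x. (T h u x - u x) / h - w x)) \<longlongrightarrow> 0) (at_right 0)"
    using T_generator[OF u w] assms(2) by (simp add: w_def)
  have "((\<lambda>h. l2_norm \<mu> (\<lambda>x. (T h (T t u) x - T t u x) / h - T t w x)) \<longlongrightarrow> 0) (at_right 0)"
  proof (rule tendsto_0_le[OF lim, where K=1])
    have "\<forall>\<^sub>F h in at_right (0::real). h > 0" by (simp add: eventually_at_right_less)
    then show "\<forall>\<^sub>F h in at_right 0. norm (l2_norm \<mu> (\<lambda>x. (T h (T t u) x - T t u x) / h - T t w x))
        \<le> norm (l2_norm \<mu> (\<lambda>x. (T h u x - u x) / h - w x)) * 1"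
    proof eventually_elim
      case (elim h)
      define q where "q = (\<lambda>x. (1 / h) * (T h u x - u x))"
      have Th: "T h u \<in> L2 \<mu>" using T_L2 elim u by simp
      have d: "(\<lambda>x. T h u x - u x) \<in> L2 \<mu>" using L2_diff[OF Th u] .
      have q: "q \<in> L2 \<mu>" unfolding q_def using L2_scale[OF d] .
      have h: "0 \<le> h" using elim by simp
      have "AE x in \<mu>. (T h (T t u) x - T t u x) / h - T t w x = T t q x - T t w x"
        using T_scale[OF assms(1) d, of "1 / h"] T_diff[OF assms(1) Th u]
          T_plus[OF h assms(1) u] T_plus[OF assms(1) h u]
        by eventually_elim (simp add: q_def add.commute)
      then have "l2_norm \<mu> (\<lambda>x. (T h (T t u) x - T t u x) / h - T t w x) =
          l2_norm \<mu> (\<lambda>x. T t q x - T t w x)"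
        using T_L2[OF h T_L2[OF assms(1) u]] T_L2[OF assms(1) u] T_L2[OF assms(1) w]
          T_L2[OF assms(1) q]
        by (intro l2_norm_cong_AE) (auto dest!: L2_measurable)
      also have "\<dots> \<le> l2_norm \<mu> (\<lambda>x. q x - w x)" using T_norm_diff[OF assms(1) q w] .
      finally show ?case by (simp add: q_def l2_norm_nonneg)
    qed
  qed
  then have *: "T t u \<in> D \<and> (AE x in \<mu>. - L (T t u) x = T t w x)"
    using T_generator[OF T_L2[OF assms(1) u] T_L2[OF assms(1) w]] by blast
  then show "T t u \<in> D" by blast
  from * have "AE x in \<mu>. - L (T t u) x = T t w x" by blast
  with TL show "AE x in \<mu>. L (T t u) x = T t (L u) x" by eventually_elim simp
qed

text \<open>The common domain of all powers of \<open>L\<close>.\<close>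
definition Dinf :: "('a \<Rightarrow> real) set" where
  "Dinf = {u. \<forall>n. (L ^^ n) u \<in> D}"

lemma Dinf_D: "u \<in> Dinf \<Longrightarrow> (L ^^ n) u \<in> D"
  by (simp add: Dinf_def)

lemma Dinf_pow_L2: "u \<in> Dinf \<Longrightarrow> (L ^^ n) u \<in> L2 \<mu>"
  using Dinf_D D_L2 by blast

lemma Dinf_L2: "u \<in> Dinf \<Longrightarrow> u \<in> L2 \<mu>"
  using Dinf_pow_L2[of u 0] by simp

lemma Dinf_pow: "u \<in> Dinf \<Longrightarrow> (L ^^ n) u \<in> Dinf"
  by (auto simp: Dinf_def simp flip: funpow_add[unfolded o_def fun_eq_iff, rule_format])

text \<open>
  The powers of \<open>L\<close> act on representatives. Since \<open>L\<close> respects equality almost everywhere, they may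
  be computed with any choice of representatives \<open>v n\<close> along the way; linearity of the powers and
  their commutation with the semigroup are instances.
\<close>
lemma Dinf_I:
  assumes "\<And>n. v n \<in> D" "\<And>n. AE x in \<mu>. L (v n) x = v (Suc n) x"
    and "u \<in> L2 \<mu>" "AE x in \<mu>. u x = v 0 x"
  shows "u \<in> Dinf" "AE x in \<mu>. (L ^^ n) u x = v n x"
proof -
  have *: "(L ^^ n) u \<in> D \<and> (AE x in \<mu>. (L ^^ n) u x = v n x)" for n
  proof (induction n)
    case 0
    have "AE x in \<mu>. v 0 x = u x" using assms(4) by eventually_elim simp
    then show ?case using D_cong_AE[OF assms(1) assms(3)] assms(4) by simp
  next
    case (Suc n)
    have "AE x in \<mu>. L ((L ^^ n) u) x = L (v n) x"
      using L_cong_AE Suc assms(1) D_L2 by blast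
    then have e: "AE x in \<mu>. (L ^^ Suc n) u x = v (Suc n) x"
      using assms(2)[of n] by eventually_elim simp
    moreover have "(L ^^ Suc n) u \<in> L2 \<mu>" using Suc L_L2 by simp
    moreover have "AE x in \<mu>. v (Suc n) x = (L ^^ Suc n) u x" using e by eventually_elim simp
    ultimately show ?case using D_cong_AE[OF assms(1)] by blast
  qed
  then show "u \<in> Dinf" "AE x in \<mu>. (L ^^ n) u x = v n x" by (auto simp: Dinf_def)
qed

lemma Dinf_cong_AE:
  assumes "u \<in> Dinf" "v \<in> L2 \<mu>" "AE x in \<mu>. u x = v x"
  shows "v \<in> Dinf" "AE x in \<mu>. (L ^^ n) v x = (L ^^ n) u x"
proof -
  have "AE x in \<mu>. v x = (L ^^ 0) u x" using assms(3) by eventually_elim simp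
  from Dinf_I[of "\<lambda>n. (L ^^ n) u", OF Dinf_D[OF assms(1)] _ assms(2) this]
  show "v \<in> Dinf" "AE x in \<mu>. (L ^^ n) v x = (L ^^ n) u x" by simp_all
qed

lemma Dinf_add:
  assumes "u \<in> Dinf" "v \<in> Dinf"
  shows "(\<lambda>x. u x + v x) \<in> Dinf"
    "AE x in \<mu>. (L ^^ n) (\<lambda>x. u x + v x) x = (L ^^ n) u x + (L ^^ n) v x"
proof -
  have 1: "(\<lambda>x. (L ^^ n) u x + (L ^^ n) v x) \<in> D" for n
    using D_add Dinf_D assms by blast
  have 2: "AE x in \<mu>. L (\<lambda>x. (L ^^ n) u x + (L ^^ n) v x) x =
      (L ^^ Suc n) u x + (L ^^ Suc n) v x" for n
    using L_add[OF Dinf_D[OF assms(1)] Dinf_D[OF assms(2)]] by simp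
  have 3: "(\<lambda>x. u x + v x) \<in> L2 \<mu>" using L2_add Dinf_L2 assms by blast
  from Dinf_I[of "\<lambda>n x. (L ^^ n) u x + (L ^^ n) v x", OF 1 2 3]
  show "(\<lambda>x. u x + v x) \<in> Dinf"
    "AE x in \<mu>. (L ^^ n) (\<lambda>x. u x + v x) x = (L ^^ n) u x + (L ^^ n) v x" by simp_all
qed

lemma Dinf_scale:
  assumes "u \<in> Dinf"
  shows "(\<lambda>x. c * u x) \<in> Dinf"
    "AE x in \<mu>. (L ^^ n) (\<lambda>x. c * u x) x = c * (L ^^ n) u x"
proof -
  have 1: "(\<lambda>x. c * (L ^^ n) u x) \<in> D" for n
    using D_scale Dinf_D assms by blast
  have 2: "AE x in \<mu>. L (\<lambda>x. c * (L ^^ n) u x) x = c * (L ^^ Suc n) u x" for n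
    using L_scale[OF Dinf_D[OF assms(1)]] by simp
  have 3: "(\<lambda>x. c * u x) \<in> L2 \<mu>" using L2_scale Dinf_L2 assms by blast
  from Dinf_I[of "\<lambda>n x. c * (L ^^ n) u x", OF 1 2 3]
  show "(\<lambda>x. c * u x) \<in> Dinf"
    "AE x in \<mu>. (L ^^ n) (\<lambda>x. c * u x) x = c * (L ^^ n) u x" by simp_all
qed

lemma Dinf_diff:
  assumes "u \<in> Dinf" "v \<in> Dinf"
  shows "(\<lambda>x. u x - v x) \<in> Dinf"
    "AE x in \<mu>. (L ^^ n) (\<lambda>x. u x - v x) x = (L ^^ n) u x - (L ^^ n) v x"
proof -
  note s = Dinf_scale(1)[OF assms(2), where c = "-1"]
    Dinf_scale(2)[OF assms(2), where c = "-1"]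
  show "(\<lambda>x. u x - v x) \<in> Dinf" using Dinf_add(1)[OF assms(1) s(1)] by simp
  show "AE x in \<mu>. (L ^^ n) (\<lambda>x. u x - v x) x = (L ^^ n) u x - (L ^^ n) v x"
    using Dinf_add(2)[OF assms(1) s(1), of n] s(2)[of n] by eventually_elim simp
qed

lemma Dinf_T:
  assumes "t \<ge> 0" "u \<in> Dinf"
  shows "T t u \<in> Dinf" "AE x in \<mu>. (L ^^ n) (T t u) x = T t ((L ^^ n) u) x"
proof -
  have 1: "T t ((L ^^ n) u) \<in> D" for n
    using T_commutes_L(1) Dinf_D assms by blast
  have 2: "AE x in \<mu>. L (T t ((L ^^ n) u)) x = T t ((L ^^ Suc n) u) x" for n
    using T_commutes_L(2)[OF assms(1) Dinf_D[OF assms(2)]] by simp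
  have 3: "T t u \<in> L2 \<mu>" using T_L2 Dinf_L2 assms by blast
  from Dinf_I[of "\<lambda>n. T t ((L ^^ n) u)", OF 1 2 3]
  show "T t u \<in> Dinf" "AE x in \<mu>. (L ^^ n) (T t u) x = T t ((L ^^ n) u) x" by simp_all
qed

lemma L_pow_symmetric:
  assumes "u \<in> Dinf" "v \<in> Dinf"
  shows "l2_inner \<mu> ((L ^^ n) u) v = l2_inner \<mu> u ((L ^^ n) v)"
proof -
  have "l2_inner \<mu> ((L ^^ n) u) v = l2_inner \<mu> u ((L ^^ n) v)" if "v \<in> Dinf" for v
    using that
  proof (induction n arbitrary: v)
    case (Suc n)
    have "l2_inner \<mu> ((L ^^ Suc n) u) v = l2_inner \<mu> ((L ^^ n) u) (L v)"
      using L_symmetric[OF Dinf_D[OF assms(1)] Dinf_D[OF Suc.prems, of 0], of n] by simp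
    also have "\<dots> = l2_inner \<mu> u ((L ^^ n) (L v))"
      using Suc.IH Dinf_pow[OF Suc.prems, of 1] by simp
    finally show ?case by (simp add: funpow_swap1)
  qed simp
  then show ?thesis using assms(2) .
qed

text \<open>The set where two continuous functions differ is open, so it contains a ball if it is nonempty.\<close>
lemma continuous_AE_eq:
  assumes "AE x in \<mu>. f x = g x" "\<And>x. isCont f x" "\<And>x. isCont g x"
  shows "f x = (g x :: real)"
proof (rule ccontr)
  assume "f x \<noteq> g x"
  moreover have "isCont (\<lambda>x. f x - g x) x" using assms by (intro continuous_intros)
  ultimately have "\<forall>\<^sub>F y in at x. f y - g y \<noteq> 0"
    by (intro tendsto_imp_eventually_ne[of _ "f x - g x"]) (auto simp: isCont_def)
  then obtain e where "e > 0" "\<And>y. dist y x < e \<Longrightarrow> y \<noteq> x \<Longrightarrow> f y \<noteq> g y"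
    by (auto simp: eventually_at)
  then show False
    using AE_exists_in_ball[OF assms(1), of e x] \<open>f x \<noteq> g x\<close> by (metis dist_commute)
qed

end

context heat_manifold
begin

definition heat_dt :: "nat \<Rightarrow> real \<Rightarrow> 'a \<Rightarrow> 'a \<Rightarrow> real" where
  "heat_dt k t x y = (deriv ^^ k) (\<lambda>s. H s x y) t"

definition heat_quotient :: "nat \<Rightarrow> real \<Rightarrow> 'a \<Rightarrow> real \<Rightarrow> 'a \<Rightarrow> real" where
  "heat_quotient k t x h y = (1 / h) * (heat_dt k (t + h) x y - heat_dt k t x y)"

lemma heat_dt_0: "heat_dt 0 = H"
  by (simp add: heat_dt_def fun_eq_iff)

lemma heat_dt_derivative:
  "t > 0 \<Longrightarrow> ((\<lambda>s. heat_dt k s x y) has_real_derivative heat_dt (Suc k) t x y) (at t)"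
  unfolding heat_dt_def using heat_time_derivative[of t k x y] by simp

lemma heat_dt_bound:
  "\<exists>C>0. \<exists>c>0. \<forall>t>0. \<forall>x y. \<bar>heat_dt k t x y\<bar> \<le> C * t powr (- real k) * gauss \<mu> c t x y"
  using time_derivative_bounds[of k] unfolding heat_dt_def gauss_def by (simp add: mult.assoc) blast

lemma heat_dt_measurable: "t > 0 \<Longrightarrow> heat_dt k t x \<in> borel_measurable \<mu>"
proof (induction k arbitrary: t)
  case 0
  then show ?case using heat_measurable by (simp add: heat_dt_0)
next
  case (Suc k)
  define e where "e i = inverse (real (Suc i))" for i
  have e: "e i > 0" "filterlim e (at 0) sequentially" for i
    using LIMSEQ_inverse_real_of_nat by (auto simp: e_def[abs_def] filterlim_at)
  show ?case
  proof (rule borel_measurable_LIMSEQ_real)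
    fix y
    have "((\<lambda>h. (heat_dt k (t + h) x y - heat_dt k t x y) / h) \<longlongrightarrow> heat_dt (Suc k) t x y) (at 0)"
      using heat_dt_derivative[OF Suc.prems] by (simp add: DERIV_def)
    from filterlim_compose[OF this e(2)]
    show "(\<lambda>i. (heat_dt k (t + e i) x y - heat_dt k t x y) / e i) \<longlonglongrightarrow> heat_dt (Suc k) t x y" .
  next
    fix i
    have "t + e i > 0" using Suc.prems e(1)[of i] by simp
    then show "(\<lambda>y. (heat_dt k (t + e i) x y - heat_dt k t x y) / e i) \<in> borel_measurable \<mu>"
      using Suc.IH Suc.prems by simp
  qed
qed

lemma heat_dt_L2:
  assumes "t > 0"
  shows "heat_dt k t x \<in> L2 \<mu>"
proof -
  obtain C c where *: "C > 0" "c > 0"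
    "\<And>t x y. t > 0 \<Longrightarrow> \<bar>heat_dt k t x y\<bar> \<le> C * t powr (- real k) * gauss \<mu> c t x y"
    using heat_dt_bound by metis
  show ?thesis
    by (rule gauss_dominated_L2[OF *(2) assms _ heat_dt_measurable[OF assms] *(3)[OF assms]])
      (use *(1) in simp)
qed

text \<open>
  The bound on the second derivative in time gives one square integrable majorant for the Taylor
  remainders at all times near \<open>t\<close>.
\<close>
lemma heat_dt_Taylor:
  assumes "t > 0"
  obtains G where "G \<in> L2 \<mu>" "\<And>y. 0 \<le> G y"
    "\<And>s y. t / 2 \<le> s \<Longrightarrow> s \<le> 2 * t \<Longrightarrow>
       \<bar>heat_dt k s x y - heat_dt k t x y - (s - t) * heat_dt (Suc k) t x y\<bar> \<le> (s - t)\<^sup>2 * G y"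
proof -
  obtain C c where *: "C > 0" "c > 0"
    "\<And>t x y. t > 0 \<Longrightarrow> \<bar>heat_dt (Suc (Suc k)) t x y\<bar>
      \<le> C * t powr (- real (Suc (Suc k))) * gauss \<mu> c t x y"
    using heat_dt_bound by metis
  \<comment> \<open>Based at \<open>t / 2\<close>, the majorant covers the times up to \<open>4 * (t / 2) = 2 * t\<close>.\<close>
  have t2: "t / 2 > 0" using assms by simp
  obtain G where G: "G \<in> L2 \<mu>" "\<And>y. 0 \<le> G y"
    "\<And>x' r y. dist x x' \<le> sqrt (t / 2) \<Longrightarrow> t / 2 \<le> r \<Longrightarrow> r \<le> 4 * (t / 2) \<Longrightarrow> gauss \<mu> c r x' y \<le> G y"
    using gauss_L2_dominator[OF *(2) t2] by metis
  define A where "A = C * (t / 2) powr (- real (Suc (Suc k)))"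
  have A: "A \<ge> 0" using *(1) by (simp add: A_def)
  show ?thesis
  proof (rule that[of "\<lambda>y. A * G y"])
    show "(\<lambda>y. A * G y) \<in> L2 \<mu>" using G(1) by (rule L2_scale)
    show "0 \<le> A * G y" for y using A G(2) by simp
    fix s y assume s: "t / 2 \<le> s" "s \<le> 2 * t"
    show "\<bar>heat_dt k s x y - heat_dt k t x y - (s - t) * heat_dt (Suc k) t x y\<bar> \<le> (s - t)\<^sup>2 * (A * G y)"
    proof (rule Taylor_order_2_bound[where a = "t / 2" and b = "2 * t" and g = "\<lambda>s. heat_dt k s x y"
          and g' = "\<lambda>s. heat_dt (Suc k) s x y" and g'' = "\<lambda>s. heat_dt (Suc (Suc k)) s x y"])
      fix r assume r: "t / 2 \<le> r" "r \<le> 2 * t"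
      then have r0: "r > 0" using assms by simp
      show "((\<lambda>s. heat_dt k s x y) has_real_derivative heat_dt (Suc k) r x y) (at r)"
        "((\<lambda>s. heat_dt (Suc k) s x y) has_real_derivative heat_dt (Suc (Suc k)) r x y) (at r)"
        using r0 by (rule heat_dt_derivative)+
      have "\<bar>heat_dt (Suc (Suc k)) r x y\<bar> \<le> C * r powr (- real (Suc (Suc k))) * gauss \<mu> c r x y"
        by (rule *(3)[OF r0])
      also have "\<dots> \<le> A * G y"
        unfolding A_def using *(1) G(3)[of x r y] r t2 gauss_pos[OF r0, of c x y]
        by (intro mult_mono mult_left_mono powr_mono2') auto
      finally show "\<bar>heat_dt (Suc (Suc k)) r x y\<bar> \<le> A * G y" .
    qed (use s assms in auto)
  qed
qed

lemma heat_dt_L2_derivative: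
  assumes "t > 0"
  shows "((\<lambda>h. l2_norm \<mu> (\<lambda>y. heat_quotient k t x h y - heat_dt (Suc k) t x y))
    \<longlongrightarrow> 0) (at 0)"
proof -
  obtain G where G: "G \<in> L2 \<mu>" "\<And>y. 0 \<le> G y"
    "\<And>s y. t / 2 \<le> s \<Longrightarrow> s \<le> 2 * t \<Longrightarrow>
       \<bar>heat_dt k s x y - heat_dt k t x y - (s - t) * heat_dt (Suc k) t x y\<bar> \<le> (s - t)\<^sup>2 * G y"
    using heat_dt_Taylor[OF assms] by metis
  show ?thesis
  proof (rule tendsto_0_le[where K = "l2_norm \<mu> G"])
    show "((\<lambda>h::real. h) \<longlongrightarrow> 0) (at 0)" by (rule tendsto_ident_at)
    have "\<forall>\<^sub>F h in at (0::real). h \<noteq> 0 \<and> \<bar>h\<bar> < t / 2"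
      using assms by (auto simp: eventually_at dist_real_def intro!: exI[of _ "t / 2"])
    then show "\<forall>\<^sub>F h in at 0.
        norm (l2_norm \<mu> (\<lambda>y. heat_quotient k t x h y - heat_dt (Suc k) t x y))
        \<le> norm h * l2_norm \<mu> G"
    proof eventually_elim
      case (elim h)
      then have h: "h \<noteq> 0" "t + h > 0" "t / 2 \<le> t + h" "t + h \<le> 2 * t" using assms by auto
      have "l2_norm \<mu> (\<lambda>y. heat_quotient k t x h y - heat_dt (Suc k) t x y)
          \<le> l2_norm \<mu> (\<lambda>y. h * G y)"
      proof (rule l2_norm_dominated[OF L2_scale[OF G(1)]])
        show "(\<lambda>y. heat_quotient k t x h y - heat_dt (Suc k) t x y)
            \<in> borel_measurable \<mu>"
          using heat_dt_measurable h(2) assms unfolding heat_quotient_def by simp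
        have "\<bar>heat_quotient k t x h y - heat_dt (Suc k) t x y\<bar> \<le> \<bar>h * G y\<bar>" for y
        proof -
          define E where "E = heat_dt k (t + h) x y - heat_dt k t x y - h * heat_dt (Suc k) t x y"
          have "\<bar>E\<bar> \<le> h\<^sup>2 * G y" using G(3)[OF h(3,4), of y] by (simp add: E_def)
          then have "\<bar>E / h\<bar> \<le> \<bar>h\<bar> * G y"
            using h(1) by (simp add: abs_divide divide_le_eq power2_eq_square mult_ac)
          moreover have "E / h = heat_quotient k t x h y - heat_dt (Suc k) t x y"
            using h(1) by (simp add: E_def heat_quotient_def diff_divide_distrib)
          ultimately show ?thesis using G(2)[of y] by (simp add: abs_mult)
        qed
        then show "AE y in \<mu>. \<bar>heat_quotient k t x h y - heat_dt (Suc k) t x y\<bar>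
            \<le> \<bar>h * G y\<bar>" by simp
      qed
      then show ?case by (simp add: l2_norm_scale l2_norm_nonneg)
    qed
  qed
qed

lemma heat_inner_continuous:
  assumes "t > 0" "u \<in> L2 \<mu>"
  shows "isCont (\<lambda>x. l2_inner \<mu> (H t x) u) x"
  unfolding continuous_at_sequentially
proof safe
  fix X assume X: "X \<longlonglongrightarrow> x"
  obtain C c where *: "C > 0" "c > 0" "\<And>t x y. t > 0 \<Longrightarrow> H t x y \<le> C * gauss \<mu> c t x y"
    using heat_gauss_bounds by metis
  obtain G where G: "G \<in> L2 \<mu>" "\<And>y. 0 \<le> G y"
    "\<And>x' r y. dist x x' \<le> sqrt t \<Longrightarrow> t \<le> r \<Longrightarrow> r \<le> 4 * t \<Longrightarrow> gauss \<mu> c r x' y \<le> G y"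
    using gauss_L2_dominator[OF *(2) assms(1), of x] by metis
  have "\<forall>\<^sub>F n in sequentially. dist (X n) x < sqrt t"
    using X assms(1) by (intro tendstoD) auto
  then obtain N where N: "\<And>n. n \<ge> N \<Longrightarrow> dist (X n) x < sqrt t"
    by (auto simp: eventually_sequentially)
  have "(\<lambda>n. l2_inner \<mu> (H t (X (n + N))) u) \<longlonglongrightarrow> l2_inner \<mu> (H t x) u"
    unfolding l2_inner_def
  proof (rule integral_dominated_convergence[where w = "\<lambda>y. C * (G y * \<bar>u y\<bar>)"])
    have "(\<lambda>y. \<bar>u y\<bar>) \<in> L2 \<mu>" using L2_dominated[OF assms(2)] L2_measurable[OF assms(2)] by simp
    then show "integrable \<mu> (\<lambda>y. C * (G y * \<bar>u y\<bar>))" using L2_mult_integrable[OF G(1)] by simp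
    have "(\<lambda>n. H t (X (n + N)) y) \<longlonglongrightarrow> H t x y" for y
      using isCont_tendsto_compose[OF heat_continuous_left[OF assms(1)] LIMSEQ_ignore_initial_segment[OF X]] .
    then show "AE y in \<mu>. (\<lambda>n. H t (X (n + N)) y * u y) \<longlonglongrightarrow> H t x y * u y"
      by (intro AE_I2 tendsto_intros) auto
    show "AE y in \<mu>. norm (H t (X (n + N)) y * u y) \<le> C * (G y * \<bar>u y\<bar>)" for n
    proof (rule AE_I2)
      fix y
      have "H t (X (n + N)) y \<le> C * G y"
        using *(3)[OF assms(1), of "X (n + N)" y] G(3)[of "X (n + N)" t y] N[of "n + N"] assms(1) *(1)
        by (simp add: dist_commute) (meson less_imp_le mult_left_mono order_trans)
      then have "H t (X (n + N)) y * \<bar>u y\<bar> \<le> C * G y * \<bar>u y\<bar>" by (intro mult_right_mono) auto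
      then show "norm (H t (X (n + N)) y * u y) \<le> C * (G y * \<bar>u y\<bar>)"
        using heat_pos[OF assms(1), of "X (n + N)" y] by (simp add: abs_mult mult.assoc)
    qed
  qed (use heat_measurable[OF assms(1)] assms(2) in \<open>auto dest: L2_measurable\<close>)
  then show "((\<lambda>x. l2_inner \<mu> (H t x) u) \<circ> X) \<longlonglongrightarrow> l2_inner \<mu> (H t x) u"
    unfolding o_def by (rule LIMSEQ_offset)
qed

lemma T_inner:
  assumes "t > 0" "u \<in> L2 \<mu>"
  shows "AE x in \<mu>. T t u x = l2_inner \<mu> (H t x) u"
  using kernel[OF assms] by (simp add: l2_inner_def)

text \<open>
  The Chapman-Kolmogorov identity. For a fixed \<open>u\<close>, symmetry of \<open>T s\<close> and the semigroup law
  give \<open>\<langle>T\<^sub>s H\<^sub>t(x, \<cdot>), u\<rangle> = \<langle>H\<^sub>t(x, \<cdot>), T\<^sub>s u\<rangle> = T\<^sub>t\<^sub>+\<^sub>s u(x)\<close> for almost every \<open>x\<close>, and both sides are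
  continuous in \<open>x\<close>. So the exceptional set, which depends on \<open>u\<close>, disappears.
\<close>
lemma heat_semigroup_kernel:
  assumes "s > 0" "t > 0"
  shows "AE y in \<mu>. T s (H t x) y = H (t + s) x y"
proof (rule l2_eq_AE_if_inner_eq)
  note Ht = heat_L2[OF assms(2)]
  have ts: "t + s > 0" using assms by simp
  have s0: "s \<ge> 0" "t \<ge> 0" using assms by auto
  show "T s (H t x) \<in> L2 \<mu>" using T_L2 s0 Ht by blast
  show "H (t + s) x \<in> L2 \<mu>" using heat_L2[OF ts] .
  fix u assume u: "u \<in> L2 \<mu>"
  have Tu: "T s u \<in> L2 \<mu>" using T_L2 s0 u by blast
  have "l2_inner \<mu> (H (t + s) x) u = l2_inner \<mu> (H t x) (T s u)"
  proof (rule continuous_AE_eq[of "\<lambda>x. l2_inner \<mu> (H (t + s) x) u"])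
    show "AE x in \<mu>. l2_inner \<mu> (H (t + s) x) u = l2_inner \<mu> (H t x) (T s u)"
      using T_inner[OF ts u] T_inner[OF assms(2) Tu] T_plus[OF s0(2,1) u] by eventually_elim simp
  qed (use heat_inner_continuous[OF ts u] heat_inner_continuous[OF assms(2) Tu] in auto)
  then show "l2_inner \<mu> (T s (H t x)) u = l2_inner \<mu> (H (t + s) x) u"
    using T_symmetric[OF assms(1) Ht u] by simp
qed

text \<open>
  Differentiating the Chapman-Kolmogorov identity in \<open>t\<close>: both sides are limits in \<open>L\<^sup>2\<close> of
  the same difference quotients.
\<close>
lemma heat_dt_semigroup:
  assumes "s > 0" "t > 0"
  shows "AE y in \<mu>. T s (heat_dt k t x) y = heat_dt k (t + s) x y"
  using assms(2)
proof (induction k arbitrary: t)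
  case 0
  then show ?case using heat_semigroup_kernel[OF assms(1)] by (simp add: heat_dt_0)
next
  case (Suc k)
  have ts: "t + s > 0" and s0: "s \<ge> 0" using assms Suc.prems by auto
  have q: "heat_quotient k t x h \<in> L2 \<mu>" if "t > 0" "h > 0" for t h
    unfolding heat_quotient_def[abs_def] using that by (intro L2_scale L2_diff heat_dt_L2) auto
  have lim: "((\<lambda>h. l2_norm \<mu> (\<lambda>y. heat_quotient k t x h y - heat_dt (Suc k) t x y)) \<longlongrightarrow> 0) (at_right 0)"
    if "t > 0" for t
    using heat_dt_L2_derivative[OF that, of k x] by (simp add: filterlim_at_split)
  have pos: "\<forall>\<^sub>F h in at_right (0::real). h > 0" by (simp add: eventually_at_right_less)
  show ?case
  proof (rule l2_limit_unique[where F = "at_right (0::real)" and u = "heat_quotient k (t + s) x"])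
    show "\<forall>\<^sub>F h in at_right 0. heat_quotient k (t + s) x h \<in> L2 \<mu>"
      using pos by eventually_elim (rule q[OF ts])
    show "((\<lambda>h. l2_norm \<mu> (\<lambda>y. heat_quotient k (t + s) x h y - heat_dt (Suc k) (t + s) x y)) \<longlongrightarrow> 0) (at_right 0)"
      by (rule lim[OF ts])
    show "((\<lambda>h. l2_norm \<mu> (\<lambda>y. heat_quotient k (t + s) x h y - T s (heat_dt (Suc k) t x) y)) \<longlongrightarrow> 0) (at_right 0)"
    proof (rule tendsto_0_le[OF lim[OF Suc.prems], where K=1])
      show "\<forall>\<^sub>F h in at_right 0. norm (l2_norm \<mu> (\<lambda>y. heat_quotient k (t + s) x h y - T s (heat_dt (Suc k) t x) y))
          \<le> norm (l2_norm \<mu> (\<lambda>y. heat_quotient k t x h y - heat_dt (Suc k) t x y)) * 1"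
        using pos
      proof eventually_elim
        case (elim h)
        have th: "t + h > 0" using Suc.prems elim by simp
        have d: "(\<lambda>y. heat_dt k (t + h) x y - heat_dt k t x y) \<in> L2 \<mu>"
          using heat_dt_L2 th Suc.prems L2_diff by blast
        have "AE y in \<mu>. heat_quotient k (t + s) x h y = T s (heat_quotient k t x h) y"
          unfolding heat_quotient_def[abs_def]
          using T_scale[OF s0 d, of "1 / h"] T_diff[OF s0 heat_dt_L2[OF th] heat_dt_L2[OF Suc.prems], of k x k x]
            Suc.IH[OF th] Suc.IH[OF Suc.prems]
          by eventually_elim (simp add: add_ac)
        then have "l2_norm \<mu> (\<lambda>y. heat_quotient k (t + s) x h y - T s (heat_dt (Suc k) t x) y) =
            l2_norm \<mu> (\<lambda>y. T s (heat_quotient k t x h) y - T s (heat_dt (Suc k) t x) y)"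
          using q[OF ts elim] T_L2[OF s0 q[OF Suc.prems elim]] T_L2[OF s0 heat_dt_L2[OF Suc.prems]]
          by (intro l2_norm_cong_AE borel_measurable_diff L2_measurable)
            (auto elim: eventually_mono)
        also have "\<dots> \<le> l2_norm \<mu> (\<lambda>y. heat_quotient k t x h y - heat_dt (Suc k) t x y)"
          using T_norm_diff[OF s0 q[OF Suc.prems elim] heat_dt_L2[OF Suc.prems]] .
        finally show ?case by (simp add: l2_norm_nonneg)
      qed
    qed
  qed (use heat_dt_L2[OF ts] T_L2[OF s0 heat_dt_L2[OF Suc.prems]] in auto)
qed

text \<open>
  By the preceding identity the difference quotients that define the generator are difference
  quotients of the kernel in time.
\<close>
lemma heat_dt_generator:
  assumes "t > 0"
  shows "heat_dt k t x \<in> D" "AE y in \<mu>. L (heat_dt k t x) y = - heat_dt (Suc k) t x y"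
proof -
  note h1 = heat_dt_L2[OF assms, of k x] and h2 = heat_dt_L2[OF assms, of "Suc k" x]
  have lim: "((\<lambda>h. l2_norm \<mu> (\<lambda>y. heat_quotient k t x h y - heat_dt (Suc k) t x y))
      \<longlongrightarrow> 0) (at_right 0)"
    using heat_dt_L2_derivative[OF assms, of k x] by (simp add: filterlim_at_split)
  have "((\<lambda>h. l2_norm \<mu> (\<lambda>y. (T h (heat_dt k t x) y - heat_dt k t x y) / h - heat_dt (Suc k) t x y))
      \<longlongrightarrow> 0) (at_right 0)"
  proof (rule Lim_transform_eventually[OF lim])
    have "\<forall>\<^sub>F h in at_right (0::real). h > 0" by (simp add: eventually_at_right_less)
    then show "\<forall>\<^sub>F h in at_right 0.
        l2_norm \<mu> (\<lambda>y. heat_quotient k t x h y - heat_dt (Suc k) t x y) =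
        l2_norm \<mu> (\<lambda>y. (T h (heat_dt k t x) y - heat_dt k t x y) / h - heat_dt (Suc k) t x y)"
    proof eventually_elim
      case (elim h)
      have "t + h > 0" using elim assms by simp
      have "AE y in \<mu>. heat_quotient k t x h y - heat_dt (Suc k) t x y =
          (T h (heat_dt k t x) y - heat_dt k t x y) / h - heat_dt (Suc k) t x y"
        using heat_dt_semigroup[OF elim assms, of k x]
        by eventually_elim (simp add: heat_quotient_def)
      then show ?case
        using heat_dt_measurable[OF \<open>t + h > 0\<close>] heat_dt_measurable[OF assms]
          L2_measurable[OF T_L2[OF less_imp_le[OF elim] h1]]
        unfolding heat_quotient_def by (intro l2_norm_cong_AE) auto
    qed
  qed
  then have *: "heat_dt k t x \<in> D \<and> (AE y in \<mu>. - L (heat_dt k t x) y = heat_dt (Suc k) t x y)"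
    using T_generator[OF h1 h2] by blast
  then show "heat_dt k t x \<in> D" by blast
  from * have "AE y in \<mu>. - L (heat_dt k t x) y = heat_dt (Suc k) t x y" by blast
  then show "AE y in \<mu>. L (heat_dt k t x) y = - heat_dt (Suc k) t x y" by eventually_elim simp
qed

lemma heat_Dinf:
  assumes "t > 0"
  shows "H t x \<in> Dinf" "AE y in \<mu>. (L ^^ n) (H t x) y = (-1) ^ n * heat_dt n t x y"
proof -
  have 1: "(\<lambda>y. (-1) ^ n * heat_dt n t x y) \<in> D" for n
    using heat_dt_generator(1)[OF assms] by (rule D_scale)
  have 2: "AE y in \<mu>. L (\<lambda>y. (-1) ^ n * heat_dt n t x y) y = (-1) ^ Suc n * heat_dt (Suc n) t x y" for n
    using L_scale[OF heat_dt_generator(1)[OF assms], of "(-1) ^ n" n x] heat_dt_generator(2)[OF assms, of n x]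
    by eventually_elim simp
  from Dinf_I[of "\<lambda>n y. (-1) ^ n * heat_dt n t x y", OF 1 2 heat_L2[OF assms]]
  show "H t x \<in> Dinf" "AE y in \<mu>. (L ^^ n) (H t x) y = (-1) ^ n * heat_dt n t x y"
    by (simp_all add: heat_dt_0)
qed

end

section \<open>Test functions and distributions\<close>

context heat_manifold_distributions
begin

abbreviation S where "S \<equiv> schwartz \<mu> D L x\<^sub>0"

abbreviation schwartz_top where "schwartz_top \<equiv> schwartz_topology \<mu> D L x\<^sub>0"

abbreviation distr where "distr \<equiv> distributions \<mu> D L x\<^sub>0"

text \<open>
  The Schwartz seminorms involve an essential supremum and a maximum over \<open>k\<close>. The estimates are
  more convenient for a single function and a given constant; \<open>seminorm_le_iff\<close> translates.
\<close>
definition wbound :: "nat \<Rightarrow> real \<Rightarrow> ('a \<Rightarrow> real) \<Rightarrow> bool" where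
  "wbound n K u \<longleftrightarrow> (AE x in \<mu>. (1 + dist x x\<^sub>0) ^ n * \<bar>u x\<bar> \<le> K)"

lemma wbound_mono:
  assumes "wbound n K u" "m \<le> n" "K \<le> K'"
  shows "wbound m K' u"
  using assms(1) unfolding wbound_def
proof eventually_elim
  case (elim x)
  have "(1 + dist x x\<^sub>0) ^ m * \<bar>u x\<bar> \<le> (1 + dist x x\<^sub>0) ^ n * \<bar>u x\<bar>"
    using assms(2) by (intro mult_right_mono power_increasing) auto
  then show ?case using elim assms(3) by simp
qed

lemma wbound_cong_AE: "wbound n K u \<Longrightarrow> AE x in \<mu>. u x = v x \<Longrightarrow> wbound n K v"
  unfolding wbound_def by (elim AE_mp) (auto elim: eventually_mono)

lemma wbound_add:
  assumes "wbound n K u" "wbound n K' v"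
  shows "wbound n (K + K') (\<lambda>x. u x + v x)"
  using assms unfolding wbound_def
proof eventually_elim
  case (elim x)
  have "(1 + dist x x\<^sub>0) ^ n * \<bar>u x + v x\<bar> \<le> (1 + dist x x\<^sub>0) ^ n * (\<bar>u x\<bar> + \<bar>v x\<bar>)"
    by (intro mult_left_mono) auto
  then show ?case using elim by (simp add: distrib_left)
qed

lemma wbound_scale:
  assumes "wbound n K u"
  shows "wbound n (\<bar>c\<bar> * K) (\<lambda>x. c * u x)"
  using assms unfolding wbound_def
proof eventually_elim
  case (elim x)
  have "(1 + dist x x\<^sub>0) ^ n * \<bar>c * u x\<bar> = \<bar>c\<bar> * ((1 + dist x x\<^sub>0) ^ n * \<bar>u x\<bar>)"
    by (simp only: abs_mult mult_ac)
  then show ?case using mult_left_mono[OF elim, of "\<bar>c\<bar>"] by (simp only:)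
qed

lemma seminorm_le_iff:
  assumes "u \<in> Dinf"
  shows "schwartz_seminorm \<mu> L x\<^sub>0 n u \<le> ereal K \<longleftrightarrow> (\<forall>k\<le>n. wbound n K ((L ^^ k) u))"
proof -
  define F where "F x = ereal ((1 + dist x x\<^sub>0) ^ n * Max ((\<lambda>k. \<bar>(L ^^ k) u x\<bar>) ` {..n}))" for x
  have m[measurable]: "(L ^^ k) u \<in> borel_measurable \<mu>" for k
    using Dinf_pow_L2[OF assms] L2_measurable by blast
  have [measurable]: "(\<lambda>x. dist x x\<^sub>0) \<in> borel_measurable \<mu>"
    unfolding measurable_mu by (intro borel_measurable_continuous_onI continuous_intros)
  have "(\<lambda>x. Max ((\<lambda>k. \<bar>(L ^^ k) u x\<bar>) ` {..n})) \<in> borel_measurable \<mu>"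
    by (intro borel_measurable_Max) auto
  then have F: "F \<in> borel_measurable \<mu>" unfolding F_def by measurable
  have "F x \<le> ereal K \<longleftrightarrow> (\<forall>k\<le>n. (1 + dist x x\<^sub>0) ^ n * \<bar>(L ^^ k) u x\<bar> \<le> K)" for x
  proof -
    have w: "(1 + dist x x\<^sub>0) ^ n > 0" by (simp add: add_pos_nonneg)
    have "F x \<le> ereal K \<longleftrightarrow> Max ((\<lambda>k. \<bar>(L ^^ k) u x\<bar>) ` {..n}) \<le> K / (1 + dist x x\<^sub>0) ^ n"
      using w by (simp add: F_def le_divide_eq mult.commute)
    also have "\<dots> \<longleftrightarrow> (\<forall>k\<le>n. \<bar>(L ^^ k) u x\<bar> \<le> K / (1 + dist x x\<^sub>0) ^ n)"
      by (subst Max_le_iff) auto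
    also have "\<dots> \<longleftrightarrow> (\<forall>k\<le>n. (1 + dist x x\<^sub>0) ^ n * \<bar>(L ^^ k) u x\<bar> \<le> K)"
      using w by (simp add: le_divide_eq mult.commute)
    finally show ?thesis .
  qed
  then have "(AE x in \<mu>. F x \<le> ereal K) \<longleftrightarrow>
      (AE x in \<mu>. \<forall>k\<in>{..n}. (1 + dist x x\<^sub>0) ^ n * \<bar>(L ^^ k) u x\<bar> \<le> K)"
    by (simp add: atMost_iff Ball_def)
  also have "\<dots> \<longleftrightarrow> (\<forall>k\<in>{..n}. wbound n K ((L ^^ k) u))"
    unfolding wbound_def by (rule AE_finite_all) simp
  finally have AE: "(AE x in \<mu>. F x \<le> ereal K) \<longleftrightarrow> (\<forall>k\<le>n. wbound n K ((L ^^ k) u))"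
    by (simp add: Ball_def)
  have "esssup \<mu> F \<le> ereal K \<longleftrightarrow> (AE x in \<mu>. F x \<le> ereal K)"
  proof
    assume "esssup \<mu> F \<le> ereal K"
    then show "AE x in \<mu>. F x \<le> ereal K"
      using esssup_AE[of F \<mu>] by (auto elim: eventually_mono)
  qed (rule esssup_I[OF F])
  then show ?thesis using AE by (simp add: schwartz_seminorm_def F_def[abs_def])
qed

lemma seminorm_less_iff:
  assumes "u \<in> Dinf"
  shows "schwartz_seminorm \<mu> L x\<^sub>0 n u < ereal e \<longleftrightarrow> (\<exists>r<e. \<forall>k\<le>n. wbound n r ((L ^^ k) u))"
proof
  assume "schwartz_seminorm \<mu> L x\<^sub>0 n u < ereal e"
  then obtain r where "schwartz_seminorm \<mu> L x\<^sub>0 n u < ereal r" "ereal r < ereal e"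
    using ereal_dense2 by blast
  then show "\<exists>r<e. \<forall>k\<le>n. wbound n r ((L ^^ k) u)"
    using seminorm_le_iff[OF assms, of n r] by auto
next
  assume "\<exists>r<e. \<forall>k\<le>n. wbound n r ((L ^^ k) u)"
  then obtain r where "r < e" "schwartz_seminorm \<mu> L x\<^sub>0 n u \<le> ereal r"
    using seminorm_le_iff[OF assms] by blast
  moreover from this have "ereal r < ereal e" by simp
  ultimately show "schwartz_seminorm \<mu> L x\<^sub>0 n u < ereal e" by (metis le_less_trans)
qed

lemma schwartz_Dinf: "u \<in> S \<Longrightarrow> u \<in> Dinf"
  by (simp add: schwartz_def Dinf_def)

lemma schwartz_L2: "u \<in> S \<Longrightarrow> u \<in> L2 \<mu>"
  by (simp add: schwartz_def)

lemma schwartz_seminorm_bound: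
  assumes "u \<in> S"
  shows "\<exists>K>0. \<forall>k\<le>n. wbound n K ((L ^^ k) u)"
proof -
  have "schwartz_seminorm \<mu> L x\<^sub>0 n u < \<infinity>" using assms by (simp add: schwartz_def)
  then obtain r where "schwartz_seminorm \<mu> L x\<^sub>0 n u < ereal r" by (meson ereal_dense2)
  then have "\<forall>k\<le>n. wbound n r ((L ^^ k) u)"
    using seminorm_le_iff[OF schwartz_Dinf[OF assms]] by (meson less_imp_le)
  then have "\<forall>k\<le>n. wbound n (max r 1) ((L ^^ k) u)" by (meson wbound_mono max.cobounded1 order_refl)
  then show ?thesis by (intro exI[of _ "max r 1"]) auto
qed

lemma schwartz_wbound:
  assumes "u \<in> S"
  shows "\<exists>K>0. wbound n K ((L ^^ k) u)"
proof -
  obtain K where "K > 0" "wbound (n + k) K ((L ^^ k) u)"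
    using schwartz_seminorm_bound[OF assms, of "n + k"] by auto
  then show ?thesis using wbound_mono[of "n + k" K _ n K] by auto
qed

lemma schwartz_I:
  assumes "u \<in> Dinf" "\<And>n k. \<exists>K. wbound n K ((L ^^ k) u)"
  shows "u \<in> S"
proof -
  have "schwartz_seminorm \<mu> L x\<^sub>0 n u < \<infinity>" for n
  proof -
    obtain K where K: "\<And>k. wbound n (K k) ((L ^^ k) u)" using assms(2)[of n] by metis
    have "wbound n (\<Sum>i\<le>n. \<bar>K i\<bar>) ((L ^^ k) u)" if "k \<le> n" for k
    proof (rule wbound_mono[OF K[of k] order_refl])
      have "\<bar>K k\<bar> \<le> (\<Sum>i\<le>n. \<bar>K i\<bar>)" using that by (intro member_le_sum) auto
      then show "K k \<le> (\<Sum>i\<le>n. \<bar>K i\<bar>)" by linarith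
    qed
    then have "schwartz_seminorm \<mu> L x\<^sub>0 n u \<le> ereal (\<Sum>i\<le>n. \<bar>K i\<bar>)"
      using seminorm_le_iff[OF assms(1)] by blast
    then show ?thesis by (rule le_less_trans) simp
  qed
  then show ?thesis using assms(1) Dinf_L2 by (simp add: schwartz_def Dinf_def)
qed

lemma schwartz_cong_AE:
  assumes "u \<in> S" "v \<in> borel_measurable \<mu>" "AE x in \<mu>. u x = v x"
  shows "v \<in> S"
proof (rule schwartz_I)
  note u = schwartz_Dinf[OF assms(1)]
  have v: "v \<in> L2 \<mu>" using L2_cong_AE[OF Dinf_L2[OF u] assms(2,3)] .
  show "v \<in> Dinf" using Dinf_cong_AE(1)[OF u v assms(3)] .
  fix n k
  have "AE x in \<mu>. (L ^^ k) u x = (L ^^ k) v x"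
    by (rule AE_eq_sym[OF Dinf_cong_AE(2)[OF u v assms(3)]])
  then show "\<exists>K. wbound n K ((L ^^ k) v)"
    using schwartz_wbound[OF assms(1)] wbound_cong_AE by blast
qed

lemma schwartz_add:
  assumes "u \<in> S" "v \<in> S"
  shows "(\<lambda>x. u x + v x) \<in> S"
proof (rule schwartz_I)
  note uv = schwartz_Dinf[OF assms(1)] schwartz_Dinf[OF assms(2)]
  show "(\<lambda>x. u x + v x) \<in> Dinf" using Dinf_add(1)[OF uv] .
  fix n k
  obtain K K' where "wbound n K ((L ^^ k) u)" "wbound n K' ((L ^^ k) v)"
    using schwartz_wbound assms by meson
  from wbound_cong_AE[OF wbound_add[OF this] AE_eq_sym[OF Dinf_add(2)[OF uv]]]
  show "\<exists>K. wbound n K ((L ^^ k) (\<lambda>x. u x + v x))" by blast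
qed

lemma schwartz_scale:
  assumes "u \<in> S"
  shows "(\<lambda>x. c * u x) \<in> S"
proof (rule schwartz_I)
  note u = schwartz_Dinf[OF assms(1)]
  show "(\<lambda>x. c * u x) \<in> Dinf" using Dinf_scale(1)[OF u] .
  fix n k
  obtain K where "wbound n K ((L ^^ k) u)"
    using schwartz_wbound assms by meson
  from wbound_cong_AE[OF wbound_scale[OF this, of c] AE_eq_sym[OF Dinf_scale(2)[OF u]]]
  show "\<exists>K. wbound n K ((L ^^ k) (\<lambda>x. c * u x))" by blast
qed

lemma schwartz_diff:
  assumes "u \<in> S" "v \<in> S"
  shows "(\<lambda>x. u x - v x) \<in> S"
  using schwartz_add[OF assms(1) schwartz_scale[OF assms(2), of "-1"]] by simp

lemma schwartz_L_pow:
  assumes "u \<in> S"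
  shows "(L ^^ n) u \<in> S"
proof (rule schwartz_I)
  show "(L ^^ n) u \<in> Dinf" using Dinf_pow schwartz_Dinf assms by blast
  show "\<exists>K. wbound i K ((L ^^ k) ((L ^^ n) u))" for i k
    using schwartz_wbound[OF assms, of i "k + n"] by (auto simp: funpow_add)
qed

lemma zero_Dinf: "(\<lambda>x. 0) \<in> Dinf"
  and L_pow_zero: "AE x in \<mu>. (L ^^ n) (\<lambda>x. 0) x = 0"
proof -
  obtain v where "v \<in> D"
    using L_self_adjoint L2_zero unfolding l2_self_adjoint_def by (meson zero_less_one)
  then have 0: "(\<lambda>x. 0) \<in> D" "AE x in \<mu>. L (\<lambda>x. 0) x = 0"
    using D_scale[of v 0] L_scale[of v 0] by simp_all
  from Dinf_I[of "\<lambda>n x. 0", OF 0 L2_zero]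
  show "(\<lambda>x. 0) \<in> Dinf" "AE x in \<mu>. (L ^^ n) (\<lambda>x. 0) x = 0" by simp_all
qed

lemma schwartz_zero: "(\<lambda>x. 0) \<in> S"
proof (rule schwartz_I[OF zero_Dinf])
  fix n k
  have "wbound n 0 ((L ^^ k) (\<lambda>x. 0))"
    using L_pow_zero[of k] unfolding wbound_def by eventually_elim simp
  then show "\<exists>K. wbound n K ((L ^^ k) (\<lambda>x. 0))" by blast
qed

definition sball :: "nat \<Rightarrow> real \<Rightarrow> ('a \<Rightarrow> real) \<Rightarrow> ('a \<Rightarrow> real) set" where
  "sball n e \<phi> = {\<psi> \<in> S. schwartz_seminorm \<mu> L x\<^sub>0 n (\<lambda>x. \<psi> x - \<phi> x) < ereal e}"

lemma schwartz_topology_sball: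
  "schwartz_top = topology_generated_by {sball n e \<phi> |\<phi> n e. \<phi> \<in> S \<and> e > 0}"
  by (simp add: schwartz_topology_def sball_def)

lemma mem_sball_iff:
  assumes "\<phi> \<in> S" "\<psi> \<in> S"
  shows "\<psi> \<in> sball n e \<phi> \<longleftrightarrow> (\<exists>r<e. \<forall>k\<le>n. wbound n r (\<lambda>x. (L ^^ k) \<psi> x - (L ^^ k) \<phi> x))"
proof -
  note d = Dinf_diff[OF schwartz_Dinf[OF assms(2)] schwartz_Dinf[OF assms(1)]]
  have "wbound n r ((L ^^ k) (\<lambda>x. \<psi> x - \<phi> x)) \<longleftrightarrow>
      wbound n r (\<lambda>x. (L ^^ k) \<psi> x - (L ^^ k) \<phi> x)" for r k
    using wbound_cong_AE[OF _ d(2)] wbound_cong_AE[OF _ AE_eq_sym[OF d(2)]] by blast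
  then show ?thesis using seminorm_less_iff[OF d(1)] assms(2) by (simp add: sball_def)
qed

lemma center_in_sball: "\<phi> \<in> S \<Longrightarrow> e > 0 \<Longrightarrow> \<phi> \<in> sball n e \<phi>"
  by (subst mem_sball_iff) (auto simp: wbound_def intro!: exI[of _ 0])

lemma openin_sball: "\<phi> \<in> S \<Longrightarrow> e > 0 \<Longrightarrow> openin schwartz_top (sball n e \<phi>)"
  unfolding schwartz_topology_sball by (intro topology_generated_by_Basis) blast

lemma topspace_schwartz: "topspace schwartz_top = S"
proof
  show "topspace schwartz_top \<subseteq> S"
    unfolding schwartz_topology_sball topology_generated_by_topspace by (auto simp: sball_def)
  show "S \<subseteq> topspace schwartz_top"
  proof
    fix \<phi> assume \<phi>: "\<phi> \<in> S"
    show "\<phi> \<in> topspace schwartz_top"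
      using openin_subset[OF openin_sball[OF \<phi> zero_less_one, of 0]]
        center_in_sball[OF \<phi> zero_less_one, of 0] by blast
  qed
qed

text \<open>
  The topology is generated by balls with arbitrary centres. A ball that contains zero contains a
  ball around zero by the triangle inequality, and the seminorms increase with \<open>n\<close>, so finite
  intersections are covered as well.
\<close>
lemma open_contains_neighbourhood_of_zero:
  assumes "openin schwartz_top U" "(\<lambda>x. 0) \<in> U"
  shows "\<exists>N. \<exists>e>0. \<forall>\<phi>\<in>S. (\<forall>k\<le>N. wbound N e ((L ^^ k) \<phi>)) \<longrightarrow> \<phi> \<in> U"
proof -
  have "generate_topology_on {sball n e \<phi> |\<phi> n e. \<phi> \<in> S \<and> e > 0} U"
    using assms(1) unfolding schwartz_topology_sball by (simp add: openin_topology_generated_by_iff)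
  then show ?thesis using assms(2)
  proof induction
    case (Int U V)
    then have UV: "(\<lambda>x. 0) \<in> U" "(\<lambda>x. 0) \<in> V" by auto
    obtain N e where 1: "e > 0" "\<And>\<phi>. \<phi> \<in> S \<Longrightarrow> \<forall>k\<le>N. wbound N e ((L ^^ k) \<phi>) \<Longrightarrow> \<phi> \<in> U"
      using Int.IH(1)[OF UV(1)] by metis
    obtain N' e' where 2: "e' > 0"
      "\<And>\<phi>. \<phi> \<in> S \<Longrightarrow> \<forall>k\<le>N'. wbound N' e' ((L ^^ k) \<phi>) \<Longrightarrow> \<phi> \<in> V"
      using Int.IH(2)[OF UV(2)] by metis
    have "\<phi> \<in> U \<inter> V" if "\<phi> \<in> S" and w: "\<forall>k\<le>max N N'. wbound (max N N') (min e e') ((L ^^ k) \<phi>)" for \<phi>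
    proof -
      have "wbound N e ((L ^^ k) \<phi>)" if "k \<le> N" for k
        by (rule wbound_mono[of "max N N'" "min e e'"]) (use w that in auto)
      moreover have "wbound N' e' ((L ^^ k) \<phi>)" if "k \<le> N'" for k
        by (rule wbound_mono[of "max N N'" "min e e'"]) (use w that in auto)
      ultimately show ?thesis using 1(2) 2(2) that(1) by blast
    qed
    moreover have "min e e' > 0" using 1(1) 2(1) by simp
    ultimately show ?case by blast
  next
    case (UN \<U>)
    then obtain V where V: "V \<in> \<U>" "(\<lambda>x. 0) \<in> V" by blast
    from UN.IH[OF this] show ?case using V(1) by (meson UnionI)
  next
    case (Basis s)
    then obtain \<phi> n e where s: "s = sball n e \<phi>" "\<phi> \<in> S" "e > 0" by blast
    with Basis obtain r where r: "r < e" "\<And>k. k \<le> n \<Longrightarrow> wbound n r (\<lambda>x. (L ^^ k) (\<lambda>x. 0) x - (L ^^ k) \<phi> x)"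
      using mem_sball_iff[OF s(2) schwartz_zero] by blast
    have "\<psi> \<in> s" if "\<psi> \<in> S" and w: "\<forall>k\<le>n. wbound n ((e - r) / 2) ((L ^^ k) \<psi>)" for \<psi>
    proof -
      have "wbound n (r + (e - r) / 2) (\<lambda>x. (L ^^ k) \<psi> x - (L ^^ k) \<phi> x)" if "k \<le> n" for k
      proof (rule wbound_cong_AE)
        show "wbound n (r + (e - r) / 2)
            (\<lambda>x. ((L ^^ k) (\<lambda>x. 0) x - (L ^^ k) \<phi> x) + (L ^^ k) \<psi> x)"
          using wbound_add[OF r(2)[OF that]] w that by blast
        show "AE x in \<mu>. (L ^^ k) (\<lambda>x. 0) x - (L ^^ k) \<phi> x + (L ^^ k) \<psi> x =
            (L ^^ k) \<psi> x - (L ^^ k) \<phi> x"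
          using L_pow_zero[of k] by eventually_elim simp
      qed
      moreover have "r + (e - r) / 2 < e" using r(1) by (simp add: field_simps)
      ultimately show ?thesis unfolding s(1) mem_sball_iff[OF s(2) that(1)] by blast
    qed
    then show ?case using r(1) by (intro exI[of _ n] exI[of _ "(e - r) / 2"]) auto
  qed simp
qed

lemma distribution_add: "f \<in> distr \<Longrightarrow> \<phi> \<in> S \<Longrightarrow> \<psi> \<in> S \<Longrightarrow> f (\<lambda>x. \<phi> x + \<psi> x) = f \<phi> + f \<psi>"
  and distribution_scale: "f \<in> distr \<Longrightarrow> \<phi> \<in> S \<Longrightarrow> f (\<lambda>x. c * \<phi> x) = c * f \<phi>"
  and distribution_continuous:
    "f \<in> distr \<Longrightarrow> continuous_map schwartz_top euclideanreal f"
  by (auto simp: distributions_def)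

lemma distribution_diff:
  "f \<in> distr \<Longrightarrow> \<phi> \<in> S \<Longrightarrow> \<psi> \<in> S \<Longrightarrow> f (\<lambda>x. \<phi> x - \<psi> x) = f \<phi> - f \<psi>"
  using distribution_add[of f \<phi> "\<lambda>x. (-1) * \<psi> x"] distribution_scale[of f \<psi> "-1"]
    schwartz_scale[of \<psi> "-1"] by simp

definition of_order :: "(('a \<Rightarrow> real) \<Rightarrow> real) \<Rightarrow> nat \<Rightarrow> real \<Rightarrow> bool" where
  "of_order f N C \<longleftrightarrow> C > 0 \<and>
    (\<forall>\<phi>\<in>S. \<forall>K>0. (\<forall>k\<le>N. wbound N K ((L ^^ k) \<phi>)) \<longrightarrow> \<bar>f \<phi>\<bar> \<le> C * K)"

lemma of_order_pos: "of_order f N C \<Longrightarrow> C > 0"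
  and of_orderD: "of_order f N C \<Longrightarrow> \<phi> \<in> S \<Longrightarrow> K > 0 \<Longrightarrow>
    (\<And>k. k \<le> N \<Longrightarrow> wbound N K ((L ^^ k) \<phi>)) \<Longrightarrow> \<bar>f \<phi>\<bar> \<le> C * K"
  by (auto simp: of_order_def)

text \<open>
  A distribution has finite order: it is bounded by one on a neighbourhood of zero, and the general
  bound follows by scaling. Only positive \<open>K\<close> are considered because of the scaling factor
  \<open>e / K\<close>.
\<close>
lemma distribution_bound:
  assumes "f \<in> distr"
  shows "\<exists>N C. of_order f N C"
proof -
  define U where "U = {\<phi> \<in> S. f \<phi> \<in> {-1<..<1}}"
  have "openin schwartz_top U"
    using openin_continuous_map_preimage[OF distribution_continuous[OF assms], of "{-1<..<1}"]
    unfolding U_def topspace_schwartz by simp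
  moreover have "f (\<lambda>x. 0) = 0" using distribution_scale[OF assms schwartz_zero, of 0] by simp
  then have "(\<lambda>x. 0) \<in> U" using schwartz_zero by (simp add: U_def)
  ultimately obtain N e where e: "e > 0"
    and U: "\<And>\<phi>. \<phi> \<in> S \<Longrightarrow> \<forall>k\<le>N. wbound N e ((L ^^ k) \<phi>) \<Longrightarrow> \<phi> \<in> U"
    using open_contains_neighbourhood_of_zero by meson
  have "\<bar>f \<phi>\<bar> \<le> 1 / e * K" if \<phi>: "\<phi> \<in> S" and K: "K > 0" and w: "\<forall>k\<le>N. wbound N K ((L ^^ k) \<phi>)" for \<phi> K
  proof -
    have "wbound N e ((L ^^ k) (\<lambda>x. e / K * \<phi> x))" if "k \<le> N" for k
    proof (rule wbound_cong_AE)
      have "wbound N (\<bar>e / K\<bar> * K) (\<lambda>x. e / K * (L ^^ k) \<phi> x)"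
        using w that by (intro wbound_scale) auto
      then show "wbound N e (\<lambda>x. e / K * (L ^^ k) \<phi> x)" using e K by simp
      show "AE x in \<mu>. e / K * (L ^^ k) \<phi> x = (L ^^ k) (\<lambda>x. e / K * \<phi> x) x"
        by (rule AE_eq_sym[OF Dinf_scale(2)[OF schwartz_Dinf[OF \<phi>]]])
    qed
    then have "(\<lambda>x. e / K * \<phi> x) \<in> U" using U[OF schwartz_scale[OF \<phi>]] by blast
    then have "\<bar>e / K * f \<phi>\<bar> < 1"
      using distribution_scale[OF assms \<phi>, of "e / K"] by (auto simp: U_def)
    then show ?thesis using e K by (simp add: abs_mult field_simps)
  qed
  moreover have "1 / e > 0" using e by simp
  ultimately show ?thesis unfolding of_order_def by blast
qed

lemma distribution_I:
  assumes add: "\<And>\<phi> \<psi>. \<phi> \<in> S \<Longrightarrow> \<psi> \<in> S \<Longrightarrow> f (\<lambda>x. \<phi> x + \<psi> x) = f \<phi> + f \<psi>"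
    and scale: "\<And>\<phi> c. \<phi> \<in> S \<Longrightarrow> f (\<lambda>x. c * \<phi> x) = c * f \<phi>"
    and bound: "\<And>\<phi> K. \<phi> \<in> S \<Longrightarrow> K > 0 \<Longrightarrow> \<forall>k\<le>N. wbound N K ((L ^^ k) \<phi>) \<Longrightarrow> \<bar>f \<phi>\<bar> \<le> C * K"
  shows "f \<in> distr"
proof -
  have diff: "f (\<lambda>x. \<psi> x - \<phi> x) = f \<psi> - f \<phi>" if "\<psi> \<in> S" "\<phi> \<in> S" for \<phi> \<psi>
    using add[OF that(1) schwartz_scale[OF that(2), of "-1"]] scale[OF that(2), of "-1"] by simp
  have "openin schwartz_top {\<phi> \<in> S. f \<phi> \<in> U}" if "open U" for U
  proof (subst openin_subopen, safe)
    fix \<phi> assume \<phi>: "\<phi> \<in> S" "f \<phi> \<in> U"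
    then obtain d where d: "d > 0" "\<And>y. dist y (f \<phi>) < d \<Longrightarrow> y \<in> U"
      using \<open>open U\<close> by (meson open_dist)
    define e where "e = d / (\<bar>C\<bar> + 1)"
    have e: "e > 0" "\<bar>C\<bar> * e < d" using d(1) by (auto simp: e_def field_simps)
    have "f \<psi> \<in> U" if "\<psi> \<in> sball N e \<phi>" for \<psi>
    proof -
      have \<psi>: "\<psi> \<in> S" using that by (simp add: sball_def)
      note D = Dinf_diff[OF schwartz_Dinf[OF \<psi>] schwartz_Dinf[OF \<phi>(1)]]
      have "schwartz_seminorm \<mu> L x\<^sub>0 N (\<lambda>x. \<psi> x - \<phi> x) < ereal e" using that by (simp add: sball_def)
      then have "\<forall>k\<le>N. wbound N e ((L ^^ k) (\<lambda>x. \<psi> x - \<phi> x))"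
        using seminorm_le_iff[OF D(1)] by (meson less_imp_le)
      then have "\<bar>f (\<lambda>x. \<psi> x - \<phi> x)\<bar> \<le> C * e" using schwartz_diff \<psi> \<phi>(1) e(1) by (intro bound) auto
      also have "\<dots> \<le> \<bar>C\<bar> * e" using e(1) by (intro mult_right_mono) auto
      finally show ?thesis using diff[OF \<psi> \<phi>(1)] e(2) by (intro d(2)) (simp add: dist_real_def)
    qed
    then show "\<exists>T. openin schwartz_top T \<and> \<phi> \<in> T \<and> T \<subseteq> {\<phi> \<in> S. f \<phi> \<in> U}"
      using openin_sball[OF \<phi>(1) e(1), of N] center_in_sball[OF \<phi>(1) e(1), of N]
      by (intro exI[of _ "sball N e \<phi>"]) (auto simp: sball_def)
  qed
  then have "continuous_map schwartz_top euclideanreal f"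
    unfolding continuous_map_def topspace_schwartz open_openin[symmetric] by simp
  then show ?thesis using add scale by (simp add: distributions_def)
qed

text \<open>All seminorms of the difference vanish.\<close>
lemma distribution_cong_AE:
  assumes "f \<in> distr" "\<phi> \<in> S" "\<psi> \<in> S" "AE x in \<mu>. \<phi> x = \<psi> x"
  shows "f \<phi> = f \<psi>"
proof -
  obtain N C where C: "of_order f N C" using distribution_bound[OF assms(1)] by blast
  note D = schwartz_Dinf[OF assms(2)] schwartz_Dinf[OF assms(3)]
  have "wbound N K ((L ^^ k) (\<lambda>x. \<phi> x - \<psi> x))" if "K > 0" for K k
    unfolding wbound_def
    using Dinf_diff(2)[OF D, of k] Dinf_cong_AE(2)[OF D(1) Dinf_L2[OF D(2)] assms(4), of k]
    by eventually_elim (use that in simp)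
  then have le: "\<bar>f \<phi> - f \<psi>\<bar> \<le> C * K" if "K > 0" for K
    using of_orderD[OF C schwartz_diff[OF assms(2,3)] that] that distribution_diff[OF assms(1-3)] by simp
  have "\<bar>f \<phi> - f \<psi>\<bar> \<le> 0"
  proof (rule field_le_epsilon)
    fix e :: real assume "e > 0"
    then show "\<bar>f \<phi> - f \<psi>\<bar> \<le> 0 + e" using le[of "e / C"] of_order_pos[OF C] by simp
  qed
  then show ?thesis by simp
qed

text \<open>
  The topology does not separate representatives of the same function. Hence continuous operators
  respect equality almost everywhere, as \<open>continuous_operator_cong_AE\<close> shows.
\<close>
lemma open_AE_indistinguishable:
  assumes "openin schwartz_top U" "\<phi> \<in> S" "\<psi> \<in> S" "AE x in \<mu>. \<phi> x = \<psi> x" "\<phi> \<in> U"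
  shows "\<psi> \<in> U"
proof -
  have "generate_topology_on {sball n e \<phi> |\<phi> n e. \<phi> \<in> S \<and> e > 0} U"
    using assms(1) unfolding schwartz_topology_sball by (simp add: openin_topology_generated_by_iff)
  then show ?thesis using assms(5)
  proof induction
    case (Basis s)
    then obtain \<theta> n e where s: "s = sball n e \<theta>" "\<theta> \<in> S" "e > 0" by blast
    have "wbound n r (\<lambda>x. (L ^^ k) \<psi> x - (L ^^ k) \<theta> x)"
      if "wbound n r (\<lambda>x. (L ^^ k) \<phi> x - (L ^^ k) \<theta> x)" for r k
      using Dinf_cong_AE(2)[OF schwartz_Dinf[OF assms(2)] schwartz_L2[OF assms(3)] assms(4), of k]
      by (intro wbound_cong_AE[OF that]) (auto elim: eventually_mono)
    then show ?case
      using Basis(2) unfolding s(1) mem_sball_iff[OF s(2) assms(2)] mem_sball_iff[OF s(2) assms(3)]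
      by blast
  qed auto
qed

lemma continuous_operator_maps:
  "continuous_map schwartz_top schwartz_top B \<Longrightarrow> \<phi> \<in> S \<Longrightarrow> B \<phi> \<in> S"
  unfolding continuous_map_def topspace_schwartz by blast

lemma continuous_operator_cong_AE:
  assumes B: "continuous_map schwartz_top schwartz_top B"
    and "\<phi> \<in> S" "\<psi> \<in> S" "AE x in \<mu>. \<phi> x = \<psi> x"
  shows "AE x in \<mu>. B \<phi> x = B \<psi> x"
proof -
  note S = continuous_operator_maps[OF B assms(2)] continuous_operator_maps[OF B assms(3)]
  have "AE x in \<mu>. \<bar>B \<psi> x - B \<phi> x\<bar> \<le> e" if e: "e > 0" for e
  proof -
    have "openin schwartz_top {\<theta> \<in> S. B \<theta> \<in> sball 0 e (B \<phi>)}"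
      using openin_continuous_map_preimage[OF B openin_sball[OF S(1) e]] unfolding topspace_schwartz .
    moreover have "\<phi> \<in> {\<theta> \<in> S. B \<theta> \<in> sball 0 e (B \<phi>)}"
      using assms(2) center_in_sball[OF S(1) e] by simp
    ultimately have "B \<psi> \<in> sball 0 e (B \<phi>)"
      using open_AE_indistinguishable assms(2-4) by blast
    then obtain r where "r < e" "wbound 0 r (\<lambda>x. B \<psi> x - B \<phi> x)"
      using mem_sball_iff[OF S] by auto
    then show ?thesis unfolding wbound_def by (auto elim: eventually_mono)
  qed
  then have "AE x in \<mu>. \<forall>n. \<bar>B \<psi> x - B \<phi> x\<bar> \<le> inverse (real (Suc n))"
    by (subst AE_all_countable) simp
  then show ?thesis
  proof eventually_elim
    case (elim x)
    have "\<bar>B \<psi> x - B \<phi> x\<bar> \<le> 0"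
      using elim LIMSEQ_inverse_real_of_nat by (intro LIMSEQ_le_const) auto
    then show ?case by simp
  qed
qed

lemma by_duality_distribution:
  assumes B: "continuous_map schwartz_top schwartz_top B"
    and lin: "linear_ae_on \<mu> S B" and f: "f \<in> distr"
  shows "by_duality B f \<in> distr"
proof -
  note S = continuous_operator_maps[OF B]
  have "f (B (\<lambda>x. \<phi> x + \<psi> x)) = f (B \<phi>) + f (B \<psi>)" if "\<phi> \<in> S" "\<psi> \<in> S" for \<phi> \<psi>
    using distribution_cong_AE[OF f S[OF schwartz_add[OF that]] schwartz_add[OF S[OF that(1)] S[OF that(2)]]]
      lin that distribution_add[OF f S[OF that(1)] S[OF that(2)]]
    by (auto simp: linear_ae_on_def)
  moreover have "f (B (\<lambda>x. c * \<phi> x)) = c * f (B \<phi>)" if "\<phi> \<in> S" for \<phi> c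
    using distribution_cong_AE[OF f S[OF schwartz_scale[OF that]] schwartz_scale[OF S[OF that]]]
      lin that distribution_scale[OF f S[OF that]]
    by (auto simp: linear_ae_on_def)
  moreover have "continuous_map schwartz_top euclideanreal (\<lambda>\<phi>. f (B \<phi>))"
    using continuous_map_compose[OF B distribution_continuous[OF f]] by (simp add: o_def)
  ultimately show ?thesis by (simp add: distributions_def by_duality_def)
qed

definition XA_word :: "nat list \<Rightarrow> ('a \<Rightarrow> real) \<Rightarrow> 'a \<Rightarrow> real" where
  "XA_word J \<phi> = foldl (\<lambda>\<psi> j. XA j \<psi>) \<phi> J"

lemma XA_word_simps [simp]: "XA_word [] \<phi> = \<phi>" "XA_word (j # J) \<phi> = XA_word J (XA j \<phi>)"
  by (simp_all add: XA_word_def)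

text \<open>Duality reverses the order: the adjoint of the leftmost vector field acts on \<open>\<phi>\<close> first.\<close>
lemma iterated_by_duality:
  "iterated (\<lambda>j. by_duality (XA j)) J f \<phi> = f (XA_word J \<phi>)"
  unfolding iterated_def by (induction J arbitrary: \<phi>) (simp_all add: by_duality_def)

lemma iterated_by_duality_distribution:
  assumes "J \<in> multi_indices \<kappa> n" "f \<in> distr"
  shows "iterated (\<lambda>j. by_duality (XA j)) J f \<in> distr"
proof -
  have "set J \<subseteq> {1..\<kappa>} \<Longrightarrow> foldr (\<lambda>j. by_duality (XA j)) J f \<in> distr"
    using assms(2) XA_continuous XA_linear by (induction J) (auto intro!: by_duality_distribution)
  then show ?thesis using assms(1) by (simp add: multi_indices_def iterated_def)
qed

lemma XA_word_schwartz:
  assumes "set J \<subseteq> {1..\<kappa>}" "\<phi> \<in> S"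
  shows "XA_word J \<phi> \<in> S"
  using assms XA_continuous by (induction J arbitrary: \<phi>) (auto intro: continuous_operator_maps)

lemma foldr_XS_schwartz:
  assumes "set J \<subseteq> {1..\<kappa>}" "\<phi> \<in> S"
  shows "foldr XS J \<phi> \<in> S"
  using assms XS_continuous by (induction J) (auto intro: continuous_operator_maps)

lemma XA_word_adjoint:
  assumes "set J \<subseteq> {1..\<kappa>}" "h \<in> S" "\<phi> \<in> S"
  shows "l2_inner \<mu> h (XA_word J \<phi>) = l2_inner \<mu> (foldr XS J h) \<phi>"
  using assms(1,3)
proof (induction J arbitrary: \<phi>)
  case (Cons j J)
  then have j: "j \<in> {1..\<kappa>}" and J: "set J \<subseteq> {1..\<kappa>}" by auto
  have "XA j \<phi> \<in> S" using continuous_operator_maps XA_continuous j Cons.prems by blast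
  then have "l2_inner \<mu> h (XA_word J (XA j \<phi>)) = l2_inner \<mu> (foldr XS J h) (XA j \<phi>)"
    using Cons.IH J by blast
  also have "\<dots> = l2_inner \<mu> (XS j (foldr XS J h)) \<phi>"
    using XA_adjoint[OF j foldr_XS_schwartz[OF J assms(2)] Cons.prems(2)] by simp
  finally show ?case by simp
qed simp

text \<open>
  Each step applies the pointwise description to the previous iterate, which is smooth, and a
  test function because it agrees almost everywhere with the image under \<open>XS\<close>.
\<close>
lemma foldr_XS_pointwise:
  assumes "set J \<subseteq> {1..\<kappa>}" "h \<in> S" "smooth_fun \<A> h"
  shows "AE x in \<mu>. foldr XS J h x = foldr (vf_action X) J h x"
  using assms(1)
proof (induction J)
  case (Cons j J)
  then have j: "j \<in> {1..\<kappa>}" and J: "set J \<subseteq> {1..\<kappa>}" by auto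
  have sm: "smooth_fun \<A> (foldr (vf_action X) J h)"
    using iterated_smooth[of J "length J" h] J assms(3) by (simp add: multi_indices_def iterated_def)
  have IH: "AE x in \<mu>. foldr XS J h x = foldr (vf_action X) J h x" using Cons.IH J by blast
  have S: "foldr (vf_action X) J h \<in> S"
    using schwartz_cong_AE[OF foldr_XS_schwartz[OF J assms(2)] smooth_fun_measurable[OF sm] IH] .
  show ?case
    using continuous_operator_cong_AE[OF XS_continuous[OF j] foldr_XS_schwartz[OF J assms(2)] S IH]
      XS_pointwise[OF j S sm]
    by eventually_elim simp
qed simp

lemma limitin_distribution_topology:
  "limitin (distribution_topology \<mu> D L x\<^sub>0) F g sequentially \<longleftrightarrow>
    g \<in> distr \<and> (\<forall>\<^sub>F k in sequentially. F k \<in> distr) \<and> (\<forall>\<phi>\<in>S. (\<lambda>k. F k \<phi>) \<longlonglongrightarrow> g \<phi>)"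
proof -
  define r where "r f = restrict f S" for f :: "('a \<Rightarrow> real) \<Rightarrow> real"
  have T: "distribution_topology \<mu> D L x\<^sub>0 = pullback_topology distr r (powertop_real S)"
    by (simp add: distribution_topology_def r_def[abs_def])
  have pw: "limitin (powertop_real S) (\<lambda>k. r (F k)) (r g) sequentially \<longleftrightarrow>
      (\<forall>\<phi>\<in>S. (\<lambda>k. F k \<phi>) \<longlonglongrightarrow> g \<phi>)"
    by (simp add: limitin_componentwise r_def)
  show ?thesis
  proof
    assume l: "limitin (distribution_topology \<mu> D L x\<^sub>0) F g sequentially"
    have g: "g \<in> distr" using limitin_topspace[OF l] by (simp add: T topspace_pullback_topology)
    have "openin (distribution_topology \<mu> D L x\<^sub>0) (topspace (distribution_topology \<mu> D L x\<^sub>0))" by simp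
    then have "\<forall>\<^sub>F k in sequentially. F k \<in> topspace (distribution_topology \<mu> D L x\<^sub>0)"
      using l limitin_topspace[OF l] unfolding limitin_def by blast
    then have ev: "\<forall>\<^sub>F k in sequentially. F k \<in> distr"
      by eventually_elim (simp add: T topspace_pullback_topology)
    have "limitin (powertop_real S) (\<lambda>k. r (F k)) (r g) sequentially"
      unfolding limitin_def
    proof safe
      show "r g \<in> topspace (powertop_real S)" by (simp add: r_def)
      fix U assume U: "openin (powertop_real S) U" "r g \<in> U"
      then have "openin (distribution_topology \<mu> D L x\<^sub>0) (r -` U \<inter> distr)"
        unfolding T openin_pullback_topology by blast
      moreover have "g \<in> r -` U \<inter> distr" using U g by simp
      ultimately have "\<forall>\<^sub>F k in sequentially. F k \<in> r -` U \<inter> distr"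
        using l unfolding limitin_def by blast
      then show "\<forall>\<^sub>F k in sequentially. r (F k) \<in> U" by eventually_elim simp
    qed
    then show "g \<in> distr \<and> (\<forall>\<^sub>F k in sequentially. F k \<in> distr) \<and> (\<forall>\<phi>\<in>S. (\<lambda>k. F k \<phi>) \<longlonglongrightarrow> g \<phi>)"
      using g ev pw by blast
  next
    assume *: "g \<in> distr \<and> (\<forall>\<^sub>F k in sequentially. F k \<in> distr) \<and> (\<forall>\<phi>\<in>S. (\<lambda>k. F k \<phi>) \<longlonglongrightarrow> g \<phi>)"
    then have l: "limitin (powertop_real S) (\<lambda>k. r (F k)) (r g) sequentially" using pw by blast
    show "limitin (distribution_topology \<mu> D L x\<^sub>0) F g sequentially"
      unfolding limitin_def
    proof safe
      show "g \<in> topspace (distribution_topology \<mu> D L x\<^sub>0)"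
        using * by (simp add: T topspace_pullback_topology r_def)
      fix V assume V: "openin (distribution_topology \<mu> D L x\<^sub>0) V" "g \<in> V"
      then obtain U where U: "openin (powertop_real S) U" "V = r -` U \<inter> distr"
        unfolding T openin_pullback_topology by blast
      have "\<forall>\<^sub>F k in sequentially. r (F k) \<in> U" using l U V unfolding limitin_def by blast
      moreover have "\<forall>\<^sub>F k in sequentially. F k \<in> distr" using * by blast
      ultimately show "\<forall>\<^sub>F k in sequentially. F k \<in> V" by eventually_elim (simp add: U)
    qed
  qed
qed

end

section \<open>Weighted estimates for the heat flow\<close>

context heat_manifold_distributions
begin

text \<open>
  The Gaussian absorbs every polynomial weight centred at \<open>x\<close>, and moving the centre to \<open>x\<^sub>0\<close> costs
  a constant that depends on \<open>x\<close>.
\<close>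
lemma heat_schwartz:
  assumes "t > 0"
  shows "H t x \<in> S"
proof (rule schwartz_I[OF heat_Dinf(1)[OF assms]])
  fix n k
  obtain C c where C: "C > 0" "c > 0"
    "\<And>t x y. t > 0 \<Longrightarrow> \<bar>heat_dt k t x y\<bar> \<le> C * t powr (- real k) * gauss \<mu> c t x y"
    using heat_dt_bound by metis
  obtain C1 where C1: "C1 > 0" "\<And>t x y. t > 0 \<Longrightarrow>
    (1 + dist x y) ^ n * gauss \<mu> c t x y \<le> C1 * (1 + sqrt t) ^ n * gauss \<mu> (c / 2) t x y"
    using gauss_weight[OF C(2)] by metis
  have "c / 2 > 0" using C(2) by simp
  then obtain B where B: "B > 0" "\<And>x y. gauss \<mu> (c / 2) t x y \<le> B"
    using gauss_bounded[OF assms] by metis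
  define A where "A = C * t powr (- real k)"
  have A: "A \<ge> 0" using C(1) by (simp add: A_def)
  define K where "K = (1 + dist x x\<^sub>0) ^ n * (A * (C1 * (1 + sqrt t) ^ n * B))"
  have "(1 + dist y x\<^sub>0) ^ n * \<bar>heat_dt k t x y\<bar> \<le> K" for y
  proof -
    have "1 + dist y x\<^sub>0 \<le> (1 + dist x x\<^sub>0) * (1 + dist x y)"
      using dist_triangle[of y x\<^sub>0 x] mult_nonneg_nonneg[OF zero_le_dist[of x x\<^sub>0] zero_le_dist[of x y]]
      unfolding distrib_left distrib_right mult_1 mult_1_right dist_commute[of y x] by linarith
    then have "(1 + dist y x\<^sub>0) ^ n \<le> (1 + dist x x\<^sub>0) ^ n * (1 + dist x y) ^ n"
      unfolding power_mult_distrib[symmetric] by (intro power_mono) auto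
    then have "(1 + dist y x\<^sub>0) ^ n * \<bar>heat_dt k t x y\<bar>
        \<le> ((1 + dist x x\<^sub>0) ^ n * (1 + dist x y) ^ n) * (A * gauss \<mu> c t x y)"
      using C(3)[OF assms, of x y] by (intro mult_mono) (auto simp: A_def)
    also have "\<dots> = (1 + dist x x\<^sub>0) ^ n * (A * ((1 + dist x y) ^ n * gauss \<mu> c t x y))"
      by (simp add: mult_ac)
    also have "(1 + dist x y) ^ n * gauss \<mu> c t x y \<le> C1 * (1 + sqrt t) ^ n * B"
      by (rule order_trans[OF C1(2)[OF assms] mult_left_mono[OF B(2)]]) (use C1(1) assms in simp)
    finally show ?thesis unfolding K_def using A by (simp add: mult_left_mono)
  qed
  then have "wbound n K ((L ^^ k) (H t x))"
    using heat_Dinf(2)[OF assms, of k x] unfolding wbound_def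
    by (elim eventually_mono) (simp add: abs_mult power_abs)
  then show "\<exists>K. wbound n K ((L ^^ k) (H t x))" by blast
qed

text \<open>The powers of \<open>L\<close> are moved to the kernel, where they become time derivatives.\<close>
lemma T_pow_kernel:
  assumes "t > 0" "u \<in> Dinf"
  shows "AE x in \<mu>. T t ((L ^^ n) u) x = (\<integral>y. ((-1) ^ n * heat_dt n t x y) * u y \<partial>\<mu>)"
  using T_inner[OF assms(1) Dinf_pow_L2[OF assms(2), of n]]
proof eventually_elim
  case (elim x)
  have "l2_inner \<mu> (H t x) ((L ^^ n) u) = l2_inner \<mu> ((L ^^ n) (H t x)) u"
    using L_pow_symmetric[OF heat_Dinf(1)[OF assms(1)] assms(2)] by simp
  also have "\<dots> = l2_inner \<mu> (\<lambda>y. (-1) ^ n * heat_dt n t x y) u"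
    using heat_Dinf[OF assms(1)] Dinf_pow_L2 assms heat_dt_measurable Dinf_L2
    by (intro l2_inner_cong_AE) (auto intro: L2_measurable)
  finally show ?case using elim by (simp add: l2_inner_def)
qed

lemma T_pow_wbound:
  "\<exists>C>0. \<forall>t>0. \<forall>u\<in>Dinf. \<forall>K\<ge>0. wbound N K u \<longrightarrow>
    wbound N (C / t ^ n * (1 + sqrt t) ^ N * K) (T t ((L ^^ n) u))"
proof -
  obtain C c where C: "C > 0" "c > 0"
    "\<And>t x y. t > 0 \<Longrightarrow> \<bar>heat_dt n t x y\<bar> \<le> C * t powr (- real n) * gauss \<mu> c t x y"
    using heat_dt_bound by metis
  obtain C' where "weighted_constant c N C'" using weighted_kernel_bound[OF C(2)] by blast
  note C' = this[unfolded weighted_constant_def, THEN conjunct1]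
    this[unfolded weighted_constant_def, THEN conjunct2]
  have main: "wbound N (C' * C / t ^ n * (1 + sqrt t) ^ N * K) (T t ((L ^^ n) u))"
    if t: "t > 0" and u: "u \<in> Dinf" and K: "K \<ge> 0" and w: "wbound N K u" for t u K
    unfolding wbound_def using T_pow_kernel[OF t u, of n]
  proof eventually_elim
    case (elim x)
    have tn: "t powr (- real n) = 1 / t ^ n" using t by (simp add: powr_minus powr_realpow divide_inverse)
    have "(1 + dist x x\<^sub>0) ^ N * \<bar>\<integral>y. ((-1) ^ n * heat_dt n t x y) * u y \<partial>\<mu>\<bar>
        \<le> C' * (C / t ^ n) * (1 + sqrt t) ^ N * K"
    proof (intro C'(2)[rule_format])
      show "\<bar>(-1) ^ n * heat_dt n t x y\<bar> \<le> C / t ^ n * gauss \<mu> c t x y" for y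
        using C(3)[OF t, of x y] tn by (simp add: abs_mult power_abs)
    qed (use t K w C(1) heat_dt_measurable[OF t] L2_measurable[OF Dinf_L2[OF u]] in
        \<open>auto simp: wbound_def\<close>)
    then show ?case using elim by simp
  qed
  show ?thesis
    by (intro exI[of _ "C' * C"] conjI allI ballI impI mult_pos_pos C(1) C'(1)) (rule main; assumption)
qed

lemma T_wbound:
  "\<exists>C>0. \<forall>t\<ge>0. \<forall>u\<in>Dinf. \<forall>K\<ge>0. wbound N K u \<longrightarrow> wbound N (C * (1 + sqrt t) ^ N * K) (T t u)"
proof -
  obtain C where C: "C > 0" "\<And>t u K. t > 0 \<Longrightarrow> u \<in> Dinf \<Longrightarrow> K \<ge> 0 \<Longrightarrow> wbound N K u \<Longrightarrow>
    wbound N (C * (1 + sqrt t) ^ N * K) (T t u)"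
    using T_pow_wbound[of N 0] by auto
  have main: "wbound N (max C 1 * (1 + sqrt t) ^ N * K) (T t u)"
    if "t \<ge> 0" and u: "u \<in> Dinf" and K: "K \<ge> 0" and w: "wbound N K u" for t u K
  proof (cases "t = 0")
    case True
    have "wbound N K (T t u)"
      using wbound_cong_AE[OF w AE_eq_sym[OF T_0[OF Dinf_L2[OF u]]]] True by simp
    moreover have "K \<le> max C 1 * (1 + sqrt t) ^ N * K"
      using True K mult_right_mono[of 1 "max C 1" K] by simp
    ultimately show ?thesis using wbound_mono by blast
  next
    case False
    then have t: "t > 0" using that by simp
    have "C * (1 + sqrt t) ^ N * K \<le> max C 1 * (1 + sqrt t) ^ N * K"
      using K t by (intro mult_right_mono) auto
    then show ?thesis using C(2)[OF t u K w] wbound_mono by blast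
  qed
  show ?thesis
    by (intro exI[of _ "max C 1"] conjI allI ballI impI max.strict_coboundedI2 zero_less_one)
      (rule main; assumption)
qed

lemma T_schwartz:
  assumes "t \<ge> 0" "\<phi> \<in> S"
  shows "T t \<phi> \<in> S"
proof (rule schwartz_I)
  note \<phi> = schwartz_Dinf[OF assms(2)]
  show "T t \<phi> \<in> Dinf" using Dinf_T(1)[OF assms(1) \<phi>] .
  fix n k
  obtain C where "\<And>u K. u \<in> Dinf \<Longrightarrow> K \<ge> 0 \<Longrightarrow> wbound n K u \<Longrightarrow> wbound n (C * (1 + sqrt t) ^ n * K) (T t u)"
    using T_wbound[of n] assms(1) by blast
  moreover obtain K where "K > 0" "wbound n K ((L ^^ k) \<phi>)"
    using schwartz_wbound[OF assms(2)] by blast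
  ultimately have "wbound n (C * (1 + sqrt t) ^ n * K) (T t ((L ^^ k) \<phi>))"
    using Dinf_pow[OF \<phi>] by simp
  from wbound_cong_AE[OF this AE_eq_sym[OF Dinf_T(2)[OF assms(1) \<phi>]]]
  show "\<exists>K. wbound n K ((L ^^ k) (T t \<phi>))" by blast
qed

text \<open>
  The adjoint vector fields are moved to the kernel, where they become the fields themselves acting
  pointwise on the smooth function \<open>H t x\<close>. For \<open>2 * q\<close> fields the gain is the integral power
  \<open>1 / t ^ q\<close>.
\<close>
lemma T_XA_wbound:
  "\<exists>C>0. \<forall>t>0. \<forall>\<phi>\<in>S. \<forall>K\<ge>0. \<forall>J\<in>multi_indices \<kappa> (2 * q). wbound N K \<phi> \<longrightarrow>
    wbound N (C / t ^ q * (1 + sqrt t) ^ N * K) (T t (XA_word J \<phi>))"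
proof -
  obtain C c where C: "C > 0" "c > 0" "\<forall>x y. \<forall>t>0.
        \<forall>I \<in> multi_indices \<kappa> 0. \<forall>J \<in> multi_indices \<kappa> (2 * q).
          \<bar>iterated (vf_action X) J (\<lambda>y. iterated (vf_action X) I (\<lambda>x. H t x y) x) y\<bar> \<le>
            C * t powr (- real (0 + 2 * q) / 2) * (1 / vol \<mu> t x y) * exp (- c * (dist x y)\<^sup>2 / t)"
    using kernel_derivative_bounds[of 0 "2 * q"] by (elim exE conjE)
  have kb: "\<bar>foldr (vf_action X) J (H t x) y\<bar> \<le> C / t ^ q * gauss \<mu> c t x y"
    if t: "t > 0" and J: "J \<in> multi_indices \<kappa> (2 * q)" for t J x y
  proof -
    have "[] \<in> multi_indices \<kappa> 0" by (simp add: multi_indices_def)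
    from C(3)[rule_format, OF t this J, of x y]
    have "\<bar>foldr (vf_action X) J (H t x) y\<bar> \<le> C * t powr (- real q) * gauss \<mu> c t x y"
      by (simp add: iterated_def gauss_def mult_ac)
    also have "t powr (- real q) = 1 / t ^ q" using t by (simp add: powr_minus powr_realpow divide_inverse)
    finally show ?thesis by simp
  qed
  obtain C' where "weighted_constant c N C'" using weighted_kernel_bound[OF C(2)] by blast
  note C' = this[unfolded weighted_constant_def, THEN conjunct1]
    this[unfolded weighted_constant_def, THEN conjunct2]
  have main: "wbound N (C' * C / t ^ q * (1 + sqrt t) ^ N * K) (T t (XA_word J \<phi>))"
    if t: "t > 0" and \<phi>: "\<phi> \<in> S" and K: "K \<ge> 0" and J: "J \<in> multi_indices \<kappa> (2 * q)"
      and w: "wbound N K \<phi>" for t \<phi> K J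
  proof -
    define \<psi> where "\<psi> = XA_word J \<phi>"
    have sJ: "set J \<subseteq> {1..\<kappa>}" using J by (simp add: multi_indices_def)
    have "\<psi> \<in> S" unfolding \<psi>_def using XA_word_schwartz[OF sJ \<phi>] .
    from T_inner[OF t schwartz_L2[OF this]] show ?thesis
      unfolding wbound_def \<psi>_def[symmetric]
    proof eventually_elim
      case (elim x)
      note h = heat_schwartz[OF t, of x]
      have m: "foldr (vf_action X) J (H t x) \<in> borel_measurable \<mu>"
        using smooth_fun_measurable[OF iterated_smooth[OF J heat_smooth_right[OF t, of x]]]
        by (simp add: iterated_def)
      have "l2_inner \<mu> (H t x) \<psi> = l2_inner \<mu> (foldr XS J (H t x)) \<phi>"
        unfolding \<psi>_def by (rule XA_word_adjoint[OF sJ h \<phi>])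
      also have "\<dots> = l2_inner \<mu> (foldr (vf_action X) J (H t x)) \<phi>"
        using foldr_XS_pointwise[OF sJ h heat_smooth_right[OF t]] m
          L2_measurable[OF schwartz_L2[OF foldr_XS_schwartz[OF sJ h]]] L2_measurable[OF schwartz_L2[OF \<phi>]]
        by (intro l2_inner_cong_AE) auto
      finally have e: "T t \<psi> x = (\<integral>y. foldr (vf_action X) J (H t x) y * \<phi> y \<partial>\<mu>)"
        using elim by (simp add: l2_inner_def)
      have "(1 + dist x x\<^sub>0) ^ N * \<bar>\<integral>y. foldr (vf_action X) J (H t x) y * \<phi> y \<partial>\<mu>\<bar>
          \<le> C' * (C / t ^ q) * (1 + sqrt t) ^ N * K"
        by (intro C'(2)[rule_format])
          (use t K w C(1) m kb[OF t J] L2_measurable[OF schwartz_L2[OF \<phi>]] in \<open>auto simp: wbound_def\<close>)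
      then show ?case using e by simp
    qed
  qed
  show ?thesis
    by (intro exI[of _ "C' * C"] conjI allI ballI impI mult_pos_pos C(1) C'(1)) (rule main; assumption)
qed

text \<open>
  For positive times \<open>\<langle>H t x, u\<rangle>\<close> is a representative of \<open>T t u\<close> that is differentiable in \<open>t\<close>
  at every point \<open>x\<close>. This reduces the regularity in time of the semigroup in the weighted norms to
  one-variable calculus.
\<close>
lemma heat_inner_derivative:
  assumes "t > 0" "u \<in> Dinf"
  shows "((\<lambda>s. l2_inner \<mu> (H s x) u) has_real_derivative - l2_inner \<mu> (H t x) (L u)) (at t)"
proof -
  note u = Dinf_L2[OF assms(2)]
  have ev: "\<forall>\<^sub>F h in at (0::real). h \<noteq> 0 \<and> t + h > 0"
    using assms(1) by (auto simp: eventually_at dist_real_def intro!: exI[of _ t])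
  have "((\<lambda>h. l2_inner \<mu> (heat_quotient 0 t x h) u) \<longlongrightarrow> l2_inner \<mu> (heat_dt 1 t x) u) (at 0)"
  proof (rule l2_inner_tendsto[OF _ heat_dt_L2[OF assms(1)] u])
    show "\<forall>\<^sub>F h in at 0. heat_quotient 0 t x h \<in> L2 \<mu>"
      using ev unfolding heat_quotient_def[abs_def] by eventually_elim (intro L2_scale L2_diff heat_dt_L2 assms(1), simp)
    show "((\<lambda>h. l2_norm \<mu> (\<lambda>y. heat_quotient 0 t x h y - heat_dt 1 t x y)) \<longlongrightarrow> 0) (at 0)"
      using heat_dt_L2_derivative[OF assms(1), of 0 x] by simp
  qed
  then have "((\<lambda>h. (l2_inner \<mu> (H (t + h) x) u - l2_inner \<mu> (H t x) u) / h)
      \<longlongrightarrow> l2_inner \<mu> (heat_dt 1 t x) u) (at 0)"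
  proof (rule Lim_transform_eventually)
    show "\<forall>\<^sub>F h in at 0. l2_inner \<mu> (heat_quotient 0 t x h) u = (l2_inner \<mu> (H (t + h) x) u - l2_inner \<mu> (H t x) u) / h"
      using ev
    proof eventually_elim
      case (elim h)
      then have "t + h > 0" by simp
      then show ?case
        unfolding heat_quotient_def[abs_def] heat_dt_0 l2_inner_scale_left
        using l2_inner_diff_left[OF heat_L2 heat_L2[OF assms(1)] u] by simp
    qed
  qed
  moreover have "l2_inner \<mu> (heat_dt 1 t x) u = - l2_inner \<mu> (H t x) (L u)"
  proof -
    have "l2_inner \<mu> (H t x) (L u) = l2_inner \<mu> (L (H t x)) u"
      using L_symmetric[OF Dinf_D[OF heat_Dinf(1)[OF assms(1)], of 0] Dinf_D[OF assms(2), of 0]] by simp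
    also have "\<dots> = l2_inner \<mu> (\<lambda>y. (-1) * heat_dt 1 t x y) u"
      using heat_dt_generator[OF assms(1), of 0 x] heat_dt_L2[OF assms(1), of 1 x] u
      by (intro l2_inner_cong_AE) (auto simp: heat_dt_0 dest: L2_measurable L_L2)
    also have "\<dots> = - l2_inner \<mu> (heat_dt 1 t x) u" unfolding l2_inner_scale_left by simp
    finally show ?thesis by simp
  qed
  ultimately show ?thesis by (simp add: DERIV_def)
qed

lemma heat_inner_wbound:
  assumes "u \<in> S" "b > 0"
  shows "\<exists>K>0. \<forall>r. 0 < r \<longrightarrow> r \<le> b \<longrightarrow> (\<forall>x. (1 + dist x x\<^sub>0) ^ N * \<bar>l2_inner \<mu> (H r x) u\<bar> \<le> K)"
proof -
  obtain C c where C: "C > 0" "c > 0" "\<And>t x y. t > 0 \<Longrightarrow> H t x y \<le> C * gauss \<mu> c t x y"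
    using heat_gauss_bounds by metis
  obtain C' where "weighted_constant c N C'" using weighted_kernel_bound[OF C(2)] by blast
  note C' = this[unfolded weighted_constant_def, THEN conjunct1]
    this[unfolded weighted_constant_def, THEN conjunct2]
  obtain K where K: "K > 0" "wbound N K u" using schwartz_wbound[OF assms(1), of N 0] by auto
  have "(1 + dist x x\<^sub>0) ^ N * \<bar>l2_inner \<mu> (H r x) u\<bar> \<le> C' * C * (1 + sqrt b) ^ N * K"
    if r: "0 < r" "r \<le> b" for r x
  proof -
    have "(1 + dist x x\<^sub>0) ^ N * \<bar>l2_inner \<mu> (H r x) u\<bar> \<le> C' * C * (1 + sqrt r) ^ N * K"
      unfolding l2_inner_def
      by (intro C'(2)[rule_format])
        (use r K C heat_measurable[OF r(1)] heat_pos[OF r(1)] L2_measurable[OF schwartz_L2[OF assms(1)]]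
          in \<open>auto simp: wbound_def abs_of_pos\<close>)
    also have "\<dots> \<le> C' * C * (1 + sqrt b) ^ N * K"
      using r C(1) C'(1) K(1) by (intro mult_right_mono mult_left_mono power_mono) auto
    finally show ?thesis .
  qed
  moreover have "C' * C * (1 + sqrt b) ^ N * K > 0"
    using C(1) C'(1) K(1) assms(2) by (intro mult_pos_pos zero_less_power) (auto intro: add_pos_pos)
  ultimately show ?thesis by blast
qed

lemma T_Taylor:
  assumes "\<phi> \<in> S" "b > 0"
  shows "\<exists>K>0. \<forall>s t. 0 < s \<longrightarrow> s \<le> b \<longrightarrow> 0 < t \<longrightarrow> t \<le> b \<longrightarrow>
    wbound N ((s - t)\<^sup>2 * K) (\<lambda>x. T s \<phi> x - T t \<phi> x + (s - t) * T t (L \<phi>) x)"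
proof -
  note \<phi> = schwartz_Dinf[OF assms(1)]
  have L: "L \<phi> \<in> Dinf" "L (L \<phi>) \<in> S"
    using Dinf_pow[OF \<phi>, of 1] schwartz_L_pow[OF assms(1), of 2] by (simp_all add: numeral_2_eq_2)
  obtain K where K: "K > 0" "\<And>r x. 0 < r \<Longrightarrow> r \<le> b \<Longrightarrow>
      (1 + dist x x\<^sub>0) ^ N * \<bar>l2_inner \<mu> (H r x) (L (L \<phi>))\<bar> \<le> K"
    using heat_inner_wbound[OF L(2) assms(2)] by metis
  have main: "wbound N ((s - t)\<^sup>2 * K) (\<lambda>x. T s \<phi> x - T t \<phi> x + (s - t) * T t (L \<phi>) x)"
    if s: "0 < s" "s \<le> b" and t: "0 < t" "t \<le> b" for s t
    using T_inner[OF s(1) Dinf_L2[OF \<phi>]] T_inner[OF t(1) Dinf_L2[OF \<phi>]] T_inner[OF t(1) Dinf_L2[OF L(1)]]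
    unfolding wbound_def
  proof eventually_elim
    case (elim x)
    define w where "w = (1 + dist x x\<^sub>0) ^ N"
    have w: "w > 0" by (simp add: w_def add_pos_nonneg)
    have "\<bar>l2_inner \<mu> (H s x) \<phi> - l2_inner \<mu> (H t x) \<phi> - (s - t) * - l2_inner \<mu> (H t x) (L \<phi>)\<bar>
        \<le> (s - t)\<^sup>2 * (K / w)"
    proof (rule Taylor_order_2_bound[where a = "min s t" and b = b
          and g' = "\<lambda>r. - l2_inner \<mu> (H r x) (L \<phi>)" and g'' = "\<lambda>r. l2_inner \<mu> (H r x) (L (L \<phi>))"])
      fix r assume r: "min s t \<le> r" "r \<le> b"
      then have r0: "r > 0" using s t by auto
      show "((\<lambda>s. l2_inner \<mu> (H s x) \<phi>) has_real_derivative - l2_inner \<mu> (H r x) (L \<phi>)) (at r)"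
        by (rule heat_inner_derivative[OF r0 \<phi>])
      show "((\<lambda>r. - l2_inner \<mu> (H r x) (L \<phi>)) has_real_derivative l2_inner \<mu> (H r x) (L (L \<phi>))) (at r)"
        using DERIV_minus[OF heat_inner_derivative[OF r0 L(1)]] by simp
      show "\<bar>l2_inner \<mu> (H r x) (L (L \<phi>))\<bar> \<le> K / w"
        using K(2)[OF r0 r(2), of x] w by (simp add: w_def le_divide_eq mult.commute)
    qed (use s t in auto)
    then have "w * \<bar>T s \<phi> x - T t \<phi> x + (s - t) * T t (L \<phi>) x\<bar> \<le> w * ((s - t)\<^sup>2 * (K / w))"
      using w elim by (intro mult_left_mono) auto
    also have "\<dots> = (s - t)\<^sup>2 * K" using w by simp
    finally show ?case by (simp only: w_def)
  qed
  show ?thesis by (intro exI[of _ K] conjI allI impI K(1) main)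
qed

text \<open>
  The kernel is not available at time zero. The bound \<open>\<bar>T\<^sub>t \<phi> - T\<^sub>s \<phi>\<bar> \<le> \<bar>t - s\<bar> sup \<bar>T\<^sub>r L \<phi>\<bar>\<close> is
  proved for positive \<open>s\<close>, and \<open>s\<close> tends to zero along a sequence on which \<open>T\<^sub>s \<phi>\<close> converges to
  \<open>\<phi>\<close> almost everywhere.
\<close>
lemma T_near_0:
  assumes "\<phi> \<in> S"
  shows "\<exists>K>0. \<forall>t. 0 < t \<longrightarrow> t \<le> 1 \<longrightarrow> wbound N (t * K) (\<lambda>x. T t \<phi> x - \<phi> x)"
proof -
  note \<phi> = schwartz_Dinf[OF assms(1)]
  note \<phi>2 = Dinf_L2[OF \<phi>]
  have L: "L \<phi> \<in> S" using schwartz_L_pow[OF assms(1), of 1] by simp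
  obtain K where K: "K > 0" "\<And>r x. 0 < r \<Longrightarrow> r \<le> 1 \<Longrightarrow>
      (1 + dist x x\<^sub>0) ^ N * \<bar>l2_inner \<mu> (H r x) (L \<phi>)\<bar> \<le> K"
    using heat_inner_wbound[OF L zero_less_one] by metis
  have main: "wbound N (t * K) (\<lambda>x. T t \<phi> x - \<phi> x)" if t: "0 < t" "t \<le> 1" for t
  proof -
    define e where "e i = t * inverse (real (Suc i))" for i
    have e: "0 < e i" "e i \<le> t" for i
      using t by (auto simp: e_def field_simps)
    have e0: "e \<longlonglongrightarrow> 0"
      using tendsto_mult_right_zero[OF LIMSEQ_inverse_real_of_nat, of t] by (simp add: e_def[abs_def])
    then have "filterlim e (at_right 0) sequentially"
      using e by (simp add: filterlim_at less_imp_neq[THEN not_sym])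
    then have "(\<lambda>i. l2_norm \<mu> (\<lambda>x. T (e i) \<phi> x - \<phi> x)) \<longlonglongrightarrow> 0"
      by (rule filterlim_compose[OF T_strongly_continuous[OF \<phi>2]])
    moreover have "T (e i) \<phi> \<in> L2 \<mu>" for i using T_L2[OF less_imp_le[OF e(1)] \<phi>2] .
    ultimately obtain \<sigma> where \<sigma>: "AE x in \<mu>. (\<lambda>i. T (e (\<sigma> i)) \<phi> x) \<longlonglongrightarrow> \<phi> x"
      using l2_limit_AE_subseq[of "\<lambda>i. T (e i) \<phi>" \<mu> \<phi>] \<phi>2 by metis
    have "AE x in \<mu>. \<forall>i. T (e i) \<phi> x = l2_inner \<mu> (H (e i) x) \<phi>"
      by (subst AE_all_countable) (use T_inner[OF e(1) \<phi>2] in blast)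
    with \<sigma> T_inner[OF t(1) \<phi>2] show ?thesis
      unfolding wbound_def
    proof eventually_elim
      case (elim x)
      define w where "w = (1 + dist x x\<^sub>0) ^ N"
      have w: "w > 0" by (simp add: w_def add_pos_nonneg)
      have "w * \<bar>T t \<phi> x - T (e i) \<phi> x\<bar> \<le> t * K" for i
      proof -
        have "norm (l2_inner \<mu> (H t x) \<phi> - l2_inner \<mu> (H (e i) x) \<phi>) \<le> K / w * norm (t - e i)"
        proof (rule field_differentiable_bound[where S = "{e i..t}" and f' = "\<lambda>r. - l2_inner \<mu> (H r x) (L \<phi>)"])
          fix r assume r: "r \<in> {e i..t}"
          then have r0: "0 < r" "r \<le> 1" using e(1)[of i] t by auto
          show "((\<lambda>s. l2_inner \<mu> (H s x) \<phi>) has_field_derivative - l2_inner \<mu> (H r x) (L \<phi>))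
              (at r within {e i..t})"
            using heat_inner_derivative[OF r0(1) \<phi>] by (rule has_field_derivative_at_within)
          show "norm (- l2_inner \<mu> (H r x) (L \<phi>)) \<le> K / w"
            using K(2)[OF r0, of x] w by (simp add: w_def le_divide_eq mult.commute)
        qed (use e in auto)
        also have "\<dots> \<le> K / w * t" using e[of i] K(1) w by (intro mult_left_mono) auto
        finally have "w * \<bar>T t \<phi> x - T (e i) \<phi> x\<bar> \<le> w * (K / w * t)"
          using elim w by (intro mult_left_mono) auto
        then show ?thesis using w by (simp add: mult.commute)
      qed
      then have "w * \<bar>T t \<phi> x - T (e (\<sigma> i)) \<phi> x\<bar> \<le> t * K" for i .
      moreover have "(\<lambda>i. w * \<bar>T t \<phi> x - T (e (\<sigma> i)) \<phi> x\<bar>) \<longlonglongrightarrow> w * \<bar>T t \<phi> x - \<phi> x\<bar>"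
        using elim(1) by (intro tendsto_intros)
      ultimately show ?case unfolding w_def[symmetric] by (intro LIMSEQ_le_const2) auto
    qed
  qed
  show ?thesis by (intro exI[of _ K] conjI allI impI K(1) main)
qed

end

section \<open>The Calderon reproducing formula\<close>

lemma uniform_constant:
  fixes P :: "nat \<Rightarrow> real \<Rightarrow> bool"
  assumes "\<And>k. \<exists>K>0. P k K" "\<And>k K K'. P k K \<Longrightarrow> K \<le> K' \<Longrightarrow> P k K'"
  shows "\<exists>K>0. \<forall>k\<le>N. P k K"
proof (induction N)
  case (Suc N)
  then obtain K K' where "K > 0" "\<forall>k\<le>N. P k K" "P (Suc N) K'" using assms(1) by meson
  then have "\<forall>k\<le>Suc N. P k (max K K')" using assms(2) by (auto simp: le_Suc_eq)
  then show ?case using \<open>K > 0\<close> by (intro exI[of _ "max K K'"]) auto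
qed (use assms(1) in auto)

lemma tendsto_0_if_le_inverse:
  fixes a :: "nat \<Rightarrow> real"
  assumes "\<And>k. k \<ge> n \<Longrightarrow> \<bar>a k\<bar> \<le> B / real k"
  shows "a \<longlonglongrightarrow> 0"
proof (rule Lim_null_comparison)
  show "\<forall>\<^sub>F k in sequentially. norm (a k) \<le> B / real k"
    using eventually_ge_at_top[of n] by eventually_elim (use assms in simp)
  show "(\<lambda>k. B / real k) \<longlonglongrightarrow> 0" by (rule lim_const_over_n)
qed

context heat_manifold_distributions
begin

lemma distr_cong:
  assumes "f \<in> distr" "\<And>\<phi>. \<phi> \<in> S \<Longrightarrow> f \<phi> = g \<phi>"
  shows "g \<in> distr"
proof -
  have "continuous_map schwartz_top euclideanreal g"
    using assms(2) by (intro continuous_map_eq[OF distribution_continuous[OF assms(1)]])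
      (simp add: topspace_schwartz)
  moreover have "g (\<lambda>x. \<phi> x + \<psi> x) = g \<phi> + g \<psi>" if "\<phi> \<in> S" "\<psi> \<in> S" for \<phi> \<psi>
    using distribution_add[OF assms(1) that] assms(2) schwartz_add[OF that] that by simp
  moreover have "g (\<lambda>x. c * \<phi> x) = c * g \<phi>" if "\<phi> \<in> S" for c \<phi>
    using distribution_scale[OF assms(1) that] assms(2) schwartz_scale[OF that] that by simp
  ultimately show ?thesis by (simp add: distributions_def)
qed

lemma distr_add: "f \<in> distr \<Longrightarrow> g \<in> distr \<Longrightarrow> (\<lambda>\<phi>. f \<phi> + g \<phi>) \<in> distr"
  by (auto simp: distributions_def algebra_simps intro: continuous_map_add)

lemma distr_scale: "f \<in> distr \<Longrightarrow> (\<lambda>\<phi>. c * f \<phi>) \<in> distr"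
  by (auto simp: distributions_def algebra_simps intro: continuous_map_real_mult_left)

lemma distr_zero: "(\<lambda>\<phi>. 0) \<in> distr"
  by (simp add: distributions_def)

lemma distr_sum: "(\<And>i. i \<in> I \<Longrightarrow> f i \<in> distr) \<Longrightarrow> (\<lambda>\<phi>. \<Sum>i\<in>I. f i \<phi>) \<in> distr"
  by (induction I rule: infinite_finite_induct) (auto intro: distr_zero distr_add)

lemma T_distribution:
  assumes f: "f \<in> distr" and t: "t \<ge> 0"
  shows "(\<lambda>\<phi>. f (T t ((L ^^ j) \<phi>))) \<in> distr"
proof -
  obtain N C where C: "of_order f N C" using distribution_bound[OF f] by blast
  obtain C' where C': "C' > 0" "\<And>u K. u \<in> Dinf \<Longrightarrow> K \<ge> 0 \<Longrightarrow> wbound N K u \<Longrightarrow>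
      wbound N (C' * (1 + sqrt t) ^ N * K) (T t u)"
    using T_wbound[of N] t by metis
  have TS: "T t ((L ^^ j) \<phi>) \<in> S" if "\<phi> \<in> S" for \<phi>
    using T_schwartz[OF t schwartz_L_pow[OF that]] .
  show ?thesis
  proof (rule distribution_I[where N = "N + j" and C = "C * (C' * (1 + sqrt t) ^ N)"])
    fix \<phi> \<psi> assume \<phi>: "\<phi> \<in> S" and \<psi>: "\<psi> \<in> S"
    note d = schwartz_Dinf[OF \<phi>] schwartz_Dinf[OF \<psi>]
    have "AE x in \<mu>. T t ((L ^^ j) (\<lambda>x. \<phi> x + \<psi> x)) x = T t ((L ^^ j) \<phi>) x + T t ((L ^^ j) \<psi>) x"
      using T_cong_AE[OF t Dinf_pow_L2[OF Dinf_add(1)[OF d]]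
          L2_add[OF Dinf_pow_L2[OF d(1)] Dinf_pow_L2[OF d(2)]] Dinf_add(2)[OF d, of j]]
        T_add[OF t Dinf_pow_L2[OF d(1)] Dinf_pow_L2[OF d(2)], of j j]
      by eventually_elim simp
    from distribution_cong_AE[OF f TS[OF schwartz_add[OF \<phi> \<psi>]] schwartz_add[OF TS[OF \<phi>] TS[OF \<psi>]] this]
    show "f (T t ((L ^^ j) (\<lambda>x. \<phi> x + \<psi> x))) = f (T t ((L ^^ j) \<phi>)) + f (T t ((L ^^ j) \<psi>))"
      using distribution_add[OF f TS[OF \<phi>] TS[OF \<psi>]] by simp
  next
    fix \<phi> c assume \<phi>: "\<phi> \<in> S"
    note d = schwartz_Dinf[OF \<phi>]
    have "AE x in \<mu>. T t ((L ^^ j) (\<lambda>x. c * \<phi> x)) x = c * T t ((L ^^ j) \<phi>) x"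
      using T_cong_AE[OF t Dinf_pow_L2[OF Dinf_scale(1)[OF d]]
          L2_scale[OF Dinf_pow_L2[OF d]] Dinf_scale(2)[OF d, where c = c and n = j]]
        T_scale[OF t Dinf_pow_L2[OF d], of c j]
      by eventually_elim simp
    from distribution_cong_AE[OF f TS[OF schwartz_scale[OF \<phi>]] schwartz_scale[OF TS[OF \<phi>]] this]
    show "f (T t ((L ^^ j) (\<lambda>x. c * \<phi> x))) = c * f (T t ((L ^^ j) \<phi>))"
      using distribution_scale[OF f TS[OF \<phi>]] by simp
  next
    fix \<phi> K assume \<phi>: "\<phi> \<in> S" and K: "(K::real) > 0"
      and w: "\<forall>k\<le>N + j. wbound (N + j) K ((L ^^ k) \<phi>)"
    have "wbound N (C' * (1 + sqrt t) ^ N * K) ((L ^^ k) (T t ((L ^^ j) \<phi>)))" if "k \<le> N" for k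
    proof (rule wbound_cong_AE)
      have "wbound N K ((L ^^ (k + j)) \<phi>)"
        using w that wbound_mono[of "N + j" K _ N K] by auto
      then show "wbound N (C' * (1 + sqrt t) ^ N * K) (T t ((L ^^ k) ((L ^^ j) \<phi>)))"
        using K Dinf_pow[OF schwartz_Dinf[OF \<phi>], of "k + j"] by (intro C'(2)) (auto simp: funpow_add)
      show "AE x in \<mu>. T t ((L ^^ k) ((L ^^ j) \<phi>)) x = (L ^^ k) (T t ((L ^^ j) \<phi>)) x"
        by (rule AE_eq_sym[OF Dinf_T(2)[OF t Dinf_pow[OF schwartz_Dinf[OF \<phi>]]]])
    qed
    moreover have "C' * (1 + sqrt t) ^ N * K > 0"
      using C'(1) K t by (intro mult_pos_pos zero_less_power) (auto intro: add_pos_nonneg)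
    ultimately show "\<bar>f (T t ((L ^^ j) \<phi>))\<bar> \<le> C * (C' * (1 + sqrt t) ^ N) * K"
      using of_orderD[OF C TS[OF \<phi>]] by (simp add: mult.assoc)
  qed
qed

text \<open>
  By \<open>T_Taylor\<close>, applied to all \<open>(L ^^ k) \<phi>\<close> with \<open>k\<close> up to the order of \<open>f\<close>, the test function
  \<open>T\<^sub>s \<phi> - T\<^sub>t \<phi> + (s - t) T\<^sub>t L \<phi>\<close> is of size \<open>(s - t)\<^sup>2\<close> in the seminorm that controls \<open>f\<close>.
\<close>
lemma T_distribution_derivative:
  assumes f: "f \<in> distr" and \<phi>: "\<phi> \<in> S" and t: "t > 0"
  shows "((\<lambda>s. f (T s \<phi>)) has_real_derivative - f (T t (L \<phi>))) (at t)"
proof -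
  obtain N C where C: "of_order f N C" using distribution_bound[OF f] by blast
  have b: "2 * t > 0" using t by simp
  have "\<exists>K>0. \<forall>k\<le>N. \<forall>s. 0 < s \<longrightarrow> s \<le> 2 * t \<longrightarrow> wbound N ((s - t)\<^sup>2 * K)
      (\<lambda>x. T s ((L ^^ k) \<phi>) x - T t ((L ^^ k) \<phi>) x + (s - t) * T t (L ((L ^^ k) \<phi>)) x)"
  proof (rule uniform_constant, goal_cases)
    case (1 k)
    obtain K where "K > 0" "\<forall>s r. 0 < s \<longrightarrow> s \<le> 2 * t \<longrightarrow> 0 < r \<longrightarrow> r \<le> 2 * t \<longrightarrow>
        wbound N ((s - r)\<^sup>2 * K)
          (\<lambda>x. T s ((L ^^ k) \<phi>) x - T r ((L ^^ k) \<phi>) x + (s - r) * T r (L ((L ^^ k) \<phi>)) x)"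
      using T_Taylor[OF schwartz_L_pow[OF \<phi>] b, of N k] by (elim exE conjE)
    then show ?case using t by (intro exI[of _ K]) simp
  next
    case (2 k K K')
    then show ?case
      by (intro allI impI wbound_mono[OF 2(1)[rule_format] order_refl] mult_left_mono) auto
  qed
  then obtain K where K: "K > 0" "\<And>k s. k \<le> N \<Longrightarrow> 0 < s \<Longrightarrow> s \<le> 2 * t \<Longrightarrow> wbound N ((s - t)\<^sup>2 * K)
      (\<lambda>x. T s ((L ^^ k) \<phi>) x - T t ((L ^^ k) \<phi>) x + (s - t) * T t (L ((L ^^ k) \<phi>)) x)"
    by auto
  have L: "L \<phi> \<in> S" using schwartz_L_pow[OF \<phi>, of 1] by simp
  have TS: "T s \<phi> \<in> S" "T s (L \<phi>) \<in> S" if "s > 0" for s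
    using T_schwartz that \<phi> L by auto
  have est: "\<bar>(f (T (t + h) \<phi>) - f (T t \<phi>)) / h - - f (T t (L \<phi>))\<bar> \<le> \<bar>h\<bar> * (C * K)"
    if h: "h \<noteq> 0" "\<bar>h\<bar> < t" for h
  proof -
    define s where "s = t + h"
    have s: "0 < s" "s \<le> 2 * t" "s - t = h" using h by (auto simp: s_def)
    define R where "R x = T s \<phi> x - T t \<phi> x + h * T t (L \<phi>) x" for x
    note D = schwartz_Dinf[OF TS(1)[OF s(1)]] schwartz_Dinf[OF TS(1)[OF t]] schwartz_Dinf[OF TS(2)[OF t]]
    have RS: "R \<in> S" unfolding R_def by (intro schwartz_add schwartz_diff schwartz_scale TS s t)
    have "f R = f (T s \<phi>) - f (T t \<phi>) + h * f (T t (L \<phi>))"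
      unfolding R_def using TS s(1) t
      by (simp add: distribution_add[OF f] distribution_diff[OF f] distribution_scale[OF f]
          schwartz_diff schwartz_scale)
    moreover have "wbound N (h\<^sup>2 * K) ((L ^^ k) R)" if k: "k \<le> N" for k
    proof (rule wbound_cong_AE)
      show "wbound N (h\<^sup>2 * K)
          (\<lambda>x. T s ((L ^^ k) \<phi>) x - T t ((L ^^ k) \<phi>) x + h * T t (L ((L ^^ k) \<phi>)) x)"
        using K(2)[OF k s(1,2)] unfolding s(3) .
      have fp: "(L ^^ k) (L \<phi>) = L ((L ^^ k) \<phi>)" by (simp add: funpow_swap1)
      from Dinf_add(2)[OF Dinf_diff(1)[OF D(1,2)] Dinf_scale(1)[OF D(3), of h], of k]
        Dinf_diff(2)[OF D(1,2), of k] Dinf_scale(2)[OF D(3), where c = h and n = k]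
        Dinf_T(2)[OF less_imp_le[OF s(1)] schwartz_Dinf[OF \<phi>], of k]
        Dinf_T(2)[OF less_imp_le[OF t] schwartz_Dinf[OF \<phi>], of k]
        Dinf_T(2)[OF less_imp_le[OF t] schwartz_Dinf[OF L], of k]
      show "AE x in \<mu>. T s ((L ^^ k) \<phi>) x - T t ((L ^^ k) \<phi>) x + h * T t (L ((L ^^ k) \<phi>)) x =
          (L ^^ k) R x"
        unfolding R_def[abs_def] s(3) by eventually_elim (simp add: fp)
    qed
    ultimately have "\<bar>f (T s \<phi>) - f (T t \<phi>) + h * f (T t (L \<phi>))\<bar> \<le> C * (h\<^sup>2 * K)"
      using of_orderD[OF C RS, of "h\<^sup>2 * K"] K(1) h(1) by simp
    then have "\<bar>(f (T s \<phi>) - f (T t \<phi>) + h * f (T t (L \<phi>))) / h\<bar> \<le> C * (h\<^sup>2 * K) / \<bar>h\<bar>"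
      unfolding abs_divide by (rule divide_right_mono) simp
    also have "C * (h\<^sup>2 * K) / \<bar>h\<bar> = \<bar>h\<bar> * (C * K)"
      using h(1) by (simp add: power2_eq_square abs_if)
    also have "(f (T s \<phi>) - f (T t \<phi>) + h * f (T t (L \<phi>))) / h =
        (f (T (t + h) \<phi>) - f (T t \<phi>)) / h - - f (T t (L \<phi>))"
      using h(1) by (simp add: s_def add_divide_distrib)
    finally show ?thesis .
  qed
  show ?thesis
    unfolding DERIV_def
  proof (rule LIM_zero_cancel, rule tendsto_0_le[where K = "C * K"])
    show "((\<lambda>h::real. h) \<longlongrightarrow> 0) (at 0)" by (rule tendsto_ident_at)
    have "\<forall>\<^sub>F h in at (0::real). h \<noteq> 0 \<and> \<bar>h\<bar> < t"
      using t by (auto simp: eventually_at dist_real_def intro!: exI[of _ t])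
    then show "\<forall>\<^sub>F h in at 0. norm ((f (T (t + h) \<phi>) - f (T t \<phi>)) / h - - f (T t (L \<phi>))) \<le> norm h * (C * K)"
      by eventually_elim (use est in auto)
  qed
qed

lemma T_distribution_0:
  assumes "f \<in> distr" "\<phi> \<in> S"
  shows "f (T 0 \<phi>) = f \<phi>"
  using distribution_cong_AE[OF assms(1) T_schwartz[OF order_refl assms(2)] assms(2) T_0[OF schwartz_L2[OF assms(2)]]] .

text \<open>Continuity at the endpoint zero is what makes the integral start at \<open>f\<close>.\<close>
lemma T_distribution_continuous:
  assumes f: "f \<in> distr" and \<phi>: "\<phi> \<in> S"
  shows "continuous_on {0..} (\<lambda>t. f (T t \<phi>))"
  unfolding continuous_on_eq_continuous_within
proof
  fix t :: real assume "t \<in> {0..}"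
  then consider "t > 0" | "t = 0" by force
  then show "continuous (at t within {0..}) (\<lambda>t. f (T t \<phi>))"
  proof cases
    case 1
    then show ?thesis
      using DERIV_isCont[OF T_distribution_derivative[OF f \<phi> 1]] continuous_at_imp_continuous_at_within by blast
  next
    case 2
    obtain N C where C: "of_order f N C" using distribution_bound[OF f] by blast
    have "\<exists>K>0. \<forall>k\<le>N. \<forall>t. 0 < t \<longrightarrow> t \<le> 1 \<longrightarrow>
        wbound N (t * K) (\<lambda>x. T t ((L ^^ k) \<phi>) x - (L ^^ k) \<phi> x)"
    proof (rule uniform_constant[OF T_near_0[OF schwartz_L_pow[OF \<phi>]]], goal_cases)
      case (1 k K K')
      then show ?case
        by (intro allI impI wbound_mono[OF 1(1)[rule_format] order_refl] mult_left_mono) auto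
    qed
    then obtain K where K: "K > 0" "\<And>k t. k \<le> N \<Longrightarrow> 0 < t \<Longrightarrow> t \<le> 1 \<Longrightarrow>
        wbound N (t * K) (\<lambda>x. T t ((L ^^ k) \<phi>) x - (L ^^ k) \<phi> x)"
      by auto
    have est: "\<bar>f (T t \<phi>) - f \<phi>\<bar> \<le> t * (C * K)" if t: "0 < t" "t \<le> 1" for t
    proof -
      have t0: "t \<ge> 0" using t by simp
      note TS = T_schwartz[OF t0 \<phi>]
      have "wbound N (t * K) ((L ^^ k) (\<lambda>x. T t \<phi> x - \<phi> x))" if k: "k \<le> N" for k
      proof (rule wbound_cong_AE)
        show "wbound N (t * K) (\<lambda>x. T t ((L ^^ k) \<phi>) x - (L ^^ k) \<phi> x)"
          by (rule K(2)[OF k t])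
        show "AE x in \<mu>. T t ((L ^^ k) \<phi>) x - (L ^^ k) \<phi> x = (L ^^ k) (\<lambda>x. T t \<phi> x - \<phi> x) x"
          using Dinf_diff(2)[OF schwartz_Dinf[OF TS] schwartz_Dinf[OF \<phi>], of k]
            Dinf_T(2)[OF t0 schwartz_Dinf[OF \<phi>], of k]
          by eventually_elim simp
      qed
      then have "\<bar>f (\<lambda>x. T t \<phi> x - \<phi> x)\<bar> \<le> C * (t * K)"
        using t K(1) by (intro of_orderD[OF C] schwartz_diff TS \<phi>) auto
      then show ?thesis using distribution_diff[OF f TS \<phi>] by (simp add: mult_ac)
    qed
    have "((\<lambda>t. f (T t \<phi>)) \<longlongrightarrow> f (T 0 \<phi>)) (at 0 within {0..})"
    proof (rule LIM_zero_cancel, rule tendsto_0_le[where K = "C * K"])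
      show "((\<lambda>h::real. h) \<longlongrightarrow> 0) (at 0 within {0..})" by (rule tendsto_ident_at)
      have "\<forall>\<^sub>F h in at 0 within {0..}. 0 < h \<and> h < (1::real)"
        by (auto simp: eventually_at dist_real_def intro!: exI[of _ 1])
      then show "\<forall>\<^sub>F h in at 0 within {0..}. norm (f (T h \<phi>) - f (T 0 \<phi>)) \<le> norm h * (C * K)"
        unfolding T_distribution_0[OF f \<phi>] by eventually_elim (use est in auto)
    qed
    then show ?thesis using 2 by (simp add: continuous_within)
  qed
qed

text \<open>
  The distribution \<open>(\<Sum>j\<le>p. (t L)\<^sup>j / j!) T\<^sub>t f\<close>: the exponential series of \<open>t L\<close>, truncated at
  degree \<open>p\<close>, times \<open>exp (- t L)\<close>.
\<close>
definition truncated_exp :: "(('a \<Rightarrow> real) \<Rightarrow> real) \<Rightarrow> nat \<Rightarrow> real \<Rightarrow> ('a \<Rightarrow> real) \<Rightarrow> real" where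
  "truncated_exp f p t \<phi> = (\<Sum>j\<le>p. t ^ j / fact j * f (T t ((L ^^ j) \<phi>)))"

lemma truncated_exp_distribution: "f \<in> distr \<Longrightarrow> t \<ge> 0 \<Longrightarrow> truncated_exp f p t \<in> distr"
  unfolding truncated_exp_def[abs_def] by (intro distr_sum distr_scale T_distribution) auto

text \<open>
  The derivative of each factor \<open>t ^ j / fact j\<close> cancels against the derivative of the heat flow
  in the preceding summand.
\<close>
lemma truncated_exp_derivative:
  assumes f: "f \<in> distr" and \<phi>: "\<phi> \<in> S" and t: "t > 0"
  shows "((\<lambda>t. truncated_exp f p t \<phi>) has_real_derivative
    - (t ^ p / fact p * f (T t ((L ^^ Suc p) \<phi>)))) (at t)"
proof (induction p)
  case 0
  then show ?case using T_distribution_derivative[OF f \<phi> t] by (simp add: truncated_exp_def)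
next
  case (Suc p)
  define F F' where "F = (\<lambda>t. f (T t ((L ^^ Suc p) \<phi>)))" and "F' = f (T t ((L ^^ Suc (Suc p)) \<phi>))"
  have F: "(F has_real_derivative - F') (at t)"
    using T_distribution_derivative[OF f schwartz_L_pow[OF \<phi>, of "Suc p"] t]
    by (simp add: F_def F'_def)
  have P: "((\<lambda>t. t ^ Suc p / fact (Suc p)) has_real_derivative t ^ p / fact p) (at t)"
  proof -
    have "((\<lambda>t. t ^ Suc p / fact (Suc p)) has_real_derivative real (Suc p) * t ^ p / fact (Suc p)) (at t)"
      using DERIV_cdivide[OF DERIV_pow[of "Suc p" t], of "fact (Suc p)"] by simp
    moreover have "real (Suc p) * t ^ p / fact (Suc p) = t ^ p / fact p"
      unfolding fact_Suc by (rule nonzero_mult_divide_mult_cancel_left) simp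
    ultimately show ?thesis by (simp only:)
  qed
  have "((\<lambda>t. truncated_exp f p t \<phi> + t ^ Suc p / fact (Suc p) * F t) has_real_derivative
      - (t ^ p / fact p * F t) + (t ^ p / fact p * F t + - F' * (t ^ Suc p / fact (Suc p)))) (at t)"
    using Suc.IH by (intro DERIV_add DERIV_mult P F) (simp add: F_def)
  moreover have "(\<lambda>t. truncated_exp f (Suc p) t \<phi>) = (\<lambda>t. truncated_exp f p t \<phi> + t ^ Suc p / fact (Suc p) * F t)"
    by (simp add: truncated_exp_def F_def)
  ultimately show ?case by (simp add: F'_def mult.commute)
qed

lemma truncated_exp_0: "f \<in> distr \<Longrightarrow> \<phi> \<in> S \<Longrightarrow> truncated_exp f p 0 \<phi> = f \<phi>"
  by (simp add: truncated_exp_def sum.atMost_shift T_distribution_0)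

lemma truncated_exp_continuous:
  assumes "f \<in> distr" "\<phi> \<in> S"
  shows "continuous_on {0..} (\<lambda>t. truncated_exp f p t \<phi>)"
  unfolding truncated_exp_def
  by (intro continuous_intros T_distribution_continuous schwartz_L_pow assms) auto

lemma calderon_integral:
  assumes f: "f \<in> distr" and \<phi>: "\<phi> \<in> S"
  shows "set_integrable lborel {0<..<real k} (calderon_integrand L T (Suc p) f \<phi>)"
    and "(LINT t:{0<..<real k}|lborel. calderon_integrand L T (Suc p) f \<phi> t)
      = fact p * (f \<phi> - truncated_exp f p (real k) \<phi>)"
proof -
  define q where "q t = t ^ p * f (T t ((L ^^ Suc p) \<phi>))" for t
  have c: "calderon_integrand L T (Suc p) f \<phi> t = q t" if "t \<in> {0<..<real k}" for t
    using that by (simp add: calderon_integrand_def by_duality_def q_def)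
  have "continuous_on {0..real k} q"
    unfolding q_def
    by (intro continuous_intros continuous_on_subset[OF T_distribution_continuous[OF f schwartz_L_pow[OF \<phi>]]]) auto
  then have "set_integrable lborel {0..real k} q"
    unfolding set_integrable_def by (intro borel_integrable_compact) auto
  then have qi: "set_integrable lborel {0<..<real k} q"
    by (rule set_integrable_subset) auto
  moreover have "set_integrable lborel {0<..<real k} (calderon_integrand L T (Suc p) f \<phi>) =
      set_integrable lborel {0<..<real k} q"
    by (rule set_integrable_cong[OF refl refl c])
  ultimately show "set_integrable lborel {0<..<real k} (calderon_integrand L T (Suc p) f \<phi>)" by simp
  have "((\<lambda>t. - (t ^ p / fact p * f (T t ((L ^^ Suc p) \<phi>)))) has_integral
      (truncated_exp f p (real k) \<phi> - truncated_exp f p 0 \<phi>)) {0..real k}"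
    by (intro fundamental_theorem_of_calculus_interior
        continuous_on_subset[OF truncated_exp_continuous[OF f \<phi>]]
        truncated_exp_derivative[OF f \<phi>, unfolded has_real_derivative_iff_has_vector_derivative]) auto
  from has_integral_mult_right[OF this, of "- fact p"]
  have "(q has_integral fact p * (f \<phi> - truncated_exp f p (real k) \<phi>)) {0..real k}"
    using truncated_exp_0[OF f \<phi>, of p] by (simp add: q_def[abs_def] algebra_simps)
  then have "integral {0<..<real k} q = fact p * (f \<phi> - truncated_exp f p (real k) \<phi>)"
    using integral_open_interval_real[of 0 "real k" q] integral_unique by metis
  moreover have "(LINT t:{0<..<real k}|lborel. calderon_integrand L T (Suc p) f \<phi> t) =
      (LINT t:{0<..<real k}|lborel. q t)"
    using c by (intro set_lebesgue_integral_cong) auto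
  ultimately show "(LINT t:{0<..<real k}|lborel. calderon_integrand L T (Suc p) f \<phi> t)
      = fact p * (f \<phi> - truncated_exp f p (real k) \<phi>)"
    using set_borel_integral_eq_integral(2)[OF qi] by simp
qed

text \<open>
  The powers \<open>L ^^ k\<close> in the seminorm of order \<open>N\<close> commute with the flow and make it only smaller
  for \<open>t \<ge> 1\<close>. The rough bound \<open>1 + sqrt t \<le> 2 * t\<close> suffices, because arbitrarily many powers of \<open>t\<close>
  can be gained later.
\<close>
lemma heat_flow_decay:
  assumes f: "f \<in> distr" and C: "of_order f N C"
  shows "\<exists>C'>0. \<forall>t\<ge>1. \<forall>u\<in>S. \<forall>K>0. wbound N K u \<longrightarrow> t ^ j * \<bar>f (T t ((L ^^ j) u))\<bar> \<le> C' * t ^ N * K"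
proof -
  have "\<exists>c>0. \<forall>i\<le>N. \<forall>t>0. \<forall>u\<in>Dinf. \<forall>K\<ge>0. wbound N K u \<longrightarrow>
      wbound N (c / t ^ (i + j) * (1 + sqrt t) ^ N * K) (T t ((L ^^ (i + j)) u))"
  proof (rule uniform_constant[OF T_pow_wbound], goal_cases)
    case (1 i c c')
    then show ?case
      by (intro allI ballI impI wbound_mono[OF 1(1)[rule_format] order_refl])
        (auto intro!: mult_right_mono divide_right_mono)
  qed
  then obtain A where A: "A > 0" "\<And>i t u K. i \<le> N \<Longrightarrow> t > 0 \<Longrightarrow> u \<in> Dinf \<Longrightarrow> K \<ge> 0 \<Longrightarrow>
      wbound N K u \<Longrightarrow> wbound N (A / t ^ (i + j) * (1 + sqrt t) ^ N * K) (T t ((L ^^ (i + j)) u))"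
    by auto
  have main: "t ^ j * \<bar>f (T t ((L ^^ j) u))\<bar> \<le> C * A * 2 ^ N * t ^ N * K"
    if t: "t \<ge> 1" and u: "u \<in> S" and K: "K > 0" and w: "wbound N K u" for t u K
  proof -
    have t0: "t > 0" "t \<ge> 0" using t by auto
    define B where "B = A / t ^ j * (2 * t) ^ N * K"
    have B: "B > 0" using A K t0 by (simp add: B_def)
    have "wbound N B ((L ^^ i) (T t ((L ^^ j) u)))" if i: "i \<le> N" for i
    proof (rule wbound_cong_AE)
      have "sqrt t \<le> t" using t by (intro real_le_lsqrt) (auto simp: power2_eq_square)
      then have s: "1 + sqrt t \<le> 2 * t" using t by simp
      have "A / t ^ (i + j) \<le> A / t ^ j"
        using A(1) t t0 by (intro frac_le power_increasing) auto
      then have "A / t ^ (i + j) * (1 + sqrt t) ^ N * K \<le> B"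
        unfolding B_def using s K t0 A(1)
        by (intro mult_right_mono mult_mono power_mono) (auto intro: less_imp_le)
      with A(2)[OF i t0(1) schwartz_Dinf[OF u] less_imp_le[OF K] w]
      have "wbound N B (T t ((L ^^ (i + j)) u))" using wbound_mono by blast
      then show "wbound N B (T t ((L ^^ i) ((L ^^ j) u)))" by (simp add: funpow_add)
      show "AE x in \<mu>. T t ((L ^^ i) ((L ^^ j) u)) x = (L ^^ i) (T t ((L ^^ j) u)) x"
        by (rule AE_eq_sym[OF Dinf_T(2)[OF t0(2) Dinf_pow[OF schwartz_Dinf[OF u]]]])
    qed
    then have "\<bar>f (T t ((L ^^ j) u))\<bar> \<le> C * B"
      using B by (intro of_orderD[OF C] T_schwartz t0(2) schwartz_L_pow u) auto
    then have "t ^ j * \<bar>f (T t ((L ^^ j) u))\<bar> \<le> t ^ j * (C * B)"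
      using t0 by (intro mult_left_mono) auto
    also have "\<dots> = C * A * 2 ^ N * t ^ N * K"
      using t0 by (simp add: B_def power_mult_distrib)
    finally show ?thesis .
  qed
  have "C * A * 2 ^ N > 0" using of_order_pos[OF C] A(1) by simp
  then show ?thesis by (intro exI[of _ "C * A * 2 ^ N"] conjI allI ballI impI) (assumption | rule main)+
qed

lemma truncated_exp_L_pow_tendsto:
  assumes f: "f \<in> distr" and C: "of_order f N C"
    and \<phi>: "\<phi> \<in> S"
  shows "(\<lambda>k. truncated_exp f p (real k) ((L ^^ Suc N) \<phi>)) \<longlonglongrightarrow> 0"
proof -
  have "(\<lambda>k. real k ^ j / fact j * f (T (real k) ((L ^^ j) ((L ^^ Suc N) \<phi>)))) \<longlonglongrightarrow> 0" for j
  proof -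
    obtain C' where C': "C' > 0" "\<And>t u K. t \<ge> 1 \<Longrightarrow> u \<in> S \<Longrightarrow> K > 0 \<Longrightarrow> wbound N K u \<Longrightarrow>
        t ^ (j + Suc N) * \<bar>f (T t ((L ^^ (j + Suc N)) u))\<bar> \<le> C' * t ^ N * K"
      using heat_flow_decay[OF f C, of "j + Suc N"] by metis
    obtain K where K: "K > 0" "wbound N K \<phi>" using schwartz_wbound[OF \<phi>, of N 0] by auto
    show ?thesis
    proof (rule tendsto_0_if_le_inverse[where n = 1 and B = "C' * K / fact j"])
      fix k :: nat assume "k \<ge> 1"
      then have t: "real k \<ge> 1" by simp
      define a where "a = \<bar>f (T (real k) ((L ^^ (j + Suc N)) \<phi>))\<bar>"
      have "real k ^ N * (real k * (real k ^ j * a)) \<le> real k ^ N * (C' * K)"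
        using C'(2)[OF t \<phi> K] by (simp add: a_def power_add mult_ac)
      then have "real k * (real k ^ j * a) \<le> C' * K"
        by (rule mult_left_le_imp_le) (use t in simp)
      then have "real k ^ j * a \<le> C' * K / real k" using t by (simp add: le_divide_eq mult.commute)
      then have "real k ^ j * a / fact j \<le> C' * K / real k / fact j" by (rule divide_right_mono) simp
      moreover have fp: "(L ^^ j) ((L ^^ Suc N) \<phi>) = (L ^^ (j + Suc N)) \<phi>"
        by (simp only: funpow_add o_apply)
      ultimately show "\<bar>real k ^ j / fact j * f (T (real k) ((L ^^ j) ((L ^^ Suc N) \<phi>)))\<bar> \<le> C' * K / fact j / real k"
        unfolding fp by (simp add: a_def abs_mult mult_ac del: funpow.simps)
    qed
  qed
  then show ?thesis unfolding truncated_exp_def by (intro tendsto_null_sum)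
qed

text \<open>
  One half of the time is spent on \<open>(t L)\<^sup>j\<close> and the other half on the vector fields. The powers of
  \<open>L\<close> and the fields lose \<open>t ^ N\<close> each, so \<open>2 * N + 1\<close> pairs of fields leave a factor \<open>1 / t\<close>.
\<close>
lemma truncated_exp_XA_tendsto:
  assumes f: "f \<in> distr" and C: "of_order f N C"
    and \<phi>: "\<phi> \<in> S" and J: "J \<in> multi_indices \<kappa> (2 * (2 * N + 1))"
  shows "(\<lambda>k. truncated_exp f p (real k) (XA_word J \<phi>)) \<longlonglongrightarrow> 0"
proof -
  define \<psi> where "\<psi> = XA_word J \<phi>"
  have \<psi>: "\<psi> \<in> S" unfolding \<psi>_def using J \<phi> by (intro XA_word_schwartz) (simp add: multi_indices_def)
  obtain c where c: "c > 0" "\<And>t K. t > 0 \<Longrightarrow> K \<ge> 0 \<Longrightarrow> wbound N K \<phi> \<Longrightarrow>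
      wbound N (c / t ^ (2 * N + 1) * (1 + sqrt t) ^ N * K) (T t \<psi>)"
    using T_XA_wbound[of "2 * N + 1" N] \<phi> J unfolding \<psi>_def by metis
  obtain K where K: "K > 0" "wbound N K \<phi>" using schwartz_wbound[OF \<phi>, of N 0] by auto
  have "(\<lambda>k. real k ^ j / fact j * f (T (real k) ((L ^^ j) \<psi>))) \<longlonglongrightarrow> 0" for j
  proof -
    obtain C' where C': "C' > 0" "\<And>t u K. t \<ge> 1 \<Longrightarrow> u \<in> S \<Longrightarrow> K > 0 \<Longrightarrow> wbound N K u \<Longrightarrow>
        t ^ j * \<bar>f (T t ((L ^^ j) u))\<bar> \<le> C' * t ^ N * K"
      using heat_flow_decay[OF f C, of j] by metis
    define B where "B = 2 ^ j * (C' * (c * 2 ^ N * K)) / fact j * 2"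
    show ?thesis
    proof (rule tendsto_0_if_le_inverse[where n = 2 and B = B])
      fix k :: nat assume "k \<ge> 2"
      define s where "s = real k / 2"
      have s: "s \<ge> 1" "s > 0" "s \<ge> 0" "real k = s + s" using \<open>k \<ge> 2\<close> by (auto simp: s_def)
      define K1 where "K1 = c / s ^ (2 * N + 1) * (2 * s) ^ N * K"
      have K1: "K1 > 0" using c(1) s K(1) by (simp add: K1_def)
      have w: "wbound N K1 (T s \<psi>)"
      proof (rule wbound_mono[OF c(2)[OF s(2) less_imp_le[OF K(1)] K(2)] order_refl])
        have "sqrt s \<le> s" using s by (intro real_le_lsqrt) (auto simp: power2_eq_square)
        then show "c / s ^ (2 * N + 1) * (1 + sqrt s) ^ N * K \<le> K1"
          unfolding K1_def using s c(1) K(1)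
          by (intro mult_right_mono mult_left_mono power_mono) auto
      qed
      note T\<psi> = T_schwartz[OF s(3) \<psi>]
      have "AE x in \<mu>. T (real k) ((L ^^ j) \<psi>) x = T s ((L ^^ j) (T s \<psi>)) x"
      proof -
        note L\<psi> = schwartz_L2[OF schwartz_L_pow[OF \<psi>]]
        have "AE x in \<mu>. T s ((L ^^ j) (T s \<psi>)) x = T s (T s ((L ^^ j) \<psi>)) x"
          by (rule T_cong_AE[OF s(3) schwartz_L2[OF schwartz_L_pow[OF T\<psi>]] T_L2[OF s(3) L\<psi>]
                Dinf_T(2)[OF s(3) schwartz_Dinf[OF \<psi>]]])
        then show ?thesis
          using T_plus[OF s(3) s(3) L\<psi>[of j]] unfolding s(4) by eventually_elim simp
      qed
      then have e: "f (T (real k) ((L ^^ j) \<psi>)) = f (T s ((L ^^ j) (T s \<psi>)))"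
        using \<psi> T\<psi> s by (intro distribution_cong_AE[OF f] T_schwartz schwartz_L_pow) auto
      define a where "a = \<bar>f (T s ((L ^^ j) (T s \<psi>)))\<bar>"
      have "s ^ j * a \<le> C' * s ^ N * K1"
        unfolding a_def by (rule C'(2)[OF s(1) T\<psi> K1 w])
      also have "\<dots> = C' * (c * 2 ^ N * K) / s"
      proof -
        have "C' * y * (c / (y * y * s) * (2 ^ N * y) * K) = C' * (c * 2 ^ N * K) / s"
          if "y \<noteq> 0" for y :: real
          using that s(2) by (simp add: field_simps)
        moreover have "s ^ (2 * N + 1) = s ^ N * s ^ N * s" by (simp add: mult_2 power_add)
        then have "K1 = c / (s ^ N * s ^ N * s) * (2 ^ N * s ^ N) * K"
          by (simp only: K1_def power_mult_distrib)
        moreover have "s ^ N \<noteq> 0" using s(2) by simp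
        ultimately show ?thesis by blast
      qed
      finally have "2 ^ j * (s ^ j * a) / fact j \<le> 2 ^ j * (C' * (c * 2 ^ N * K) / s) / fact j"
        by (intro divide_right_mono mult_left_mono) auto
      also have "2 ^ j * (C' * (c * 2 ^ N * K) / s) / fact j = B / real k"
        using s(2) by (simp add: B_def s_def mult_ac)
      also have "2 ^ j * (s ^ j * a) / fact j = \<bar>real k ^ j / fact j * f (T (real k) ((L ^^ j) \<psi>))\<bar>"
        using s(2) unfolding e a_def[symmetric] abs_mult
        by (simp add: s_def power_divide)
      finally show "\<bar>real k ^ j / fact j * f (T (real k) ((L ^^ j) \<psi>))\<bar> \<le> B / real k" .
    qed
  qed
  then show ?thesis unfolding truncated_exp_def \<psi>_def[symmetric] by (intro tendsto_null_sum)
qed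

end

theorem proposition6p2:
  fixes \<mu> :: "'a::{metric_space, second_countable_topology} measure"
    and D :: "('a \<Rightarrow> real) set"
    and L :: "('a \<Rightarrow> real) \<Rightarrow> 'a \<Rightarrow> real"
    and T :: "real \<Rightarrow> ('a \<Rightarrow> real) \<Rightarrow> 'a \<Rightarrow> real"
    and H :: "real \<Rightarrow> 'a \<Rightarrow> 'a \<Rightarrow> real"
    and \<A> :: "('a set \<times> ('a \<Rightarrow> 'e::euclidean_space)) set"
    and \<kappa> m :: nat
    and X :: "nat \<Rightarrow> 'a \<Rightarrow> ('a \<Rightarrow> real) \<Rightarrow> real"
    and x\<^sub>0 :: 'a
    and XS XA :: "nat \<Rightarrow> ('a \<Rightarrow> real) \<Rightarrow> 'a \<Rightarrow> real"
    and f :: "('a \<Rightarrow> real) \<Rightarrow> real"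
  assumes "heat_manifold_distributions \<mu> D L T H \<A> \<kappa> X x\<^sub>0 XS XA"
    and "m \<ge> 1"
    and "f \<in> distributions \<mu> D L x\<^sub>0"
    and "property_S \<mu> D L x\<^sub>0 \<kappa> XA"
    and "condition_BP \<mu> D L x\<^sub>0 T \<kappa> XS"
  shows "\<exists>\<nu>. \<exists>\<rho>\<^sub>f \<in> polynomials \<mu> D L x\<^sub>0. \<exists>\<rho> :: nat \<Rightarrow> ('a \<Rightarrow> real) \<Rightarrow> real.
    (\<forall>k. \<rho> k \<in> polynomials_order \<mu> D L x\<^sub>0 \<nu>) \<and>
    (\<forall>k::nat. \<forall>\<phi> \<in> schwartz \<mu> D L x\<^sub>0.
       set_integrable lborel {0<..<real k} (calderon_integrand L T m f \<phi>)) \<and>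
    (\<exists>g. limitin (distribution_topology \<mu> D L x\<^sub>0)
           (\<lambda>k \<phi>. (LINT t:{0<..<real k}|lborel. calderon_integrand L T m f \<phi> t) + \<rho> k \<phi>)
           g sequentially \<and>
         (\<forall>\<phi> \<in> schwartz \<mu> D L x\<^sub>0. f \<phi> - \<rho>\<^sub>f \<phi> = 1 / fact (m - 1) * g \<phi>))"
proof -
  interpret heat_manifold_distributions \<mu> D L T H \<A> \<kappa> X x\<^sub>0 XS XA by (rule assms(1))
  note f = assms(3)
  obtain p where m: "m = Suc p" using assms(2) by (cases m) auto
  obtain N C where C: "of_order f N C" using distribution_bound[OF f] by blast
  define G where "G k = truncated_exp f p (real k)" for k :: nat
  have G: "G k \<in> distr" for k unfolding G_def using truncated_exp_distribution[OF f] by simp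
  obtain \<nu> where \<nu>: "\<forall>F :: nat \<Rightarrow> ('a \<Rightarrow> real) \<Rightarrow> real. (\<forall>k. F k \<in> distr) \<longrightarrow>
      (\<forall>J \<in> multi_indices \<kappa> (2 * (2 * N + 1)). converges_in_distributions \<mu> D L x\<^sub>0
          (\<lambda>k. iterated (\<lambda>j. by_duality (XA j)) J (F k))) \<longrightarrow>
      (\<exists>\<rho> :: nat \<Rightarrow> ('a \<Rightarrow> real) \<Rightarrow> real. (\<forall>k. \<rho> k \<in> polynomials_order \<mu> D L x\<^sub>0 \<nu>) \<and>
         converges_in_distributions \<mu> D L x\<^sub>0 (\<lambda>k \<phi>. F k \<phi> + \<rho> k \<phi>))"
    using spec[OF assms(4)[unfolded property_S_def], of "2 * (2 * N + 1)"] by (elim exE)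
  have conv: "\<forall>J\<in>multi_indices \<kappa> (2 * (2 * N + 1)). converges_in_distributions \<mu> D L x\<^sub>0
      (\<lambda>k. iterated (\<lambda>j. by_duality (XA j)) J (G k))"
  proof
    fix J assume J: "J \<in> multi_indices \<kappa> (2 * (2 * N + 1))"
    show "converges_in_distributions \<mu> D L x\<^sub>0 (\<lambda>k. iterated (\<lambda>j. by_duality (XA j)) J (G k))"
      unfolding converges_in_distributions_def limitin_distribution_topology
      using truncated_exp_XA_tendsto[OF f C _ J, of _ p] iterated_by_duality_distribution[OF J G] distr_zero
      by (intro exI[of _ "\<lambda>\<phi>. 0"]) (simp add: iterated_by_duality G_def)
  qed
  from \<nu>[THEN spec[of _ G], THEN mp, OF allI[OF G], THEN mp, OF conv]
  obtain \<rho> where \<rho>: "\<forall>k. \<rho> k \<in> polynomials_order \<mu> D L x\<^sub>0 \<nu>"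
    "converges_in_distributions \<mu> D L x\<^sub>0 (\<lambda>k \<phi>. G k \<phi> + \<rho> k \<phi>)"
    by (elim exE conjE)
  then obtain g where g: "g \<in> distr" "\<And>\<phi>. \<phi> \<in> S \<Longrightarrow> (\<lambda>k. G k \<phi> + \<rho> k \<phi>) \<longlonglongrightarrow> g \<phi>"
    unfolding converges_in_distributions_def limitin_distribution_topology by blast
  have \<rho>d: "\<rho> k \<in> distr" and \<rho>0: "\<phi> \<in> S \<Longrightarrow> \<rho> k ((L ^^ \<nu>) \<phi>) = 0" for k \<phi>
    using spec[OF \<rho>(1), of k] by (auto simp: polynomials_order_def by_duality_def)
  \<comment> \<open>\<open>L ^^ \<nu>\<close> kills the correction \<open>\<rho> k\<close>, and \<open>L ^^ Suc N\<close> makes \<open>G k\<close> decay.\<close>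
  have "g ((L ^^ (\<nu> + Suc N)) \<phi>) = 0" if \<phi>: "\<phi> \<in> S" for \<phi>
  proof (rule LIMSEQ_unique)
    show "(\<lambda>k. G k ((L ^^ (\<nu> + Suc N)) \<phi>) + \<rho> k ((L ^^ (\<nu> + Suc N)) \<phi>)) \<longlonglongrightarrow> g ((L ^^ (\<nu> + Suc N)) \<phi>)"
      using g(2) schwartz_L_pow[OF \<phi>] by blast
    have "(\<lambda>k. G k ((L ^^ Suc N) ((L ^^ \<nu>) \<phi>))) \<longlonglongrightarrow> 0"
      unfolding G_def by (rule truncated_exp_L_pow_tendsto[OF f C schwartz_L_pow[OF \<phi>]])
    moreover have "(L ^^ Suc N) ((L ^^ \<nu>) \<phi>) = (L ^^ (\<nu> + Suc N)) \<phi>"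
      by (metis add.commute comp_apply funpow_add)
    moreover have "\<rho> k ((L ^^ (\<nu> + Suc N)) \<phi>) = 0" for k
      using \<rho>0[OF schwartz_L_pow[OF \<phi>, of "Suc N"], of k] by (simp only: funpow_add o_apply)
    ultimately show "(\<lambda>k. G k ((L ^^ (\<nu> + Suc N)) \<phi>) + \<rho> k ((L ^^ (\<nu> + Suc N)) \<phi>)) \<longlonglongrightarrow> 0" by simp
  qed
  then have "g \<in> polynomials_order \<mu> D L x\<^sub>0 (\<nu> + Suc N)"
    using g(1) by (simp add: polynomials_order_def by_duality_def)
  then have gp: "g \<in> polynomials \<mu> D L x\<^sub>0" unfolding polynomials_def by blast
  \<comment> \<open>The integral is \<open>p! (f - G\<^sub>k)\<close>, hence the factor.\<close>
  define \<sigma> where "\<sigma> k \<phi> = - fact p * \<rho> k \<phi>" for k \<phi>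
  have \<sigma>: "\<sigma> k \<in> polynomials_order \<mu> D L x\<^sub>0 \<nu>" for k
    using distr_scale[OF \<rho>d[of k], of "- fact p"] \<rho>0[of _ k]
    by (simp add: polynomials_order_def by_duality_def \<sigma>_def[abs_def])
  define h where "h \<phi> = fact p * (f \<phi> - g \<phi>)" for \<phi>
  define I where "I k \<phi> = (LINT t:{0<..<real k}|lborel. calderon_integrand L T (Suc p) f \<phi> t) + \<sigma> k \<phi>" for k \<phi>
  have I: "I k \<phi> = fact p * (f \<phi> + (- 1) * (G k \<phi> + \<rho> k \<phi>))" if "\<phi> \<in> S" for k \<phi>
    unfolding I_def calderon_integral(2)[OF f that] G_def \<sigma>_def by (simp add: algebra_simps)
  have "(\<lambda>\<phi>. fact p * (f \<phi> + (- 1) * (G k \<phi> + \<rho> k \<phi>))) \<in> distr" for k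
    by (intro distr_scale distr_add f G \<rho>d)
  then have Id: "I k \<in> distr" for k by (rule distr_cong) (simp add: I)
  have hd: "h \<in> distr"
    using distr_scale[OF distr_add[OF f distr_scale[OF g(1), of "-1"]], of "fact p"]
    by (simp add: h_def[abs_def])
  have "(\<lambda>k. I k \<phi>) \<longlonglongrightarrow> h \<phi>" if \<phi>: "\<phi> \<in> S" for \<phi>
  proof -
    have "(\<lambda>k. fact p * (f \<phi> + (- 1) * (G k \<phi> + \<rho> k \<phi>))) \<longlonglongrightarrow> fact p * (f \<phi> + (- 1) * g \<phi>)"
      by (intro tendsto_intros g(2) \<phi>)
    then show ?thesis by (simp add: I[OF \<phi>] h_def)
  qed
  then have lim: "limitin (distribution_topology \<mu> D L x\<^sub>0) I h sequentially"
    unfolding limitin_distribution_topology using Id hd by simp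
  show ?thesis
    unfolding m diff_Suc_1
  proof (intro exI bexI conjI allI ballI)
    show "\<sigma> k \<in> polynomials_order \<mu> D L x\<^sub>0 \<nu>" for k by (rule \<sigma>)
    show "set_integrable lborel {0<..<real k} (calderon_integrand L T (Suc p) f \<phi>)" if "\<phi> \<in> S" for k \<phi>
      by (rule calderon_integral(1)[OF f that])
    show "limitin (distribution_topology \<mu> D L x\<^sub>0)
        (\<lambda>k \<phi>. (LINT t:{0<..<real k}|lborel. calderon_integrand L T (Suc p) f \<phi> t) + \<sigma> k \<phi>) h sequentially"
      using lim unfolding I_def[abs_def] .
    show "f \<phi> - g \<phi> = 1 / fact p * h \<phi>" for \<phi> by (simp add: h_def)
    show "g \<in> polynomials \<mu> D L x\<^sub>0" by (rule gp)
  qed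
qed

end
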